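(* Let $(B(t),\,t\ge 0)$ be a standard one-dimensional Brownian motion started at $0$, let $\ell(y,t)$ denote its (occupation density) local time at level $y\in\mathbb{R}$ up to time $t\ge 0$, and let $K(t) := \big(B(t),\,\ell(B(t),t)\big)$ for $t\ge 0$. Then, almost surely, the path $t\mapsto K(t)$ is continuous on $[0,\infty)$, and, almost surely, it fills the closed upper half-plane, i.e. $\{K(t)\colon t\ge 0\} = \mathbb{R}\times[0,\infty)$.
   Context: The local time of the Brownian motion $B$ is defined by $$\ell(y,t) := \lim_{\epsilon\to 0}(2\epsilon)^{-1}\,\mathrm{Leb}\{u\in[0,t]\colon |B(u)-y|<\epsilon\},\qquad y\in\mathbb{R},\ t\ge 0,$$ where $\mathrm{Leb}$ is Lebesgue measure on $\mathbb{R}$. It is a standard fact (Trotter's theorem) that there is an event of probability one on which this limit exists simultaneously for all $(y,t)\in\mathbb{R}\times[0,\infty)$ and is jointly continuous in $(y,t)$; $\ell$ denotes this random field. The process $K$ is called the Brownian bricklayer. *)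

theory Defs
  imports "HOL-Probability.Probability"
begin

locale standard_brownian_motion = prob_space M
  for M :: "'a measure" +
  fixes B :: "real \<Rightarrow> 'a \<Rightarrow> real"
  assumes rv: "t \<ge> 0 \<Longrightarrow> random_variable borel (B t)"
    and start: "AE \<omega> in M. B 0 \<omega> = 0"
    and independent_increments:
      "\<lbrakk>0 \<le> \<tau> 0; \<forall>i<n. \<tau> i \<le> \<tau> (Suc i)\<rbrakk> \<Longrightarrow>
        indep_vars (\<lambda>_. borel) (\<lambda>i \<omega>. B (\<tau> (Suc i)) \<omega> - B (\<tau> i) \<omega>) {..<n::nat}"
    and normal_increments:
      "\<lbrakk>0 \<le> s; s < t\<rbrakk> \<Longrightarrow>
        distributed M lborel (\<lambda>\<omega>. B t \<omega> - B s \<omega>) (normal_density 0 (sqrt (t - s)))"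
    and continuous_paths: "AE \<omega> in M. continuous_on {0..} (\<lambda>t. B t \<omega>)"

text \<open>
  Both definitions below act on a single path \<open>b\<close>. If the limit does not exist, the value of
  \<^const>\<open>Lim\<close> is unspecified; for Brownian paths this concerns a null set only, by Trotter's theorem.
\<close>

definition local_time :: "(real \<Rightarrow> real) \<Rightarrow> real \<Rightarrow> real \<Rightarrow> real" where
  "local_time b y t =
     Lim (at_right 0) (\<lambda>\<epsilon>. measure lebesgue {u \<in> {0..t}. \<bar>b u - y\<bar> < \<epsilon>} / (2 * \<epsilon>))"

definition bricklayer :: "(real \<Rightarrow> real) \<Rightarrow> real \<Rightarrow> real \<times> real" where
  "bricklayer b t = (b t, local_time b (b t) t)"

end

theory Submission
  imports Defs
begin

text \<open>
  Let \<open>d n k t\<close> be the density at dyadic level \<open>n\<close> of the occupation measure of the path up to time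
  \<open>t\<close>, that is \<open>2 ^ n\<close> times the time spent in the \<open>k\<close>-th dyadic interval of length \<open>2 ^ -n\<close>. The
  difference \<open>d n (k + 1) t - d n k t\<close> is an integral \<open>\<integral>\<^sub>0\<^sup>t g (B u) du\<close> in which \<open>g\<close> has mean zero and
  support of length \<open>2 * 2 ^ -n\<close>. By the Markov property its moments are iterated integrals against the
  heat kernel, and the mean zero condition gives an \<open>8\<close>-th moment of order \<open>t\<^sup>2 * 16 ^ -n\<close>. As \<open>d n k\<close>
  has Lipschitz constant \<open>2 ^ n\<close> in time, only about \<open>8 ^ n\<close> space-time points matter at level \<open>n\<close>, so
  Borel-Cantelli makes neighbouring densities differ by at most \<open>\<theta> ^ n\<close> with \<open>\<theta> < 1\<close>. Hence the dyadic
  densities converge locally uniformly to a jointly continuous limit, which is the local time.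

  For surjectivity, the local time at every level must be unbounded. The same moment bound
  shows that over \<open>\<bar>y\<bar> \<le> N\<close> the local time at a large time \<open>T = S ^ 6\<close> oscillates by \<open>O (S\<^sup>2)\<close>, whereas the
  renewal equation for the Laplace transform of the time spent in \<open>[-1, 1)\<close> shows that this time is
  larger than any multiple of \<open>S\<^sup>2\<close> with probability \<open>1 - O (1 / S)\<close>. Finally, the last time at
  which the local time at \<open>y\<close> is at most \<open>h\<close> is a time at which the path is at \<open>y\<close>.
\<close>

section \<open>Local time of a path with regular dyadic occupation densities\<close>

text \<open>The exponents are forced by scaling. One integration against \<open>g\<close> costs
  about \<open>h * sqrt t\<close> with \<open>h = 2 ^ -n\<close>; exploiting the mean zero of
  \<open>g\<close> in every other integration turns a pair into \<open>h ^ 3 * sqrt t\<close>, so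
  that the moment of order \<open>2 * k\<close> of a density difference is of size
  \<open>2 ^ -(n * k)\<close>, up to powers of \<open>t\<close>. Against \<open>8 ^ n\<close>
  space-time points, \<open>k = 3\<close> just fails to be summable and \<open>k = 4\<close> leaves
  a factor \<open>2 ^ -n\<close>, which pays for the geometric rate: any \<theta> < 1 with
  \<open>2 * \<theta> ^ 8 > 1\<close> will do. At time \<open>T\<close> the local time has size
  \<open>sqrt T\<close>, but its oscillation over a bounded range of levels only
  \<open>T ^ (1/4)\<close>. With \<open>T = S ^ 6\<close> these are \<open>S ^ 3\<close> and
  \<open>S ^ (3/2)\<close>, and \<open>S\<^sup>2\<close> lies strictly between. Hence a single lower
  bound on the time spent near 0 makes the local time large at all levels of a bounded range at
  once. Statements about all levels and times simultaneously are proved for one path that satisfies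
  countably many dyadic inequalities; probability enters only in verifying these
  inequalities.\<close>

definition occ :: "(real \<Rightarrow> real) \<Rightarrow> real \<Rightarrow> real set \<Rightarrow> real" where
  "occ b t A = measure lborel {u \<in> {0..t}. b u \<in> A}"

definition dens :: "(real \<Rightarrow> real) \<Rightarrow> nat \<Rightarrow> int \<Rightarrow> real \<Rightarrow> real" where
  "dens b n k t = 2 ^ n * occ b t {real_of_int k / 2 ^ n ..< (real_of_int k + 1) / 2 ^ n}"

lemma dyadic_round:
  fixes x :: real
  shows "real_of_int \<lfloor>x * 2 ^ n\<rfloor> / 2 ^ n \<le> x" "x - 1 / 2 ^ n < real_of_int \<lfloor>x * 2 ^ n\<rfloor> / 2 ^ n"
    "x \<le> real_of_int \<lceil>x * 2 ^ n\<rceil> / 2 ^ n" "real_of_int \<lceil>x * 2 ^ n\<rceil> / 2 ^ n < x + 1 / 2 ^ n"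
proof -
  have *: "real_of_int \<lfloor>x * 2 ^ n\<rfloor> \<le> x * 2 ^ n" "x * 2 ^ n - 1 < real_of_int \<lfloor>x * 2 ^ n\<rfloor>"
    "x * 2 ^ n \<le> real_of_int \<lceil>x * 2 ^ n\<rceil>" "real_of_int \<lceil>x * 2 ^ n\<rceil> < x * 2 ^ n + 1"
    using floor_correct[of "x * 2 ^ n"] ceiling_correct[of "x * 2 ^ n"] by auto
  show "real_of_int \<lfloor>x * 2 ^ n\<rfloor> / 2 ^ n \<le> x" "x \<le> real_of_int \<lceil>x * 2 ^ n\<rceil> / 2 ^ n"
    using *(1,3) by (simp_all add: divide_le_eq le_divide_eq)
  show "x - 1 / 2 ^ n < real_of_int \<lfloor>x * 2 ^ n\<rfloor> / 2 ^ n" 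
    using divide_strict_right_mono[OF *(2), of "2 ^ n"] by (simp add: diff_divide_distrib)
  show "real_of_int \<lceil>x * 2 ^ n\<rceil> / 2 ^ n < x + 1 / 2 ^ n"
    using divide_strict_right_mono[OF *(4), of "2 ^ n"] by (simp add: add_divide_distrib)
qed

text \<open>Continuity is asked for on the whole line, although only times in \<open>{0..}\<close>
  matter, so that \<open>b\<close> is Borel measurable outright.
  \<open>continuous_modification\<close> supplies paths of this kind.\<close>

locale continuous_path =
  fixes b :: "real \<Rightarrow> real"
  assumes cont: "continuous_on UNIV b"
begin

lemma measurable_path [measurable]: "b \<in> borel_measurable borel"
  using cont by (rule borel_measurable_continuous_onI)

lemma occ_sets:
  assumes "A \<in> sets borel"
  shows "{u \<in> {0..t}. b u \<in> A} \<in> fmeasurable lborel"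
proof (rule fmeasurableI2)
  show "{0..t} \<in> fmeasurable lborel" by (simp add: fmeasurable_compact)
  show "{u \<in> {0..t}. b u \<in> A} \<in> sets lborel"
    using assms by measurable
qed auto

lemma occ_nonneg: "0 \<le> occ b t A"
  by (simp add: occ_def)

lemma occ_mono:
  assumes "A \<subseteq> A'" "t \<le> t'" "A \<in> sets borel" "A' \<in> sets borel"
  shows "occ b t A \<le> occ b t' A'"
  unfolding occ_def
  by (rule measure_mono_fmeasurable) (use assms occ_sets in \<open>auto intro!: occ_sets fmeasurableD[OF occ_sets]\<close>)

lemma occ_Un:
  assumes "A \<inter> A' = {}" "A \<in> sets borel" "A' \<in> sets borel"
  shows "occ b t (A \<union> A') = occ b t A + occ b t A'"
proof -
  have "{u \<in> {0..t}. b u \<in> A \<union> A'} = {u \<in> {0..t}. b u \<in> A} \<union> {u \<in> {0..t}. b u \<in> A'}"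
    by auto
  moreover have "measure lborel ({u \<in> {0..t}. b u \<in> A} \<union> {u \<in> {0..t}. b u \<in> A'})
     = occ b t A + occ b t A'"
    unfolding occ_def using assms by (intro measure_Un2[THEN trans] occ_sets) 
      (auto intro!: arg_cong[where f = "measure lborel"])
  ultimately show ?thesis by (simp add: occ_def)
qed

text \<open>The set \<open>A'\<close> leaves room for two uses: \<open>UNIV\<close> gives the
  Lipschitz constant 1 in time, and the empty set shows that no time accrues while the path avoids
  \<open>A\<close>.\<close>

lemma occ_time_increment:
  assumes "0 \<le> t" "t \<le> t'" "A \<in> sets borel" "A' \<in> sets borel"
    and "\<And>u. t < u \<Longrightarrow> u \<le> t' \<Longrightarrow> b u \<in> A \<Longrightarrow> b u \<in> A'"
  shows "occ b t' A \<le> occ b t A + measure lborel {u \<in> {t..t'}. b u \<in> A'}"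
proof -
  have m: "{u \<in> {t..t'}. b u \<in> A'} \<in> fmeasurable lborel"
    by (rule fmeasurableI2[where A = "{t..t'}"]) (use assms in \<open>auto simp: fmeasurable_compact\<close>)
  have "occ b t' A \<le> measure lborel ({u \<in> {0..t}. b u \<in> A} \<union> {u \<in> {t..t'}. b u \<in> A'})"
    unfolding occ_def
  proof (rule measure_mono_fmeasurable)
    show "{u \<in> {0..t'}. b u \<in> A} \<subseteq> {u \<in> {0..t}. b u \<in> A} \<union> {u \<in> {t..t'}. b u \<in> A'}"
    proof
      fix u assume "u \<in> {u \<in> {0..t'}. b u \<in> A}"
      then show "u \<in> {u \<in> {0..t}. b u \<in> A} \<union> {u \<in> {t..t'}. b u \<in> A'}"
        using assms(5)[of u] by (cases "u \<le> t") auto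
    qed
  qed (use assms occ_sets m in \<open>auto intro!: fmeasurable.Un fmeasurableD\<close>)
  also have "\<dots> \<le> occ b t A + measure lborel {u \<in> {t..t'}. b u \<in> A'}"
    unfolding occ_def by (rule measure_Un_le) (use assms occ_sets m in \<open>auto intro: fmeasurableD\<close>)
  finally show ?thesis .
qed

lemma occ_time_lipschitz:
  assumes "0 \<le> t" "t \<le> t'" "A \<in> sets borel"
  shows "occ b t' A \<le> occ b t A + (t' - t)"
proof -
  have "occ b t' A \<le> occ b t A + measure lborel {u \<in> {t..t'}. b u \<in> UNIV}"
    by (rule occ_time_increment) (use assms in auto)
  also have "{u \<in> {t..t'}. b u \<in> UNIV} = {t..t'}" by auto
  finally show ?thesis using assms by simp
qed

lemma dens_nonneg: "0 \<le> dens b n k t"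
  by (simp add: dens_def occ_nonneg)

lemma dens_time_lipschitz:
  assumes "0 \<le> t" "0 \<le> t'"
  shows "\<bar>dens b n k t' - dens b n k t\<bar> \<le> 2 ^ n * \<bar>t' - t\<bar>"
proof -
  let ?A = "{real_of_int k / 2 ^ n ..< (real_of_int k + 1) / 2 ^ n}"
  have "\<bar>occ b t' ?A - occ b t ?A\<bar> \<le> \<bar>t' - t\<bar>"
    using occ_time_lipschitz[of t t' ?A] occ_time_lipschitz[of t' t ?A]
      occ_mono[of ?A ?A t t'] occ_mono[of ?A ?A t' t] assms by fastforce
  then have "2 ^ n * \<bar>occ b t' ?A - occ b t ?A\<bar> \<le> 2 ^ n * \<bar>t' - t\<bar>"
    by simp
  then show ?thesis by (simp add: dens_def abs_mult flip: right_diff_distrib)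
qed

text \<open>A dyadic interval is the disjoint union of its halves, so the densities behave like a
  martingale in \<open>n\<close>. A refinement changes the density by no more than the difference of
  two neighbours, which is why only such differences need probabilistic control.\<close>

lemma dens_split: "dens b n k t = (dens b (Suc n) (2 * k) t + dens b (Suc n) (2 * k + 1) t) / 2"
proof -
  have eq: "{real_of_int k / 2 ^ n ..< (real_of_int k + 1) / 2 ^ n} =
     {real_of_int (2 * k) / 2 ^ Suc n ..< (real_of_int (2 * k) + 1) / 2 ^ Suc n} \<union>
     {real_of_int (2 * k + 1) / 2 ^ Suc n ..< (real_of_int (2 * k + 1) + 1) / 2 ^ Suc n}"
    by (auto simp: field_simps)
  show ?thesis
    unfolding dens_def eq
    by (subst occ_Un) (auto simp: field_simps)
qed

text \<open>Adding up cells turns a uniform estimate of the densities into one for intervals with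
  dyadic end points; \<open>L_window\<close> squeezes an arbitrary window between such
  intervals.\<close>

lemma occ_dyadic_interval:
  assumes "\<And>j. j < m \<Longrightarrow> \<bar>dens b n (k + int j) t - c\<bar> \<le> \<eta>"
  shows "\<bar>2 ^ n * occ b t {real_of_int k / 2 ^ n ..< (real_of_int k + real m) / 2 ^ n} - real m * c\<bar> \<le> real m * \<eta>"
  using assms
proof (induction m)
  case 0
  then show ?case by (simp add: occ_def)
next
  case (Suc m)
  have eq: "{real_of_int k / 2 ^ n ..< (real_of_int k + real (Suc m)) / 2 ^ n} =
     {real_of_int k / 2 ^ n ..< (real_of_int k + real m) / 2 ^ n} \<union>
     {real_of_int (k + int m) / 2 ^ n ..< (real_of_int (k + int m) + 1) / 2 ^ n}"
    by (auto simp: field_simps)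
  have IH: "\<bar>2 ^ n * occ b t {real_of_int k / 2 ^ n ..< (real_of_int k + real m) / 2 ^ n} - real m * c\<bar> \<le> real m * \<eta>"
    using Suc by auto
  have "2 ^ n * occ b t {real_of_int k / 2 ^ n ..< (real_of_int k + real (Suc m)) / 2 ^ n} =
     2 ^ n * occ b t {real_of_int k / 2 ^ n ..< (real_of_int k + real m) / 2 ^ n} + dens b n (k + int m) t"
    unfolding eq by (subst occ_Un) (auto simp: dens_def field_simps)
  then show ?case using IH Suc.prems[of m] by (simp add: algebra_simps)
qed


text \<open>The definition measures with \<open>lebesgue\<close> and \<open>occ\<close> with
  \<open>lborel\<close>; the two agree because the set in question is Borel.\<close>

lemma local_time_eq:
  assumes "((\<lambda>\<epsilon>. occ b t {y - \<epsilon> <..< y + \<epsilon>} / (2 * \<epsilon>)) \<longlongrightarrow> l) (at_right 0)"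
  shows "local_time b y t = l"
proof -
  have "measure lebesgue {u \<in> {0..t}. \<bar>b u - y\<bar> < \<epsilon>} = occ b t {y - \<epsilon> <..< y + \<epsilon>}" for \<epsilon>
  proof -
    have "{u \<in> {0..t}. \<bar>b u - y\<bar> < \<epsilon>} = {u \<in> {0..t}. b u \<in> {y - \<epsilon> <..< y + \<epsilon>}}"
      by auto
    then show ?thesis using occ_sets[of "{y - \<epsilon> <..< y + \<epsilon>}" t]
      by (simp add: occ_def fmeasurable_def)
  qed
  then show ?thesis unfolding local_time_def using assms
    by (intro tendsto_Lim) auto
qed

lemma occ_avoid:
  assumes "0 \<le> t" "t \<le> t'" "A \<in> sets borel" "\<And>u. t < u \<Longrightarrow> u \<le> t' \<Longrightarrow> b u \<notin> A"
  shows "occ b t' A = occ b t A"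
proof (rule antisym)
  show "occ b t' A \<le> occ b t A"
    using occ_time_increment[of t t' A "{}"] assms by auto
  show "occ b t A \<le> occ b t' A" using assms by (intro occ_mono) auto
qed

text \<open>The deterministic half of the theorem. Right after the last time with
  \<open>l y t \<le> h\<close> the local time at \<open>y\<close> must grow, and it can grow only
  while the path is near \<open>y\<close>; continuity in time makes its value there exactly
  \<open>h\<close>.\<close>

lemma bricklayer_surj:
  assumes lim: "\<And>y t. 0 \<le> t \<Longrightarrow> ((\<lambda>\<epsilon>. occ b t {y - \<epsilon> <..< y + \<epsilon>} / (2 * \<epsilon>)) \<longlongrightarrow> l y t) (at_right 0)"
    and lcont: "continuous_on (UNIV \<times> {0..}) (\<lambda>(y, t). l y t)"
    and unbdd: "\<And>y m. \<exists>t\<ge>0. m < l y t"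
  shows "continuous_on {0..} (bricklayer b)" "bricklayer b ` {0..} = UNIV \<times> {0..}"
proof -
  have br: "bricklayer b t = (b t, l (b t) t)" if "0 \<le> t" for t
    using local_time_eq[OF lim[OF that]] by (simp add: bricklayer_def)
  have "continuous_on {0..} (\<lambda>t. (\<lambda>(y, t). l y t) (b t, t))"
    by (rule continuous_on_compose2[OF lcont])
      (auto intro!: continuous_intros continuous_on_subset[OF cont])
  then have "continuous_on {0..} (\<lambda>t. (b t, l (b t) t))"
    by (auto intro!: continuous_intros continuous_on_subset[OF cont])
  then show "continuous_on {0..} (bricklayer b)"
    by (subst continuous_on_cong[OF refl br]) auto
  have nonneg: "0 \<le> l y t" if "0 \<le> t" for y t
    by (rule tendsto_lowerbound[OF lim[OF that]])
      (auto simp: eventually_at_right_less occ_nonneg intro!: eventually_at_rightI[of 0 1])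
  have mono: "l y t \<le> l y t'" if "0 \<le> t" "t \<le> t'" for y t t'
    by (rule tendsto_le[OF _ lim lim])
      (use that in \<open>auto intro!: eventually_at_rightI[of 0 1] divide_right_mono occ_mono\<close>)
  have zero: "l y 0 = 0" for y
  proof -
    have "((\<lambda>\<epsilon>. occ b 0 {y - \<epsilon> <..< y + \<epsilon>} / (2 * \<epsilon>)) \<longlongrightarrow> 0) (at_right 0)"
    proof (rule tendsto_eventually, rule always_eventually, rule allI)
      fix \<epsilon>
      have "occ b 0 {y - \<epsilon> <..< y + \<epsilon>} \<le> measure lborel {0 :: real}"
        unfolding occ_def by (rule measure_mono_fmeasurable)
          (use fmeasurableD[OF occ_sets[of "{y - \<epsilon> <..< y + \<epsilon>}" 0]] in \<open>auto simp: fmeasurable_compact\<close>)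
      then show "occ b 0 {y - \<epsilon> <..< y + \<epsilon>} / (2 * \<epsilon>) = 0"
        using occ_nonneg[of 0 "{y - \<epsilon> <..< y + \<epsilon>}"] by (simp add: measure_lborel_singleton)
    qed
    then show ?thesis using lim[of 0 y] by (intro tendsto_unique[of "at_right (0::real)"]) auto
  qed
  have lycont: "continuous_on {0..} (l y)" for y
  proof -
    have "continuous_on {0..} (\<lambda>t. (\<lambda>(y, t). l y t) (y, t))"
      by (rule continuous_on_compose2[OF lcont]) (auto intro!: continuous_intros)
    then show ?thesis by simp
  qed
  show "bricklayer b ` {0..} = UNIV \<times> {0..}"
  proof (intro equalityI subsetI)
    fix z assume "z \<in> bricklayer b ` {0..}"
    then show "z \<in> UNIV \<times> {0..}" using br nonneg by auto
  next
    fix z :: "real \<times> real" assume "z \<in> UNIV \<times> {0..}"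
    then obtain y h where z: "z = (y, h)" "0 \<le> h" by auto
    define S where "S = {t \<in> {0..}. l y t \<le> h}"
    obtain T where T: "T \<ge> 0" "h < l y T" using unbdd by blast
    have "t \<le> T" if "t \<in> S" for t
    proof (rule ccontr)
      assume "\<not> t \<le> T"
      then have "l y T \<le> l y t" using T by (intro mono) auto
      then show False using that T by (simp add: S_def)
    qed
    then have bdd: "bdd_above S" by (rule bdd_aboveI)
    have ne: "0 \<in> S" using z by (simp add: S_def zero)
    have "closed ({0..} \<inter> l y -` {..h})"
      by (rule continuous_closed_preimage[OF lycont closed_atLeast closed_atMost])
    also have "{0..} \<inter> l y -` {..h} = S" unfolding S_def by blast
    finally have "closed S" .
    then have t0: "Sup S \<in> S" using bdd ne by (intro closed_contains_Sup) auto
    define t0 where "t0 = Sup S"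
    have t0S: "0 \<le> t0" "l y t0 \<le> h" using t0 by (auto simp: S_def t0_def)
    have after: "h < l y t" if "t0 < t" for t
    proof -
      have "t \<notin> S"
      proof
        assume "t \<in> S"
        then have "t \<le> t0" unfolding t0_def using bdd by (rule cSup_upper)
        with that show False by simp
      qed
      then show ?thesis using that t0S by (simp add: S_def)
    qed
    \<comment> \<open>Only the limit from the right is used: \<open>t0\<close> may be 0, and all
      later times satisfy \<open>h < l y t\<close>.\<close>
    have "(l y \<longlongrightarrow> l y t0) (at t0 within {0..})"
      using lycont[of y] t0S by (simp add: continuous_on_def)
    then have "(l y \<longlongrightarrow> l y t0) (at_right t0)"
      by (rule tendsto_within_subset) (use t0S in auto)
    moreover have "\<forall>\<^sub>F t in at_right t0. h \<le> l y t"
      by (rule eventually_at_rightI[of t0 "t0 + 1"]) (simp_all add: less_imp_le[OF after])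
    ultimately have "h \<le> l y t0"
      by (rule tendsto_lowerbound) simp
    with t0S have lh: "l y t0 = h" by simp
    have "b t0 = y"
    proof (rule ccontr)
      assume ne: "b t0 \<noteq> y"
      \<comment> \<open>Half the distance, so that the intervals of radius \<open>r\<close> around
        \<open>b t0\<close> and around \<open>y\<close> are disjoint. Up to \<open>t1\<close> the
        path then adds nothing to small windows at \<open>y\<close>, contrary to the growth right
        after \<open>t0\<close>.\<close>
      define r where "r = dist (b t0) y / 2"
      have r: "r > 0" using ne by (simp add: r_def)
      have "isCont b t0" using cont by (simp add: continuous_on_eq_continuous_at)
      then obtain d where d: "d > 0" "\<And>u. dist u t0 < d \<Longrightarrow> dist (b u) (b t0) < r"
        using r unfolding continuous_at_eps_delta by (auto simp: dist_commute)
      define t1 where "t1 = t0 + d / 2"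
      have "occ b t1 {y - \<epsilon> <..< y + \<epsilon>} = occ b t0 {y - \<epsilon> <..< y + \<epsilon>}" if "0 < \<epsilon>" "\<epsilon> < r" for \<epsilon>
      proof (rule occ_avoid)
        fix u assume "t0 < u" "u \<le> t1"
        then have "dist (b u) (b t0) < r" using d by (auto simp: t1_def dist_real_def)
        then show "b u \<notin> {y - \<epsilon> <..< y + \<epsilon>}" using that
          by (auto simp: r_def dist_real_def abs_if split: if_splits)
      qed (use t0S d in \<open>auto simp: t1_def\<close>)
      then have "\<forall>\<^sub>F \<epsilon> in at_right 0. occ b t1 {y - \<epsilon> <..< y + \<epsilon>} / (2 * \<epsilon>) = occ b t0 {y - \<epsilon> <..< y + \<epsilon>} / (2 * \<epsilon>)"
        using r by (intro eventually_at_rightI[of 0 r]) auto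
      then have "((\<lambda>\<epsilon>. occ b t0 {y - \<epsilon> <..< y + \<epsilon>} / (2 * \<epsilon>)) \<longlongrightarrow> l y t1) (at_right 0)"
        by (rule Lim_transform_eventually[OF lim, rotated]) (use t0S d in \<open>simp add: t1_def\<close>)
      then have "l y t1 = l y t0"
        using lim[of t0 y] t0S by (intro tendsto_unique[of "at_right (0::real)"]) auto
      with after[of t1] lh d show False by (simp add: t1_def)
    qed
    then have "bricklayer b t0 = z" using br[of t0] t0S lh z by simp
    then show "z \<in> bricklayer b ` {0..}" using t0S by force
  qed
qed

section \<open>Convergence of the dyadic densities of a fixed path\<close>

definition path_density :: "nat \<Rightarrow> real \<Rightarrow> real \<Rightarrow> real" where
  "path_density n y t = dens b n \<lfloor>y * 2 ^ n\<rfloor> t"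

text \<open>The cell of \<open>y\<close> at level \<open>Suc n\<close> is one of the halves of its
  cell at level \<open>n\<close>, whose density is the mean of the two.\<close>

lemma path_density_Suc:
  assumes "\<bar>dens b (Suc n) (2 * \<lfloor>y * 2 ^ n\<rfloor> + 1) t - dens b (Suc n) (2 * \<lfloor>y * 2 ^ n\<rfloor>) t\<bar> \<le> c"
  shows "\<bar>path_density (Suc n) y t - path_density n y t\<bar> \<le> c"
proof -
  have "\<lfloor>y * 2 ^ Suc n\<rfloor> = 2 * \<lfloor>y * 2 ^ n\<rfloor> \<or> \<lfloor>y * 2 ^ Suc n\<rfloor> = 2 * \<lfloor>y * 2 ^ n\<rfloor> + 1"
  proof -
    have "y * 2 ^ Suc n = 2 * (y * 2 ^ n)" by simp
    then show ?thesis by linarith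
  qed
  moreover have "\<bar>u - (u + v) / 2\<bar> \<le> c \<and> \<bar>v - (u + v) / 2\<bar> \<le> c" if "\<bar>v - u\<bar> \<le> c" for u v :: real
    using that by (simp add: abs_le_iff field_simps)
  note this[OF assms]
  ultimately show ?thesis
    unfolding path_density_def dens_split[of n "\<lfloor>y * 2 ^ n\<rfloor>" t] by auto
qed

lemma floor_bound:
  assumes "\<bar>y\<bar> \<le> real N"
  shows "\<bar>\<lfloor>y * 2 ^ n\<rfloor>\<bar> \<le> int N * 2 ^ n"
proof -
  have "- (real N * 2 ^ n) \<le> y * 2 ^ n" "y * 2 ^ n \<le> real N * 2 ^ n"
    using assms mult_right_mono[of "- real N" y "2 ^ n"] mult_right_mono[of y "real N" "2 ^ n"]
    by auto
  then have "- (int N * 2 ^ n) \<le> \<lfloor>y * 2 ^ n\<rfloor>"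
    by (simp add: le_floor_iff)
  moreover have "real_of_int \<lfloor>y * 2 ^ n\<rfloor> \<le> real_of_int (int N * 2 ^ n)"
    using order_trans[OF of_int_floor_le[of "y * 2 ^ n"] \<open>y * 2 ^ n \<le> real N * 2 ^ n\<close>] by simp
  then have "\<lfloor>y * 2 ^ n\<rfloor> \<le> int N * 2 ^ n" by (simp only: of_int_le_iff)
  ultimately show ?thesis by linarith
qed

text \<open>Telescoping with a geometric majorant. The factor \<open>c\<close> and the threshold
  \<open>n\<^sub>0\<close> serve two uses: \<open>c = 3\<close> beyond a path-dependent level for
  the existence of the limit, and a large \<open>c\<close> from level 0 on for the lower bound on
  the local time.\<close>

lemma path_density_tail:
  assumes \<theta>: "0 \<le> \<theta>" "\<theta> < 1" and y: "\<bar>y\<bar> \<le> real N" and c: "0 \<le> c"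
    and H: "\<And>n k. n\<^sub>0 \<le> n \<Longrightarrow> \<bar>k\<bar> \<le> int N * 2 ^ n \<Longrightarrow> \<bar>dens b n (k + 1) t - dens b n k t\<bar> \<le> c * \<theta> ^ n"
    and nm: "n\<^sub>0 \<le> n" "n \<le> m"
  shows "\<bar>path_density m y t - path_density n y t\<bar> \<le> c / (1 - \<theta>) * \<theta> ^ n"
proof -
  have step: "\<bar>path_density (Suc i) y t - path_density i y t\<bar> \<le> c * \<theta> ^ i" if "n\<^sub>0 \<le> i" for i
  proof (rule path_density_Suc)
    have "\<bar>2 * \<lfloor>y * 2 ^ i\<rfloor>\<bar> \<le> int N * 2 ^ Suc i" using floor_bound[OF y, of i] by simp
    then have "\<bar>dens b (Suc i) (2 * \<lfloor>y * 2 ^ i\<rfloor> + 1) t - dens b (Suc i) (2 * \<lfloor>y * 2 ^ i\<rfloor>) t\<bar> \<le> c * \<theta> ^ Suc i"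
      using that by (intro H) auto
    also have "\<dots> \<le> c * \<theta> ^ i" using \<theta> c by (intro mult_left_mono power_decreasing) auto
    finally show "\<bar>dens b (Suc i) (2 * \<lfloor>y * 2 ^ i\<rfloor> + 1) t - dens b (Suc i) (2 * \<lfloor>y * 2 ^ i\<rfloor>) t\<bar> \<le> c * \<theta> ^ i" .
  qed
  have "\<bar>path_density (n + j) y t - path_density n y t\<bar> \<le> c / (1 - \<theta>) * (\<theta> ^ n - \<theta> ^ (n + j))" for j
  proof (induction j)
    case (Suc j)
    have "c / (1 - \<theta>) * (\<theta> ^ n - \<theta> ^ (n + j)) + c * \<theta> ^ (n + j) = c / (1 - \<theta>) * (\<theta> ^ n - \<theta> ^ (n + Suc j))"
      using \<theta> by (simp add: field_simps)
    then show ?case using Suc step[of "n + j"] nm by simp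
  qed auto
  from this[of "m - n"] have "\<bar>path_density m y t - path_density n y t\<bar> \<le> c / (1 - \<theta>) * (\<theta> ^ n - \<theta> ^ m)"
    using nm by simp
  also have "\<dots> \<le> c / (1 - \<theta>) * \<theta> ^ n"
    using \<theta> c by (intro mult_left_mono) auto
  finally show ?thesis .
qed

text \<open>The grid of mesh \<open>4 ^ -n\<close> is fine enough since \<open>dens\<close> has
  Lipschitz constant \<open>2 ^ n\<close>: moving to the grid costs
  \<open>2 ^ -n \<le> \<theta> ^ n\<close> for each of the two densities, which together with the
  grid bound makes 3. This is the origin of \<open>1 / 2 \<le> \<theta>\<close>.\<close>

lemma dens_all_times:
  assumes \<theta>: "1 / 2 \<le> \<theta>"
    and t: "0 \<le> t" "t \<le> real N"
    and H: "\<And>j. j \<le> N * 4 ^ n \<Longrightarrow> \<bar>dens b n (k + 1) (real j / 4 ^ n) - dens b n k (real j / 4 ^ n)\<bar> \<le> \<theta> ^ n"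
  shows "\<bar>dens b n (k + 1) t - dens b n k t\<bar> \<le> 3 * \<theta> ^ n"
proof -
  define j where "j = nat \<lfloor>t * 4 ^ n\<rfloor>"
  have j: "real j \<le> t * 4 ^ n" "t * 4 ^ n < real j + 1"
    using t unfolding j_def by (auto simp: of_nat_nat)
  have "real j \<le> real (N * 4 ^ n)" using order_trans[OF j(1) mult_right_mono[OF t(2), of "4 ^ n"]] by simp
  then have jN: "j \<le> N * 4 ^ n" by linarith
  define s where "s = real j / 4 ^ n"
  have s: "s \<le> t" "t < s + 1 / 4 ^ n" "0 \<le> s" using j by (auto simp: s_def field_simps)
  have "2 ^ n * \<bar>t - s\<bar> \<le> 2 ^ n * (1 / 4 ^ n)" using s by (intro mult_left_mono) auto
  also have "\<dots> = (1 / 2) ^ n" by (simp add: power_divide field_simps flip: power_mult_distrib)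
  also have "\<dots> \<le> \<theta> ^ n" using \<theta> by (intro power_mono) auto
  finally have d: "2 ^ n * \<bar>t - s\<bar> \<le> \<theta> ^ n" .
  show ?thesis
    using dens_time_lipschitz[of s t n k] dens_time_lipschitz[of s t n "k + 1"] d s t H[OF jN]
    unfolding s_def[symmetric] by linarith
qed

text \<open>Points at distance at most \<open>2 ^ -n\<close> lie in the same cell or in adjacent
  ones.\<close>

lemma path_density_space:
  assumes y: "\<bar>y\<bar> \<le> real N" "\<bar>y'\<bar> \<le> real N" "\<bar>y - y'\<bar> \<le> 1 / 2 ^ n"
    and H: "\<And>k. \<bar>k\<bar> \<le> int N * 2 ^ n \<Longrightarrow> \<bar>dens b n (k + 1) t - dens b n k t\<bar> \<le> c"
  shows "\<bar>path_density n y t - path_density n y' t\<bar> \<le> c"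
proof -
  have "\<bar>y * 2 ^ n - y' * 2 ^ n\<bar> \<le> 1"
    using mult_right_mono[OF y(3), of "2 ^ n"] by (simp add: abs_mult flip: left_diff_distrib)
  then have "\<lfloor>y * 2 ^ n\<rfloor> = \<lfloor>y' * 2 ^ n\<rfloor> \<or> \<lfloor>y * 2 ^ n\<rfloor> = \<lfloor>y' * 2 ^ n\<rfloor> + 1 \<or> \<lfloor>y' * 2 ^ n\<rfloor> = \<lfloor>y * 2 ^ n\<rfloor> + 1"
    by linarith
  moreover have "0 \<le> c" using H[of 0] by (simp add: order_trans[OF abs_ge_zero])
  ultimately show ?thesis
    using H[OF floor_bound[OF y(1)]] H[OF floor_bound[OF y(2)]]
    by (auto simp: path_density_def abs_minus_commute)
qed

end

text \<open>The pathwise content of Borel-Cantelli: \<open>n\<^sub>0\<close> depends on the path and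
  on the box size \<open>N\<close>, and only grid times occur, so that countably many events are
  involved.\<close>

locale regular_path = continuous_path +
  fixes \<theta> :: real
  assumes \<theta>: "1 / 2 \<le> \<theta>" "\<theta> < 1"
    and regular: "\<And>N. \<exists>n\<^sub>0. \<forall>n\<ge>n\<^sub>0. \<forall>k. \<bar>k\<bar> \<le> int N * 2 ^ n \<longrightarrow> (\<forall>j \<le> N * 4 ^ n.
       \<bar>dens b n (k + 1) (real j / 4 ^ n) - dens b n k (real j / 4 ^ n)\<bar> \<le> \<theta> ^ n)"
begin

definition L :: "real \<Rightarrow> real \<Rightarrow> real" where
  "L y t = lim (\<lambda>n. path_density n y t)"

lemma regular_times:
  obtains n\<^sub>0 where "\<And>n k t. n\<^sub>0 \<le> n \<Longrightarrow> \<bar>k\<bar> \<le> int N * 2 ^ n \<Longrightarrow> 0 \<le> t \<Longrightarrow> t \<le> real N \<Longrightarrow>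
       \<bar>dens b n (k + 1) t - dens b n k t\<bar> \<le> 3 * \<theta> ^ n"
proof -
  obtain n\<^sub>0 where n0: "\<And>n k j. n\<ge>n\<^sub>0 \<Longrightarrow> \<bar>k\<bar> \<le> int N * 2 ^ n \<Longrightarrow> j \<le> N * 4 ^ n \<Longrightarrow>
       \<bar>dens b n (k + 1) (real j / 4 ^ n) - dens b n k (real j / 4 ^ n)\<bar> \<le> \<theta> ^ n"
    using regular[of N] by blast
  show thesis by (rule that[of n\<^sub>0], rule dens_all_times[OF \<theta>(1)]) (use n0 in auto)
qed

text \<open>On a box the densities are uniformly Cauchy at a geometric rate. The conclusions are
  bundled because the first and the last are later used with a common
  \<open>n\<^sub>0\<close>.\<close>

lemma L_approx:
  obtains n\<^sub>0 where "\<And>n y t. n\<^sub>0 \<le> n \<Longrightarrow> \<bar>y\<bar> \<le> real N \<Longrightarrow> 0 \<le> t \<Longrightarrow> t \<le> real N \<Longrightarrow>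
       \<bar>L y t - path_density n y t\<bar> \<le> 3 / (1 - \<theta>) * \<theta> ^ n"
    "\<And>y t. \<bar>y\<bar> \<le> real N \<Longrightarrow> 0 \<le> t \<Longrightarrow> t \<le> real N \<Longrightarrow> (\<lambda>n. path_density n y t) \<longlonglongrightarrow> L y t"
    "\<And>n k t. n\<^sub>0 \<le> n \<Longrightarrow> \<bar>k\<bar> \<le> int N * 2 ^ n \<Longrightarrow> 0 \<le> t \<Longrightarrow> t \<le> real N \<Longrightarrow>
       \<bar>dens b n (k + 1) t - dens b n k t\<bar> \<le> 3 * \<theta> ^ n"
proof -
  obtain n\<^sub>0 where
    H: "\<And>n k t. n\<^sub>0 \<le> n \<Longrightarrow> \<bar>k\<bar> \<le> int N * 2 ^ n \<Longrightarrow> 0 \<le> t \<Longrightarrow> t \<le> real N \<Longrightarrow>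
       \<bar>dens b n (k + 1) t - dens b n k t\<bar> \<le> 3 * \<theta> ^ n" by (rule regular_times[of N]) (rule that)
  have tail: "\<bar>path_density m y t - path_density n y t\<bar> \<le> 3 / (1 - \<theta>) * \<theta> ^ n"
    if "n\<^sub>0 \<le> n" "n \<le> m" "\<bar>y\<bar> \<le> real N" "0 \<le> t" "t \<le> real N" for n m y t
    by (rule path_density_tail[where N = N and n\<^sub>0 = n\<^sub>0]) (use that \<theta> H in auto)
  have null: "(\<lambda>n. 3 / (1 - \<theta>) * \<theta> ^ n) \<longlonglongrightarrow> 0"
    using \<theta> by (intro tendsto_mult_right_zero LIMSEQ_power_zero) auto
  have lim: "(\<lambda>n. path_density n y t) \<longlonglongrightarrow> L y t" if "\<bar>y\<bar> \<le> real N" "0 \<le> t" "t \<le> real N" for y t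
  proof -
    have "Cauchy (\<lambda>n. path_density n y t)"
    proof (rule CauchyI')
      fix e :: real assume "e > 0"
      then obtain n1 where n1: "\<And>n. n \<ge> n1 \<Longrightarrow> 3 / (1 - \<theta>) * \<theta> ^ n < e"
        using order_tendstoD(2)[OF null] by (auto simp: eventually_sequentially)
      show "\<exists>M. \<forall>m\<ge>M. \<forall>n>m. dist (path_density m y t) (path_density n y t) < e"
      proof (intro exI[of _ "max n\<^sub>0 n1"] allI impI)
        fix m n assume "max n\<^sub>0 n1 \<le> m" "m < n"
        then show "dist (path_density m y t) (path_density n y t) < e"
          using tail[of m n y t] n1[of m] that by (simp add: dist_real_def abs_minus_commute)
      qed
    qed
    then show ?thesis
      unfolding L_def by (simp add: Cauchy_convergent_iff convergent_LIMSEQ_iff)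
  qed
  show thesis
  proof (rule that[OF _ lim H])
    fix n y t assume *: "n\<^sub>0 \<le> n" "\<bar>y\<bar> \<le> real N" "0 \<le> t" "t \<le> real N"
    have "(\<lambda>m. \<bar>path_density m y t - path_density n y t\<bar>) \<longlonglongrightarrow> \<bar>L y t - path_density n y t\<bar>"
      by (intro tendsto_intros lim *)
    then show "\<bar>L y t - path_density n y t\<bar> \<le> 3 / (1 - \<theta>) * \<theta> ^ n"
      by (rule tendsto_upperbound) (use tail[OF *(1) _ *(2-4)] in \<open>blast intro: eventually_sequentiallyI\<close>, simp)
  qed
qed

lemma power_small:
  fixes C e :: real
  assumes "e > 0"
  obtains n where "n \<ge> n\<^sub>0" "C * \<theta> ^ n < e"
proof -
  have "(\<lambda>n. C * \<theta> ^ n) \<longlonglongrightarrow> 0"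
    using \<theta> by (intro tendsto_mult_right_zero LIMSEQ_power_zero) auto
  then have "\<forall>\<^sub>F n in sequentially. C * \<theta> ^ n < e" using assms by (rule order_tendstoD)
  then show thesis using that by (auto simp: eventually_sequentially) (meson max.cobounded1 max.cobounded2)
qed

text \<open>Fix one level \<open>n\<close> at which the limit is already well approximated; there
  the density is Lipschitz in time and changes by at most \<open>3 * \<theta> ^ n\<close> between
  adjacent cells.\<close>

lemma L_modulus:
  assumes "e > 0"
  obtains d where "d > 0" "\<And>y y' t t'. \<bar>y\<bar> \<le> real N \<Longrightarrow> \<bar>y'\<bar> \<le> real N \<Longrightarrow> 0 \<le> t \<Longrightarrow> t \<le> real N \<Longrightarrow>
      0 \<le> t' \<Longrightarrow> t' \<le> real N \<Longrightarrow> \<bar>y - y'\<bar> \<le> d \<Longrightarrow> \<bar>t - t'\<bar> \<le> d \<Longrightarrow> \<bar>L y t - L y' t'\<bar> < e"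
proof -
  obtain n\<^sub>0 where A: "\<And>n y t. n\<^sub>0 \<le> n \<Longrightarrow> \<bar>y\<bar> \<le> real N \<Longrightarrow> 0 \<le> t \<Longrightarrow> t \<le> real N \<Longrightarrow>
       \<bar>L y t - path_density n y t\<bar> \<le> 3 / (1 - \<theta>) * \<theta> ^ n"
    and lim: "\<And>y t. \<bar>y\<bar> \<le> real N \<Longrightarrow> 0 \<le> t \<Longrightarrow> t \<le> real N \<Longrightarrow> (\<lambda>n. path_density n y t) \<longlonglongrightarrow> L y t"
    and H: "\<And>n k t. n\<^sub>0 \<le> n \<Longrightarrow> \<bar>k\<bar> \<le> int N * 2 ^ n \<Longrightarrow> 0 \<le> t \<Longrightarrow> t \<le> real N \<Longrightarrow>
       \<bar>dens b n (k + 1) t - dens b n k t\<bar> \<le> 3 * \<theta> ^ n"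
    by (rule L_approx[of N]) (rule that)
  obtain n where n: "n \<ge> n\<^sub>0" "(2 * (3 / (1 - \<theta>)) + 3) * \<theta> ^ n < e / 2"
    using power_small[of "e / 2" n\<^sub>0 "2 * (3 / (1 - \<theta>)) + 3"] assms by auto
  \<comment> \<open>The first term keeps both points in the same or adjacent cells, the second
    limits the change in time, at rate \<open>2 ^ n\<close>, to \<open>e / 2\<close>.\<close>
  define d where "d = min (1 / 2 ^ n) (e / 2 / 2 ^ n)"
  show thesis
  proof (rule that[of d])
    show "d > 0" using assms by (simp add: d_def)
    fix y y' t t' :: real
    assume *: "\<bar>y\<bar> \<le> real N" "\<bar>y'\<bar> \<le> real N" "0 \<le> t" "t \<le> real N" "0 \<le> t'" "t' \<le> real N"
      "\<bar>y - y'\<bar> \<le> d" "\<bar>t - t'\<bar> \<le> d"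
    have 1: "\<bar>path_density n y t - path_density n y' t\<bar> \<le> 3 * \<theta> ^ n"
      by (rule path_density_space) (use * H n in \<open>auto simp: d_def\<close>)
    have "\<bar>path_density n y' t - path_density n y' t'\<bar> \<le> 2 ^ n * \<bar>t - t'\<bar>"
      unfolding path_density_def by (rule dens_time_lipschitz) (use * in auto)
    also have "\<dots> \<le> 2 ^ n * (e / 2 / 2 ^ n)" using * by (intro mult_left_mono) (auto simp: d_def)
    finally have 2: "\<bar>path_density n y' t - path_density n y' t'\<bar> \<le> e / 2" by simp
    show "\<bar>L y t - L y' t'\<bar> < e"
      using 1 2 A[of n y t] A[of n y' t'] * n unfolding ring_distribs by linarith
  qed
qed

lemma L_continuous: "continuous_on (UNIV \<times> {0..}) (\<lambda>(y, t). L y t)"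
  unfolding continuous_on_iff
proof (intro ballI allI impI)
  fix z :: "real \<times> real" and e :: real assume z: "z \<in> UNIV \<times> {0..}" and e: "e > 0"
  obtain y t where zz: "z = (y, t)" "0 \<le> t" using z by auto
  obtain N :: nat where N: "\<bar>y\<bar> + t + 1 \<le> real N" using real_arch_simple by blast
  obtain d where d: "d > 0" "\<And>y y' t t'. \<bar>y\<bar> \<le> real N \<Longrightarrow> \<bar>y'\<bar> \<le> real N \<Longrightarrow> 0 \<le> t \<Longrightarrow> t \<le> real N \<Longrightarrow>
      0 \<le> t' \<Longrightarrow> t' \<le> real N \<Longrightarrow> \<bar>y - y'\<bar> \<le> d \<Longrightarrow> \<bar>t - t'\<bar> \<le> d \<Longrightarrow> \<bar>L y t - L y' t'\<bar> < e"
    using L_modulus[OF e, of N] by blast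
  show "\<exists>d>0. \<forall>z'\<in>UNIV \<times> {0..}. dist z' z < d \<longrightarrow>
      dist (case z' of (y, t) \<Rightarrow> L y t) (case z of (y, t) \<Rightarrow> L y t) < e"
  proof (intro exI[of _ "min d 1"] conjI ballI impI)
    fix z' :: "real \<times> real" assume z': "z' \<in> UNIV \<times> {0..}" "dist z' z < min d 1"
    obtain y' t' where zz': "z' = (y', t')" "0 \<le> t'" using z' by auto
    have "dist y' y < min d 1" "dist t' t < min d 1"
      using z'(2) dist_fst_le[of z' z] dist_snd_le[of z' z] by (auto simp: zz zz')
    then show "dist (case z' of (y, t) \<Rightarrow> L y t) (case z of (y, t) \<Rightarrow> L y t) < e"
      using d(2)[of y' y t' t] zz zz' N by (auto simp: dist_real_def)
  qed (use d in auto)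
qed

text \<open>The half-width \<epsilon> stays fixed while the level tends to infinity: dyadic
  intervals from outside and from inside squeeze the window, and all their cells have densities
  close to \<open>L y t\<close>.\<close>

lemma L_window:
  assumes t: "0 \<le> t"
  shows "((\<lambda>\<epsilon>. occ b t {y - \<epsilon> <..< y + \<epsilon>} / (2 * \<epsilon>)) \<longlongrightarrow> L y t) (at_right 0)"
proof (rule tendstoI)
  fix e :: real assume e: "e > 0"
  \<comment> \<open>Densities near \<open>y\<close> differ from \<open>L y t\<close> by at most
    \<open>2 * \<eta>\<close>: one \<eta> for approximating \<open>L\<close> at a finite level and
    one for the modulus of continuity of \<open>L\<close>.\<close>
  define \<eta> where "\<eta> = e / 3"
  have \<eta>: "\<eta> > 0" using e by (simp add: \<eta>_def)
  obtain N :: nat where N: "\<bar>y\<bar> + t + 3 \<le> real N" using real_arch_simple by blast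
  obtain n\<^sub>0 where A: "\<And>n y t. n\<^sub>0 \<le> n \<Longrightarrow> \<bar>y\<bar> \<le> real N \<Longrightarrow> 0 \<le> t \<Longrightarrow> t \<le> real N \<Longrightarrow>
       \<bar>L y t - path_density n y t\<bar> \<le> 3 / (1 - \<theta>) * \<theta> ^ n"
    and lim: "\<And>y t. \<bar>y\<bar> \<le> real N \<Longrightarrow> 0 \<le> t \<Longrightarrow> t \<le> real N \<Longrightarrow> (\<lambda>n. path_density n y t) \<longlonglongrightarrow> L y t"
    and H: "\<And>n k t. n\<^sub>0 \<le> n \<Longrightarrow> \<bar>k\<bar> \<le> int N * 2 ^ n \<Longrightarrow> 0 \<le> t \<Longrightarrow> t \<le> real N \<Longrightarrow>
       \<bar>dens b n (k + 1) t - dens b n k t\<bar> \<le> 3 * \<theta> ^ n"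
    by (rule L_approx[of N]) (rule that)
  obtain d where d: "d > 0" "\<And>y y' t t'. \<bar>y\<bar> \<le> real N \<Longrightarrow> \<bar>y'\<bar> \<le> real N \<Longrightarrow> 0 \<le> t \<Longrightarrow> t \<le> real N \<Longrightarrow>
      0 \<le> t' \<Longrightarrow> t' \<le> real N \<Longrightarrow> \<bar>y - y'\<bar> \<le> d \<Longrightarrow> \<bar>t - t'\<bar> \<le> d \<Longrightarrow> \<bar>L y t - L y' t'\<bar> < \<eta>"
    using L_modulus[OF \<eta>, of N] by blast
  obtain n1 where n1: "n1 \<ge> n\<^sub>0" "3 / (1 - \<theta>) * \<theta> ^ n1 < \<eta>"
    using power_small[OF \<eta>] by blast
  define \<delta> where "\<delta> = min d 1"
  have \<delta>: "0 < \<delta>" "\<delta> \<le> d" "\<delta> \<le> 1" using d by (auto simp: \<delta>_def)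
  have near: "\<bar>dens b n k t - L y t\<bar> \<le> 2 * \<eta>" if n: "n1 \<le> n" and k: "\<bar>real_of_int k / 2 ^ n - y\<bar> \<le> \<delta>" for n k
  proof -
    have "\<theta> ^ n \<le> \<theta> ^ n1" using n \<theta> by (intro power_decreasing) auto
    then have "3 / (1 - \<theta>) * \<theta> ^ n \<le> 3 / (1 - \<theta>) * \<theta> ^ n1"
      using \<theta> by (intro mult_left_mono) auto
    moreover have "dens b n k t = path_density n (real_of_int k / 2 ^ n) t" by (simp add: path_density_def)
    moreover have "\<bar>L (real_of_int k / 2 ^ n) t - path_density n (real_of_int k / 2 ^ n) t\<bar> \<le> 3 / (1 - \<theta>) * \<theta> ^ n"
      by (rule A) (use n n1 k N t \<delta> in auto)
    moreover have "\<bar>L (real_of_int k / 2 ^ n) t - L y t\<bar> < \<eta>"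
      by (rule d) (use k N t \<delta> in auto)
    ultimately show ?thesis using n1 by linarith
  qed
  have L0: "0 \<le> L y t"
  proof -
    have "(\<lambda>n. path_density n y t) \<longlonglongrightarrow> L y t" using N t by (intro lim) auto
    then show ?thesis by (rule LIMSEQ_le_const) (auto simp: path_density_def dens_nonneg)
  qed
  have main: "\<bar>occ b t {y - \<epsilon> <..< y + \<epsilon>} - 2 * \<epsilon> * L y t\<bar> \<le> 2 * \<epsilon> * (2 * \<eta>)" if \<epsilon>: "0 < \<epsilon>" "\<epsilon> < \<delta> / 2" for \<epsilon>
  proof -
    define Z where "Z = occ b t {y - \<epsilon> <..< y + \<epsilon>}"
    have grid: "\<bar>2 ^ n * occ b t {real_of_int i / 2 ^ n ..< real_of_int j / 2 ^ n} - real_of_int (j - i) * L y t\<bar>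
        \<le> real_of_int (j - i) * (2 * \<eta>)"
      if "n1 \<le> n" "i \<le> j" "y - \<delta> \<le> real_of_int i / 2 ^ n" "real_of_int j / 2 ^ n \<le> y + \<delta>" for n i j
    proof -
      have "\<bar>2 ^ n * occ b t {real_of_int i / 2 ^ n ..< (real_of_int i + real (nat (j - i))) / 2 ^ n} - real (nat (j - i)) * L y t\<bar> \<le> real (nat (j - i)) * (2 * \<eta>)"
      proof (rule occ_dyadic_interval)
        fix q assume q: "q < nat (j - i)"
        have "real_of_int i / 2 ^ n \<le> real_of_int (i + int q) / 2 ^ n"
          "real_of_int (i + int q) / 2 ^ n \<le> real_of_int j / 2 ^ n"
          using q by (auto intro!: divide_right_mono)
        then show "\<bar>dens b n (i + int q) t - L y t\<bar> \<le> 2 * \<eta>"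
          using that by (intro near) auto
      qed
      then show ?thesis using that by (simp add: of_nat_nat)
    qed
    \<comment> \<open>The first bound keeps the rounded window within \<delta> of \<open>y\<close>,
      the second keeps the inner dyadic interval from degenerating.\<close>
    have small: "\<forall>\<^sub>F n in sequentially. (1 / 2) ^ n < min (\<delta> / 4) (\<epsilon> / 2)"
      using \<epsilon> \<delta> by (intro order_tendstoD(2)[OF LIMSEQ_power_zero]) auto
    have upper: "\<forall>\<^sub>F n in sequentially. Z \<le> (2 * \<epsilon> + 2 * (1 / 2) ^ n) * (L y t + 2 * \<eta>)"
      using small eventually_ge_at_top[of n1]
    proof eventually_elim
      case (elim n)
      define i j where "i = \<lfloor>(y - \<epsilon>) * 2 ^ n\<rfloor>" and "j = \<lceil>(y + \<epsilon>) * 2 ^ n\<rceil>"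
      have p: "(1 / 2 :: real) ^ n = 1 / 2 ^ n" by (simp add: power_divide)
      have ij: "real_of_int i / 2 ^ n \<le> y - \<epsilon>" "y - \<epsilon> - 1 / 2 ^ n \<le> real_of_int i / 2 ^ n"
         "y + \<epsilon> \<le> real_of_int j / 2 ^ n" "real_of_int j / 2 ^ n \<le> y + \<epsilon> + 1 / 2 ^ n"
        using dyadic_round[of "y - \<epsilon>" n] dyadic_round[of "y + \<epsilon>" n] unfolding i_def j_def by auto
      have "real_of_int i / 2 ^ n \<le> real_of_int j / 2 ^ n" using ij \<epsilon> by linarith
      then have "i \<le> j" by (simp add: divide_le_cancel)
      have "2 ^ n * Z \<le> 2 ^ n * occ b t {real_of_int i / 2 ^ n ..< real_of_int j / 2 ^ n}"
        unfolding Z_def using ij by (intro mult_left_mono occ_mono) auto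
      also have "\<dots> \<le> real_of_int (j - i) * (L y t + 2 * \<eta>)"
        using grid[of n i j] elim \<open>i \<le> j\<close> ij \<epsilon> p unfolding ring_distribs by linarith
      also have "\<dots> \<le> (2 ^ n * (2 * \<epsilon> + 2 * (1 / 2) ^ n)) * (L y t + 2 * \<eta>)"
      proof (rule mult_right_mono)
        have "real_of_int j / 2 ^ n - real_of_int i / 2 ^ n \<le> 2 * \<epsilon> + 2 * (1 / 2) ^ n" using ij p by linarith
        then have "real_of_int (j - i) / 2 ^ n \<le> 2 * \<epsilon> + 2 * (1 / 2) ^ n" by (simp add: diff_divide_distrib)
        then show "real_of_int (j - i) \<le> 2 ^ n * (2 * \<epsilon> + 2 * (1 / 2) ^ n)"
          by (simp only: divide_le_eq mult.commute) simp
      qed (use L0 \<eta> in auto)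
      finally show ?case by (simp add: mult.assoc)
    qed
    have lower: "\<forall>\<^sub>F n in sequentially. (2 * \<epsilon>) * L y t - 2 * (1 / 2) ^ n * L y t - 2 * \<epsilon> * (2 * \<eta>) \<le> Z"
      using small eventually_ge_at_top[of n1]
    proof eventually_elim
      case (elim n)
      \<comment> \<open>Floor plus one rather than a ceiling: the window is open, so the left end
        point of the half-open interval must exceed \<open>y - \<epsilon>\<close> strictly.\<close>
      define i j where "i = \<lfloor>(y - \<epsilon>) * 2 ^ n\<rfloor> + 1" and "j = \<lfloor>(y + \<epsilon>) * 2 ^ n\<rfloor>"
      have p: "(1 / 2 :: real) ^ n = 1 / 2 ^ n" by (simp add: power_divide)
      have ij: "y - \<epsilon> < real_of_int i / 2 ^ n" "real_of_int i / 2 ^ n \<le> y - \<epsilon> + 1 / 2 ^ n"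
         "y + \<epsilon> - 1 / 2 ^ n \<le> real_of_int j / 2 ^ n" "real_of_int j / 2 ^ n \<le> y + \<epsilon>"
        using dyadic_round[of "y - \<epsilon>" n] dyadic_round[of "y + \<epsilon>" n] unfolding i_def j_def
        by (auto simp: add_divide_distrib)
      have "real_of_int i / 2 ^ n \<le> real_of_int j / 2 ^ n" using ij \<epsilon> elim p by auto
      then have "i \<le> j" by (simp add: divide_le_cancel)
      have len: "2 * \<epsilon> - 2 * (1 / 2) ^ n \<le> real_of_int (j - i) / 2 ^ n" "real_of_int (j - i) / 2 ^ n \<le> 2 * \<epsilon>"
        using ij p by (auto simp: diff_divide_distrib)
      have "real_of_int (j - i) * L y t - real_of_int (j - i) * (2 * \<eta>) \<le> 2 ^ n * occ b t {real_of_int i / 2 ^ n ..< real_of_int j / 2 ^ n}"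
        using grid[of n i j] elim \<open>i \<le> j\<close> ij \<epsilon> p unfolding ring_distribs by linarith
      then have "real_of_int (j - i) / 2 ^ n * L y t - real_of_int (j - i) / 2 ^ n * (2 * \<eta>) \<le> occ b t {real_of_int i / 2 ^ n ..< real_of_int j / 2 ^ n}"
        by (simp add: divide_le_eq mult.commute flip: diff_divide_distrib)
      also have "\<dots> \<le> Z"
        unfolding Z_def using ij by (intro occ_mono) auto
      finally have "real_of_int (j - i) / 2 ^ n * L y t - real_of_int (j - i) / 2 ^ n * (2 * \<eta>) \<le> Z" .
      moreover have "(2 * \<epsilon> - 2 * (1 / 2) ^ n) * L y t \<le> real_of_int (j - i) / 2 ^ n * L y t"
        "real_of_int (j - i) / 2 ^ n * (2 * \<eta>) \<le> 2 * \<epsilon> * (2 * \<eta>)"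
        using len L0 \<eta> by (intro mult_right_mono; simp)+
      ultimately show ?case by (simp add: algebra_simps)
    qed
    have null: "(\<lambda>n. (1 / 2 :: real) ^ n) \<longlonglongrightarrow> 0" by (intro LIMSEQ_power_zero) auto
    have "(\<lambda>n. (2 * \<epsilon> + 2 * (1 / 2) ^ n) * (L y t + 2 * \<eta>)) \<longlonglongrightarrow> (2 * \<epsilon> + 2 * 0) * (L y t + 2 * \<eta>)"
      by (intro tendsto_intros null)
    then have 1: "Z \<le> 2 * \<epsilon> * (L y t + 2 * \<eta>)" using tendsto_lowerbound[OF _ upper] by simp
    have "(\<lambda>n. (2 * \<epsilon>) * L y t - 2 * (1 / 2) ^ n * L y t - 2 * \<epsilon> * (2 * \<eta>)) \<longlonglongrightarrow> (2 * \<epsilon>) * L y t - 2 * 0 * L y t - 2 * \<epsilon> * (2 * \<eta>)"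
      by (intro tendsto_intros null)
    then have 2: "(2 * \<epsilon>) * L y t - 2 * \<epsilon> * (2 * \<eta>) \<le> Z" using tendsto_upperbound[OF _ lower] by simp
    show ?thesis using 1 2 unfolding Z_def by (simp add: algebra_simps)
  qed
  have "dist (occ b t {y - \<epsilon> <..< y + \<epsilon>} / (2 * \<epsilon>)) (L y t) < e" if \<epsilon>: "0 < \<epsilon>" "\<epsilon> < \<delta> / 2" for \<epsilon>
  proof -
    have "\<bar>occ b t {y - \<epsilon> <..< y + \<epsilon>} / (2 * \<epsilon>) - L y t\<bar> = \<bar>occ b t {y - \<epsilon> <..< y + \<epsilon>} - 2 * \<epsilon> * L y t\<bar> / (2 * \<epsilon>)"
    proof -
      have "occ b t {y - \<epsilon> <..< y + \<epsilon>} / (2 * \<epsilon>) - L y t = (occ b t {y - \<epsilon> <..< y + \<epsilon>} - 2 * \<epsilon> * L y t) / (2 * \<epsilon>)"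
        using \<epsilon> by (simp add: diff_divide_distrib)
      then show ?thesis using \<epsilon> by (simp add: abs_divide abs_mult)
    qed
    also have "\<dots> \<le> 2 * \<epsilon> * (2 * \<eta>) / (2 * \<epsilon>)" using main[OF \<epsilon>] \<epsilon> by (intro divide_right_mono) auto
    also have "\<dots> < e" using e \<epsilon> by (simp add: \<eta>_def)
    finally show ?thesis by (simp add: dist_real_def)
  qed
  then show "\<forall>\<^sub>F \<epsilon> in at_right 0. dist (occ b t {y - \<epsilon> <..< y + \<epsilon>} / (2 * \<epsilon>)) (L y t) < e"
    using \<delta> by (intro eventually_at_rightI[of 0 "\<delta> / 2"]) auto
qed

text \<open>Half of \<open>occ b t {-1..<1}\<close> is the mean of the two level 0 densities next to
  0. One \<open>c\<close> compares these two, at most \<open>N\<close> further ones lead to the cell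
  of \<open>y\<close>, and the geometric tail \<open>c / (1 - \<theta>)\<close> leads from level 0
  to the limit.\<close>

lemma L_lower:
  assumes t: "0 \<le> t" and c: "0 \<le> c" and y: "\<bar>y\<bar> \<le> real N"
    and H: "\<And>n k. \<bar>k\<bar> \<le> int N * 2 ^ n \<Longrightarrow> \<bar>dens b n (k + 1) t - dens b n k t\<bar> \<le> c * \<theta> ^ n"
    and N: "1 \<le> N"
  shows "occ b t {-1..<1} / 2 - (real N + 1 + 1 / (1 - \<theta>)) * c \<le> L y t"
proof -
  have H0: "\<bar>dens b 0 (k + 1) t - dens b 0 k t\<bar> \<le> c" if "\<bar>k\<bar> \<le> int N" for k
    using H[of k 0] that by simp
  have up: "\<bar>dens b 0 (int m) t - dens b 0 0 t\<bar> \<le> real m * c" if "m \<le> N" for m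
    using that
  proof (induction m)
    case (Suc m)
    then show ?case using H0[of "int m"] by (simp add: algebra_simps)
  qed simp
  have down: "\<bar>dens b 0 (- int m) t - dens b 0 0 t\<bar> \<le> real m * c" if "m \<le> N" for m
    using that
  proof (induction m)
    case (Suc m)
    have "- int (Suc m) + 1 = - int m" by simp
    then show ?case using H0[of "- int (Suc m)"] Suc by (simp add: algebra_simps)
  qed simp
  have far: "\<bar>dens b 0 k t - dens b 0 0 t\<bar> \<le> real N * c" if "\<bar>k\<bar> \<le> int N" for k
  proof -
    have "real (nat \<bar>k\<bar>) * c \<le> real N * c" using that c by (intro mult_right_mono) auto
    moreover have "nat \<bar>k\<bar> \<le> N" using that by auto
    moreover have "k = int (nat \<bar>k\<bar>) \<or> k = - int (nat \<bar>k\<bar>)" by auto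
    ultimately show ?thesis using up[of "nat \<bar>k\<bar>"] down[of "nat \<bar>k\<bar>"] by (metis order_trans)
  qed
  have "occ b t {-1..<1} = dens b 0 (-1) t + dens b 0 0 t"
  proof -
    have "{-1..<1 :: real} = {-1..<0} \<union> {0..<1}" by auto
    then show ?thesis by (simp add: occ_Un dens_def)
  qed
  then have mid: "occ b t {-1..<1} / 2 - c \<le> dens b 0 0 t"
  proof -
    have "\<bar>dens b 0 0 t - dens b 0 (-1) t\<bar> \<le> c" using H0[of "-1"] N by simp
    then show ?thesis using \<open>occ b t {-1..<1} = dens b 0 (-1) t + dens b 0 0 t\<close> c by linarith
  qed
  have "dens b 0 0 t - real N * c \<le> path_density 0 y t"
    using far[of "\<lfloor>y\<rfloor>"] floor_bound[OF y, of 0] by (simp add: path_density_def)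
  moreover obtain N' :: nat where N': "\<bar>y\<bar> + t \<le> real N'" using real_arch_simple by blast
  have lim: "(\<lambda>n. path_density n y t) \<longlonglongrightarrow> L y t"
  proof (rule L_approx[of N'])
    assume "\<And>y t. \<bar>y\<bar> \<le> real N' \<Longrightarrow> 0 \<le> t \<Longrightarrow> t \<le> real N' \<Longrightarrow> (\<lambda>n. path_density n y t) \<longlonglongrightarrow> L y t"
    then show ?thesis using N' t by simp
  qed
  have "path_density 0 y t - c / (1 - \<theta>) \<le> L y t"
  proof (rule LIMSEQ_le_const[OF lim], intro exI allI impI)
    fix n :: nat
    have "\<bar>path_density n y t - path_density 0 y t\<bar> \<le> c / (1 - \<theta>) * \<theta> ^ 0"
      by (rule path_density_tail[where N = N and n\<^sub>0 = 0]) (use \<theta> y c H in auto)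
    then show "path_density 0 y t - c / (1 - \<theta>) \<le> path_density n y t" by simp
  qed
  moreover have "(real N + 1 + 1 / (1 - \<theta>)) * c = real N * c + c + c / (1 - \<theta>)" by (simp add: distrib_right)
  ultimately show ?thesis using mid by linarith
qed

end

section \<open>The heat kernel\<close>

text \<open>The value 0 for \<open>u \<le> 0\<close> lets the factor \<open>heat (u - s)\<close>
  enforce the time order \<open>s < u\<close> inside integrals over the whole plane.\<close>

definition heat :: "real \<Rightarrow> real \<Rightarrow> real" where
  "heat u z = (if 0 < u then exp (- z\<^sup>2 / (2 * u)) / sqrt (2 * pi * u) else 0)"

lemma heat_nonneg [simp]: "0 \<le> heat u z"
  by (simp add: heat_def)

lemma heat_normal_density: "0 < u \<Longrightarrow> heat u z = normal_density 0 (sqrt u) z"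
  by (simp add: heat_def normal_density_def)

lemma heat_measurable [measurable]: "(\<lambda>(u, z). heat u z) \<in> borel_measurable (borel \<Otimes>\<^sub>M borel)"
  unfolding heat_def by measurable

lemma nn_integral_heat_space:
  assumes "0 < u"
  shows "(\<integral>\<^sup>+z. ennreal (heat u (z - x)) \<partial>lborel) = 1"
proof -
  have "heat u (z - x) = normal_density x (sqrt u) z" for z
    using assms by (simp add: heat_def normal_density_def)
  then show ?thesis
    using integral_normal_density[of "sqrt u" x] integrable_normal_density[of "sqrt u" x] assms
    by (simp add: nn_integral_eq_integral)
qed

lemma nn_integral_inverse_sqrt:
  assumes "0 \<le> t"
  shows "(\<integral>\<^sup>+u. ennreal (indicator {0..t} u / (2 * sqrt u)) \<partial>lborel) = ennreal (sqrt t)"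
proof -
  have "((\<lambda>u. 1 / (2 * sqrt u)) has_integral (sqrt t - sqrt 0)) {0..t}"
  proof (rule fundamental_theorem_of_calculus_interior)
    fix x :: real assume "x \<in> {0<..<t}"
    then show "(sqrt has_vector_derivative 1 / (2 * sqrt x)) (at x)"
      by (auto intro!: derivative_eq_intros simp: has_real_derivative_iff_has_vector_derivative[symmetric] field_simps)
  qed (use assms in \<open>auto intro!: continuous_intros\<close>)
  then have "((\<lambda>u. if u \<in> {0..t} then 1 / (2 * sqrt u) else 0) has_integral sqrt t) UNIV"
    by (subst has_integral_restrict_UNIV) simp
  moreover have "(\<lambda>u. if u \<in> {0..t} then 1 / (2 * sqrt u) else 0) = (\<lambda>u. indicator {0..t} u / (2 * sqrt u))"
    by (auto simp: indicator_def)
  ultimately have "((\<lambda>u. indicator {0..t} u / (2 * sqrt u)) has_integral sqrt t) UNIV" by simp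
  then show ?thesis
    by (intro nn_integral_has_integral_lborel) (auto simp: indicator_def)
qed

lemma two_le_sqrt_2pi: "2 \<le> sqrt (2 * pi)"
  using pi_gt3 by (intro real_le_rsqrt) simp

text \<open>Since \<open>sqrt (2 * pi) \<ge> 2\<close>, the kernel is dominated by the derivative of
  \<open>sqrt\<close>. At \<open>u = 0\<close> both sides are 0 by the convention for
  division.\<close>

lemma heat_le:
  assumes "0 \<le> u"
  shows "heat u z \<le> 1 / (2 * sqrt u)"
proof (cases "0 < u")
  case True
  have "heat u z \<le> 1 / sqrt (2 * pi * u)"
    using True by (auto simp: heat_def intro!: divide_right_mono)
  also have "\<dots> = 1 / (sqrt (2 * pi) * sqrt u)" by (simp add: real_sqrt_mult)
  also have "\<dots> \<le> 1 / (2 * sqrt u)"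
    using True two_le_sqrt_2pi by (intro divide_left_mono mult_right_mono mult_pos_pos) auto
  finally show ?thesis .
next
  case False
  then show ?thesis using assms by (simp add: heat_def)
qed

lemma heat_antimono: "\<bar>a\<bar> \<le> \<bar>b\<bar> \<Longrightarrow> heat u b \<le> heat u a"
  by (auto simp: heat_def abs_le_square_iff intro!: divide_right_mono)

lemma heat_abs: "heat u \<bar>a\<bar> = heat u a"
  by (simp add: heat_def)

lemma heat_scale:
  assumes "0 < c"
  shows "heat (c\<^sup>2 * u) (c * z) = heat u z / c"
proof (cases "0 < u")
  case True
  have "sqrt (2 * pi * (c\<^sup>2 * u)) = c * sqrt (2 * pi * u)"
    using assms by (simp add: real_sqrt_mult)
  moreover have "(c * z)\<^sup>2 / (2 * (c\<^sup>2 * u)) = z\<^sup>2 / (2 * u)"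
    using assms True by (simp add: power_mult_distrib field_simps)
  ultimately show ?thesis using assms True by (simp add: heat_def)
next
  case False
  then show ?thesis using assms by (simp add: heat_def zero_less_mult_iff)
qed

lemma nn_integral_heat_time:
  assumes "0 \<le> t"
  shows "(\<integral>\<^sup>+u. ennreal (indicator {0..t} u * heat u z) \<partial>lborel) \<le> ennreal (sqrt t)"
proof -
  have "(\<integral>\<^sup>+u. ennreal (indicator {0..t} u * heat u z) \<partial>lborel) \<le>
      (\<integral>\<^sup>+u. ennreal (indicator {0..t} u / (2 * sqrt u)) \<partial>lborel)"
    using heat_le by (intro nn_integral_mono) (auto simp: indicator_def)
  then show ?thesis using nn_integral_inverse_sqrt[OF assms] by simp
qed

text \<open>Neither kernel is integrable over all times, but the difference is of order
  \<open>u powr (-3/2)\<close> at infinity, while near 0 the bound \<open>1 / (2 * sqrt u)\<close>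
  suffices. Each of the two ranges contributes at most 1.\<close>

lemma nn_integral_heat_deficit_finite:
  "(\<integral>\<^sup>+u. ennreal (heat u 0 - heat u 1) \<partial>lborel) \<le> 2"
proof -
  have bound: "heat u 0 - heat u 1 \<le> indicator {0..1} u / (2 * sqrt u) + 1 / (2 * u * sqrt u) * indicator {1..} u" for u
  proof -
    consider "u \<le> 0" | "0 < u" "u < 1" | "1 \<le> u" by linarith
    then show ?thesis
    proof cases
      case 2
      then have "heat u 0 - heat u 1 \<le> 1 / (2 * sqrt u)"
        using heat_le[of u 0] heat_nonneg[of u 1] by linarith
      then show ?thesis using 2 by simp
    next
      case 3
      have e: "1 - exp (- 1 / (2 * u)) \<le> 1 / u"
        using exp_ge_add_one_self[of "- 1 / (2 * u)"] 3 by (simp add: field_simps)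
      have "heat u 0 - heat u 1 = (1 - exp (- 1 / (2 * u))) * heat u 0"
        using 3 by (simp add: heat_def field_simps)
      also have "\<dots> \<le> 1 / u * (1 / (2 * sqrt u))"
        using 3 e heat_le[of u 0] by (intro mult_mono) auto
      finally have "heat u 0 - heat u 1 \<le> 1 / (2 * u * sqrt u)" by (simp add: mult_ac)
      moreover have "0 \<le> indicator {0..1} u / (2 * sqrt u)" using 3 by simp
      moreover have "1 / (2 * u * sqrt u) * indicator {1..} u = 1 / (2 * u * sqrt u)" using 3 by simp
      ultimately show ?thesis by linarith
    qed (auto simp: heat_def indicator_def)
  qed
  have tail: "(\<integral>\<^sup>+u. ennreal (1 / (2 * u * sqrt u)) * indicator {1..} u \<partial>lborel) = ennreal (0 - (- 1 / sqrt 1))"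
  proof (rule nn_integral_FTC_atLeast[where F = "\<lambda>u. - 1 / sqrt u"])
    fix x :: real assume "1 \<le> x"
    then show "((\<lambda>u. - 1 / sqrt u) has_real_derivative 1 / (2 * x * sqrt x)) (at x)"
      by (auto intro!: derivative_eq_intros simp: field_simps)
  next
    show "((\<lambda>u. - 1 / sqrt u) \<longlongrightarrow> 0) at_top"
      by (rule real_tendsto_divide_at_top) (auto intro: sqrt_at_top)
  qed auto
  have "(\<integral>\<^sup>+u. ennreal (heat u 0 - heat u 1) \<partial>lborel) \<le>
      (\<integral>\<^sup>+u. ennreal (indicator {0..1} u / (2 * sqrt u)) + ennreal (1 / (2 * u * sqrt u)) * indicator {1..} u \<partial>lborel)"
  proof (rule nn_integral_mono)
    fix u :: real
    have "ennreal (heat u 0 - heat u 1) \<le> ennreal (indicator {0..1} u / (2 * sqrt u) + 1 / (2 * u * sqrt u) * indicator {1..} u)"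
      by (rule ennreal_leI[OF bound])
    also have "\<dots> = ennreal (indicator {0..1} u / (2 * sqrt u)) + ennreal (1 / (2 * u * sqrt u)) * indicator {1..} u"
      by (auto simp: indicator_def ennreal_plus)
    finally show "ennreal (heat u 0 - heat u 1) \<le> \<dots>" .
  qed
  also have "\<dots> = ennreal (sqrt 1) + ennreal (0 - (- 1 / sqrt 1))"
    by (subst nn_integral_add) (auto simp only: nn_integral_inverse_sqrt[of 1, simplified] tail, auto)
  finally show ?thesis by (simp flip: ennreal_plus)
qed

text \<open>The total deficit \<open>J b\<close> of the heat kernel at \<open>b\<close> is \<open>b * J 1\<close> by Brownian scaling, so that
  differences of heat kernels have time integral proportional to the difference of the distances.\<close>

lemma nn_integral_heat_diff_abs:
  "(\<integral>\<^sup>+u. ennreal \<bar>heat u a - heat u b\<bar> \<partial>lborel) \<le> ennreal (2 * \<bar>a - b\<bar>)"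
proof -
  define J where "J b = (\<integral>\<^sup>+u. ennreal (heat u 0 - heat u b) \<partial>lborel)" for b
  have J_scale: "J b = ennreal b * J 1" if "0 \<le> b" for b
  proof (cases "b = 0")
    case False
    then have b: "0 < b" using that by simp
    have "J b = ennreal \<bar>b\<^sup>2\<bar> * (\<integral>\<^sup>+u. ennreal (heat (0 + b\<^sup>2 * u) 0 - heat (0 + b\<^sup>2 * u) b) \<partial>lborel)"
      unfolding J_def using b by (intro nn_integral_real_affine) auto
    also have "(\<lambda>u. heat (0 + b\<^sup>2 * u) 0 - heat (0 + b\<^sup>2 * u) b) = (\<lambda>u. 1 / b * (heat u 0 - heat u 1))"
      using heat_scale[OF b, of _ 0] heat_scale[OF b, of _ 1] by (auto simp: diff_divide_distrib)
    also have "(\<integral>\<^sup>+u. ennreal (1 / b * (heat u 0 - heat u 1)) \<partial>lborel) = ennreal (1 / b) * J 1"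
      unfolding J_def using b heat_antimono[of 0 1]
      by (subst nn_integral_cmult[symmetric]) (auto simp: ennreal_mult[symmetric])
    finally show ?thesis using b
      by (simp add: mult.assoc[symmetric] ennreal_mult[symmetric] power2_eq_square)
  qed (simp add: J_def)
  have J1: "J 1 \<le> 2" unfolding J_def by (rule nn_integral_heat_deficit_finite)
  \<comment> \<open>Finiteness of \<open>J 1\<close> is what permits subtracting \<open>J a\<close>
    from \<open>J b\<close> in \<open>ennreal\<close> below.\<close>
  then obtain j where j: "J 1 = ennreal j" "0 \<le> j" "j \<le> 2"
    by (cases "J 1") (auto simp: top_unique simp flip: ennreal_numeral)
  have main: "(\<integral>\<^sup>+u. ennreal (heat u a - heat u b) \<partial>lborel) = ennreal (j * (b - a))" if "0 \<le> a" "a \<le> b" for a b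
  proof -
    have "J b = J a + (\<integral>\<^sup>+u. ennreal (heat u a - heat u b) \<partial>lborel)"
      unfolding J_def using that heat_antimono[of 0 a] heat_antimono[of a b]
      by (subst nn_integral_add[symmetric]) (auto simp: ennreal_plus[symmetric] simp del: ennreal_plus)
    then have "ennreal (b * j) = ennreal (a * j) + (\<integral>\<^sup>+u. ennreal (heat u a - heat u b) \<partial>lborel)"
      using that j J_scale[of a] J_scale[of b] by (simp add: ennreal_mult)
    then have "(\<integral>\<^sup>+u. ennreal (heat u a - heat u b) \<partial>lborel) = ennreal (b * j) - ennreal (a * j)"
      by simp
    then show ?thesis using that j by (simp add: ennreal_minus algebra_simps)
  qed
  \<comment> \<open>For every \<open>u\<close> the kernel decreases with the distance, so the
    difference has a constant sign and the absolute value is harmless.\<close>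
  have sym: "(\<integral>\<^sup>+u. ennreal \<bar>heat u a - heat u b\<bar> \<partial>lborel) \<le> ennreal (2 * \<bar>a - b\<bar>)" if "\<bar>a\<bar> \<le> \<bar>b\<bar>" for a b
  proof -
    have "(\<integral>\<^sup>+u. ennreal \<bar>heat u a - heat u b\<bar> \<partial>lborel) = (\<integral>\<^sup>+u. ennreal (heat u \<bar>a\<bar> - heat u \<bar>b\<bar>) \<partial>lborel)"
      using heat_antimono[OF that] by (simp add: heat_abs)
    also have "\<dots> = ennreal (j * (\<bar>b\<bar> - \<bar>a\<bar>))" using that by (intro main) auto
    also have "\<dots> \<le> ennreal (2 * \<bar>a - b\<bar>)" using j that by (intro ennreal_leI mult_mono) auto
    finally show ?thesis .
  qed
  show ?thesis
  proof (cases "\<bar>a\<bar> \<le> \<bar>b\<bar>")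
    case False
    then show ?thesis using sym[of b a] by (simp add: abs_minus_commute)
  qed (rule sym)
qed

section \<open>Iterated heat kernel integrals\<close>

text \<open>For a Brownian motion that is at \<open>x\<close> at time \<open>s\<close>, this is the
  expected product of \<open>g\<close> at \<open>p\<close> ordered times, integrated over
  \<open>s < u_1 < ... < u_p \<le> T\<close>; hence a \<open>p\<close>-th moment divided by
  \<open>fact p\<close>, see \<open>moment_formula\<close>.\<close>

primrec heat_moment :: "(real \<Rightarrow> real) \<Rightarrow> real \<Rightarrow> nat \<Rightarrow> real \<Rightarrow> real \<Rightarrow> real" where
  "heat_moment g T 0 = (\<lambda>s x. 1)"
| "heat_moment g T (Suc p) =
     (\<lambda>s x. \<integral>(u, z). (if u \<le> T then heat (u - s) (z - x) * g z * heat_moment g T p u z else 0) \<partial>lborel)"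

lemma nn_integral_lborel_fst:
  fixes f :: "real \<times> real \<Rightarrow> ennreal"
  assumes [measurable]: "f \<in> borel_measurable borel"
  shows "(\<integral>\<^sup>+w. f w \<partial>lborel) = (\<integral>\<^sup>+u. \<integral>\<^sup>+z. f (u, z) \<partial>lborel \<partial>lborel)"
proof -
  have "(\<integral>\<^sup>+u. \<integral>\<^sup>+z. f (u, z) \<partial>lborel \<partial>lborel) = integral\<^sup>N (lborel \<Otimes>\<^sub>M lborel) f"
    by (rule lborel.nn_integral_fst) (simp add: lborel_prod)
  then show ?thesis by (simp add: lborel_prod)
qed

lemma nn_integral_lborel_snd:
  fixes f :: "real \<times> real \<Rightarrow> ennreal"
  assumes [measurable]: "f \<in> borel_measurable borel"
  shows "(\<integral>\<^sup>+w. f w \<partial>lborel) = (\<integral>\<^sup>+z. \<integral>\<^sup>+u. f (u, z) \<partial>lborel \<partial>lborel)"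
proof -
  have "(\<integral>\<^sup>+z. \<integral>\<^sup>+u. f (u, z) \<partial>lborel \<partial>lborel) = integral\<^sup>N (lborel \<Otimes>\<^sub>M lborel) f"
    by (rule lborel_pair.nn_integral_snd) (simp add: lborel_prod)
  then show ?thesis by (simp add: lborel_prod)
qed

lemma integrable_abs_integral_le:
  fixes f :: "'a \<Rightarrow> real"
  assumes [measurable]: "f \<in> borel_measurable M" and le: "(\<integral>\<^sup>+x. ennreal \<bar>f x\<bar> \<partial>M) \<le> ennreal c" and "0 \<le> c"
  shows "integrable M f" "\<bar>integral\<^sup>L M f\<bar> \<le> c"
proof -
  show int: "integrable M f"
    using le by (intro integrableI_bounded) (auto intro: le_less_trans)
  have "ennreal \<bar>integral\<^sup>L M f\<bar> \<le> ennreal c"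
    using integral_norm_bound_ennreal[OF int] le by (auto intro: order_trans)
  then show "\<bar>integral\<^sup>L M f\<bar> \<le> c" using \<open>0 \<le> c\<close> by (simp add: ennreal_le_iff)
qed

locale bounded_test =
  fixes g :: "real \<Rightarrow> real"
  assumes g_measurable [measurable]: "g \<in> borel_measurable borel"
    and g_le: "\<And>z. \<bar>g z\<bar> \<le> 1"
begin

lemma heat_moment_measurable [measurable]:
  "(\<lambda>(s, x). heat_moment g T p s x) \<in> borel_measurable (borel \<Otimes>\<^sub>M borel)"
proof (induction p)
  case (Suc p)
  note [measurable] = Suc
  show ?case unfolding heat_moment.simps lborel_prod[symmetric] by measurable
qed simp

text \<open>The kernel has mass 1 in space, which leaves the time integral of
  \<open>(T - u) ^ p / fact p\<close>. Kept apart from \<open>heat_moment\<close> because it also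
  dominates the series in \<open>laplace_occ_le\<close>.\<close>

lemma nn_integral_heat_moment_kernel:
  "(\<integral>\<^sup>+(u, z). ennreal \<bar>if u \<le> T then heat (u - s) (z - x) * g z * (max 0 (T - u) ^ p / fact p) else 0\<bar> \<partial>lborel)
    \<le> ennreal (max 0 (T - s) ^ Suc p / fact (Suc p))"
proof -
  define F where "F u = (if s < u \<and> u \<le> T then (T - u) ^ p / fact p else 0)" for u
  have "(\<integral>\<^sup>+(u, z). ennreal \<bar>if u \<le> T then heat (u - s) (z - x) * g z * (max 0 (T - u) ^ p / fact p) else 0\<bar> \<partial>lborel)
     = (\<integral>\<^sup>+u. \<integral>\<^sup>+z. ennreal \<bar>if u \<le> T then heat (u - s) (z - x) * g z * (max 0 (T - u) ^ p / fact p) else 0\<bar> \<partial>lborel \<partial>lborel)"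
    by (subst nn_integral_lborel_fst) (simp_all add: borel_prod[symmetric])
  also have "\<dots> \<le> (\<integral>\<^sup>+u. ennreal (F u) \<partial>lborel)"
  proof (rule nn_integral_mono)
    fix u :: real
    show "(\<integral>\<^sup>+z. ennreal \<bar>if u \<le> T then heat (u - s) (z - x) * g z * (max 0 (T - u) ^ p / fact p) else 0\<bar> \<partial>lborel) \<le> ennreal (F u)"
    proof (cases "s < u \<and> u \<le> T")
      case True
      have "(\<integral>\<^sup>+z. ennreal \<bar>if u \<le> T then heat (u - s) (z - x) * g z * (max 0 (T - u) ^ p / fact p) else 0\<bar> \<partial>lborel)
          \<le> (\<integral>\<^sup>+z. ennreal (F u) * ennreal (heat (u - s) (z - x)) \<partial>lborel)"
      proof (rule nn_integral_mono)
        fix z :: real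
        have "heat (u - s) (z - x) * \<bar>g z\<bar> * F u \<le> heat (u - s) (z - x) * 1 * F u"
          using True g_le[of z] by (intro mult_right_mono mult_left_mono) (auto simp: F_def)
        then show "ennreal \<bar>if u \<le> T then heat (u - s) (z - x) * g z * (max 0 (T - u) ^ p / fact p) else 0\<bar>
            \<le> ennreal (F u) * ennreal (heat (u - s) (z - x))"
          using True by (auto simp: abs_mult F_def max_def ennreal_mult[symmetric] mult.commute intro!: ennreal_leI)
      qed
      also have "\<dots> = ennreal (F u)"
        using True nn_integral_heat_space[of "u - s" x] by (subst nn_integral_cmult) auto
      finally show ?thesis .
    next
      case False
      then have "(if u \<le> T then heat (u - s) (z - x) * g z * (max 0 (T - u) ^ p / fact p) else 0) = 0" for z
        by (auto simp: heat_def)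
      then show ?thesis by simp
    qed
  qed
  also have "\<dots> \<le> ennreal (max 0 (T - s) ^ Suc p / fact (Suc p))"
  proof (cases "s \<le> T")
    case True
    define H where "H u = - ((T - u) ^ Suc p / fact (Suc p))" for u
    have "((\<lambda>u. (T - u) ^ p / fact p) has_integral (H T - H s)) {s..T}"
      unfolding H_def by (rule fundamental_theorem_of_calculus)
        (use True in \<open>auto intro!: derivative_eq_intros simp del: power_Suc simp: has_real_derivative_iff_has_vector_derivative[symmetric] fact_reduce divide_simps\<close>)
    then have "(\<integral>\<^sup>+u. ennreal ((T - u) ^ p / fact p) * indicator {s..T} u \<partial>lborel) = ennreal ((T - s) ^ Suc p / fact (Suc p))"
      by (intro nn_integral_has_integral_lebesgue') (auto simp: H_def)
    moreover have "(\<integral>\<^sup>+u. ennreal (F u) \<partial>lborel) \<le> (\<integral>\<^sup>+u. ennreal ((T - u) ^ p / fact p) * indicator {s..T} u \<partial>lborel)"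
      by (intro nn_integral_mono) (auto simp: F_def indicator_def)
    ultimately show ?thesis using True by (simp add: max_def)
  next
    case False
    then have "F u = 0" for u by (simp add: F_def)
    then show ?thesis by simp
  qed
  finally show ?thesis .
qed

text \<open>The crude bound by the volume of the simplex of ordered times, without cancellation. It
  yields integrability and, later, convergence of the exponential series.\<close>

lemma heat_moment_bound:
  "integrable lborel (\<lambda>(u, z). if u \<le> T then heat (u - s) (z - x) * g z * heat_moment g T p u z else 0)" (is "?I p")
  "\<bar>heat_moment g T p s x\<bar> \<le> max 0 (T - s) ^ p / fact p" (is "?B p s x")
proof -
  have *: "(\<integral>\<^sup>+w. ennreal \<bar>case w of (u, z) \<Rightarrow> if u \<le> T then heat (u - s) (z - x) * g z * heat_moment g T p u z else 0\<bar> \<partial>lborel)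
      \<le> ennreal (max 0 (T - s) ^ Suc p / fact (Suc p))" if "\<And>s x. ?B p s x" for s x p
  proof -
    have "(\<integral>\<^sup>+w. ennreal \<bar>case w of (u, z) \<Rightarrow> if u \<le> T then heat (u - s) (z - x) * g z * heat_moment g T p u z else 0\<bar> \<partial>lborel)
       \<le> (\<integral>\<^sup>+(u, z). ennreal \<bar>if u \<le> T then heat (u - s) (z - x) * g z * (max 0 (T - u) ^ p / fact p) else 0\<bar> \<partial>lborel)"
    proof (intro nn_integral_mono, clarify)
      fix u z :: real
      have "heat (u - s) (z - x) * \<bar>g z\<bar> * \<bar>heat_moment g T p u z\<bar> \<le> heat (u - s) (z - x) * \<bar>g z\<bar> * (max 0 (T - u) ^ p / fact p)"
        by (intro mult_left_mono that) simp
      then show "ennreal \<bar>if u \<le> T then heat (u - s) (z - x) * g z * heat_moment g T p u z else 0\<bar>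
        \<le> ennreal \<bar>if u \<le> T then heat (u - s) (z - x) * g z * (max 0 (T - u) ^ p / fact p) else 0\<bar>"
        by (cases "u \<le> T") (auto simp: abs_mult simp del: max.absorb2 intro!: ennreal_leI)
    qed
    then show ?thesis using nn_integral_heat_moment_kernel order_trans by blast
  qed
  have meas: "(\<lambda>(u, z). if u \<le> T then heat (u - s) (z - x) * g z * heat_moment g T p u z else 0) \<in> borel_measurable lborel" for s x p
    by (simp add: borel_prod[symmetric])
  have B: "?B p s x" for p s x
  proof (induction p arbitrary: s x)
    case (Suc p)
    show ?case unfolding heat_moment.simps
      by (rule integrable_abs_integral_le(2)[OF meas *]) (use Suc in auto)
  qed simp
  show "?B p s x" by (rule B)
  show "?I p" by (rule integrable_abs_integral_le(1)[OF meas *]) (use B in auto)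
qed

lemma heat_moment_bound_horizon:
  assumes "0 \<le> s" "0 \<le> T"
  shows "\<bar>heat_moment g T p s x\<bar> \<le> T ^ p / fact p"
proof -
  have "max 0 (T - s) ^ p / fact p \<le> T ^ p / fact p"
    using assms by (intro divide_right_mono power_mono) auto
  then show ?thesis using heat_moment_bound(2)[of T p s x] by linarith
qed

text \<open>Time homogeneity of the kernel; \<open>laplace_occ_le\<close> uses it to restart at time
  \<open>u\<close> with the remaining horizon.\<close>

lemma heat_moment_shift: "heat_moment g T p (s + r) x = heat_moment g (T - r) p s x"
proof (induction p arbitrary: s x)
  case (Suc p)
  have "heat_moment g T (Suc p) (s + r) x =
     (\<integral>(u, z). (if u \<le> T then heat (u - (s + r)) (z - x) * g z * heat_moment g T p u z else 0) \<partial>distr lborel borel ((+) (r, 0)))"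
    by (simp add: lborel_distr_plus)
  also have "\<dots> = (\<integral>w. (case (r, 0) + w of (u, z) \<Rightarrow> (if u \<le> T then heat (u - (s + r)) (z - x) * g z * heat_moment g T p u z else 0)) \<partial>lborel)"
    by (rule integral_distr) (simp, simp add: borel_prod[symmetric])
  also have "\<dots> = heat_moment g (T - r) (Suc p) s x"
    unfolding heat_moment.simps
    by (intro Bochner_Integration.integral_cong refl)
      (auto simp: Suc[symmetric] algebra_simps split: prod.split)
  finally show ?case .
qed simp

end

section \<open>Cancellation for test functions with mean zero\<close>

locale centred_test = bounded_test +
  fixes \<alpha> h T :: real
  assumes h: "0 < h" and T: "0 \<le> T"
    and supp: "\<And>z. z \<notin> {\<alpha>..\<alpha> + 2 * h} \<Longrightarrow> g z = 0"
    and mean_zero: "integral\<^sup>L lborel g = 0"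
begin

text \<open>Time is integrated first, where the singularity of the kernel is integrable uniformly in
  \<open>z\<close>; the support of \<open>g\<close> then contributes its length
  \<open>2 * h\<close>.\<close>

lemma pair_bound:
  fixes f :: "real \<times> real \<Rightarrow> real"
  assumes [measurable]: "f \<in> borel_measurable borel" and c: "0 \<le> c"
    and le: "\<And>z. (\<integral>\<^sup>+u. ennreal \<bar>f (u, z)\<bar> \<partial>lborel) \<le> ennreal (c * \<bar>g z\<bar>)"
  shows "integrable lborel f" "\<bar>integral\<^sup>L lborel f\<bar> \<le> 2 * h * c"
proof -
  have "(\<integral>\<^sup>+w. ennreal \<bar>f w\<bar> \<partial>lborel) = (\<integral>\<^sup>+z. \<integral>\<^sup>+u. ennreal \<bar>f (u, z)\<bar> \<partial>lborel \<partial>lborel)"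
    by (rule nn_integral_lborel_snd) simp
  also have "\<dots> \<le> (\<integral>\<^sup>+z. ennreal c * indicator {\<alpha>..\<alpha> + 2 * h} z \<partial>lborel)"
  proof (intro nn_integral_mono order_trans[OF le])
    fix z
    show "ennreal (c * \<bar>g z\<bar>) \<le> ennreal c * indicator {\<alpha>..\<alpha> + 2 * h} z"
      using supp[of z] g_le[of z] c by (auto simp: indicator_def intro!: ennreal_leI mult_left_le)
  qed
  also have "\<dots> = ennreal c * ennreal (2 * h)"
    using h by (subst nn_integral_cmult_indicator) auto
  finally have "(\<integral>\<^sup>+w. ennreal \<bar>f w\<bar> \<partial>lborel) \<le> ennreal (2 * h * c)"
    using c h by (simp add: ennreal_mult[symmetric] mult.commute)
  from integrable_abs_integral_le[OF _ this] show "integrable lborel f" "\<bar>integral\<^sup>L lborel f\<bar> \<le> 2 * h * c"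
    using c h by auto
qed

lemma nn_integral_killed_heat:
  assumes "0 \<le> s"
  shows "(\<integral>\<^sup>+u. ennreal \<bar>if u \<le> T then heat (u - s) y else 0\<bar> \<partial>lborel) \<le> ennreal (sqrt T)"
proof -
  have "(\<integral>\<^sup>+u. ennreal \<bar>if u \<le> T then heat (u - s) y else 0\<bar> \<partial>lborel) =
      (\<integral>\<^sup>+u. ennreal \<bar>if s + 1 * u \<le> T then heat (s + 1 * u - s) y else 0\<bar> \<partial>lborel)"
    by (subst nn_integral_real_affine[where c = 1 and t = s]) auto
  also have "\<dots> \<le> (\<integral>\<^sup>+u. ennreal (indicator {0..T} u * heat u y) \<partial>lborel)"
    using assms by (intro nn_integral_mono ennreal_leI) (auto simp: indicator_def heat_def)
  also have "\<dots> \<le> ennreal (sqrt T)" by (rule nn_integral_heat_time[OF T])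
  finally show ?thesis .
qed

lemma nn_integral_killed_heat_diff:
  "(\<integral>\<^sup>+u. ennreal \<bar>(if u \<le> T then heat (u - s) y else 0) - (if u \<le> T then heat (u - s) y' else 0)\<bar> \<partial>lborel)
    \<le> ennreal (2 * \<bar>y - y'\<bar>)"
proof -
  have "(\<integral>\<^sup>+u. ennreal \<bar>(if u \<le> T then heat (u - s) y else 0) - (if u \<le> T then heat (u - s) y' else 0)\<bar> \<partial>lborel)
     \<le> (\<integral>\<^sup>+u. ennreal \<bar>heat (u - s) y - heat (u - s) y'\<bar> \<partial>lborel)"
    by (intro nn_integral_mono) auto
  also have "\<dots> = (\<integral>\<^sup>+u. ennreal \<bar>heat (s + 1 * u - s) y - heat (s + 1 * u - s) y'\<bar> \<partial>lborel)"
    by (subst nn_integral_real_affine[where c = 1 and t = s]) auto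
  also have "\<dots> \<le> ennreal (2 * \<bar>y - y'\<bar>)"
    using nn_integral_heat_diff_abs by simp
  finally show ?thesis .
qed

text \<open>The condition \<open>k u \<noteq> 0\<close> matters: the moments are bounded only for
  nonnegative starting times, and the kernel vanishes at all other \<open>u\<close>.\<close>

lemma nn_integral_times_bounded:
  fixes k :: "real \<Rightarrow> real"
  assumes [measurable]: "k \<in> borel_measurable borel" and "\<And>u. k u \<noteq> 0 \<Longrightarrow> \<bar>v u\<bar> \<le> C" "0 \<le> C" "0 \<le> c"
    and "(\<integral>\<^sup>+u. ennreal \<bar>k u\<bar> \<partial>lborel) \<le> ennreal c"
  shows "(\<integral>\<^sup>+u. ennreal \<bar>k u * a * v u\<bar> \<partial>lborel) \<le> ennreal (c * C * \<bar>a\<bar>)"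
proof -
  have "(\<integral>\<^sup>+u. ennreal \<bar>k u * a * v u\<bar> \<partial>lborel) \<le> (\<integral>\<^sup>+u. ennreal (C * \<bar>a\<bar>) * ennreal \<bar>k u\<bar> \<partial>lborel)"
  proof (rule nn_integral_mono)
    fix u
    have "\<bar>k u\<bar> * \<bar>a\<bar> * \<bar>v u\<bar> \<le> \<bar>k u\<bar> * \<bar>a\<bar> * C"
      using assms(2)[of u] by (cases "k u = 0") (auto intro!: mult_left_mono)
    then show "ennreal \<bar>k u * a * v u\<bar> \<le> ennreal (C * \<bar>a\<bar>) * ennreal \<bar>k u\<bar>"
      using assms(3) by (simp add: abs_mult ennreal_mult[symmetric] mult_ac ennreal_leI)
  qed
  also have "\<dots> = ennreal (C * \<bar>a\<bar>) * (\<integral>\<^sup>+u. ennreal \<bar>k u\<bar> \<partial>lborel)"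
    by (rule nn_integral_cmult) simp
  also have "\<dots> \<le> ennreal (C * \<bar>a\<bar>) * ennreal c"
    by (intro mult_left_mono assms) simp
  finally show ?thesis using assms by (simp add: ennreal_mult[symmetric] mult_ac)
qed

text \<open>A plain step without cancellation: \<open>sqrt T\<close> from the time integral of the
  kernel and \<open>2 * h\<close> from the support of \<open>g\<close>.\<close>

lemma heat_moment_sup_step:
  assumes S: "\<And>s x. 0 \<le> s \<Longrightarrow> \<bar>heat_moment g T p s x\<bar> \<le> S" and s: "0 \<le> s"
  shows "\<bar>heat_moment g T (Suc p) s x\<bar> \<le> 2 * h * (sqrt T * S)"
  unfolding heat_moment.simps
proof (rule pair_bound)
  have "0 \<le> S" using S[OF s] by (rule order_trans[OF abs_ge_zero])
  then show "0 \<le> sqrt T * S" using T by simp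
  fix z
  have "(\<integral>\<^sup>+u. ennreal \<bar>(if u \<le> T then heat (u - s) (z - x) else 0) * g z * heat_moment g T p u z\<bar> \<partial>lborel)
      \<le> ennreal (sqrt T * S * \<bar>g z\<bar>)"
  proof (rule nn_integral_times_bounded)
    show "(\<integral>\<^sup>+ u. ennreal \<bar>if u \<le> T then heat (u - s) (z - x) else 0\<bar> \<partial>lborel) \<le> ennreal (sqrt T)"
      by (rule nn_integral_killed_heat[OF s])
  qed (use S s T \<open>0 \<le> S\<close> in \<open>auto simp: heat_def split: if_splits\<close>)
  then show "(\<integral>\<^sup>+u. ennreal \<bar>case (u, z) of (u, z) \<Rightarrow> if u \<le> T then heat (u - s) (z - x) * g z * heat_moment g T p u z else 0\<bar> \<partial>lborel)
      \<le> ennreal (sqrt T * S * \<bar>g z\<bar>)"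
    by (simp add: if_distrib[where f = "\<lambda>v. v * _"] cong: if_cong)
qed (simp add: borel_prod[symmetric])

text \<open>The starting point enters only through the kernel, whose differences integrate over all
  times to at most twice the distance; hence no power of \<open>T\<close> appears.\<close>

lemma heat_moment_lipschitz_step:
  assumes S: "\<And>s x. 0 \<le> s \<Longrightarrow> \<bar>heat_moment g T p s x\<bar> \<le> S" and s: "0 \<le> s"
  shows "\<bar>heat_moment g T (Suc p) s x - heat_moment g T (Suc p) s x'\<bar> \<le> 2 * h * (2 * \<bar>x - x'\<bar> * S)"
proof -
  have S0: "0 \<le> S" using S[OF s] by (rule order_trans[OF abs_ge_zero])
  let ?k = "\<lambda>x u z. if u \<le> T then heat (u - s) (z - x) else 0"
  have "heat_moment g T (Suc p) s x - heat_moment g T (Suc p) s x' =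
     (\<integral>w. (case w of (u, z) \<Rightarrow> (?k x u z - ?k x' u z) * g z * heat_moment g T p u z) \<partial>lborel)"
    unfolding heat_moment.simps
    by (subst Bochner_Integration.integral_diff[symmetric])
      (auto intro!: heat_moment_bound Bochner_Integration.integral_cong simp: algebra_simps)
  also have "\<bar>\<dots>\<bar> \<le> 2 * h * (2 * \<bar>x - x'\<bar> * S)"
  proof (rule pair_bound)
    show "0 \<le> 2 * \<bar>x - x'\<bar> * S" using S0 by simp
    fix z
    have "(\<integral>\<^sup>+u. ennreal \<bar>(?k x u z - ?k x' u z) * g z * heat_moment g T p u z\<bar> \<partial>lborel)
        \<le> ennreal (2 * \<bar>x - x'\<bar> * S * \<bar>g z\<bar>)"
    proof (rule nn_integral_times_bounded)
      show "(\<integral>\<^sup>+ u. ennreal \<bar>?k x u z - ?k x' u z\<bar> \<partial>lborel) \<le> ennreal (2 * \<bar>x - x'\<bar>)"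
        using nn_integral_killed_heat_diff[of s "z - x" "z - x'"] by (simp add: abs_minus_commute)
    qed (use S s T S0 in \<open>auto simp: heat_def split: if_splits\<close>)
    then show "(\<integral>\<^sup>+u. ennreal \<bar>case (u, z) of (u, z) \<Rightarrow> (?k x u z - ?k x' u z) * g z * heat_moment g T p u z\<bar> \<partial>lborel)
      \<le> ennreal (2 * \<bar>x - x'\<bar> * S * \<bar>g z\<bar>)" by simp
  qed (simp add: borel_prod[symmetric])
  finally show ?thesis .
qed

text \<open>Since \<open>g\<close> has mean zero, both the kernel and the lower moment may be recentred at \<open>\<alpha>\<close>.\<close>

lemma heat_moment_cancel_step:
  assumes S: "\<And>s x. 0 \<le> s \<Longrightarrow> \<bar>heat_moment g T p s x\<bar> \<le> S"
    and K: "\<And>s x x'. 0 \<le> s \<Longrightarrow> \<bar>heat_moment g T p s x - heat_moment g T p s x'\<bar> \<le> K * \<bar>x - x'\<bar>"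
    and s: "0 \<le> s"
  shows "\<bar>heat_moment g T (Suc p) s x\<bar> \<le> 8 * h\<^sup>2 * S + 4 * h\<^sup>2 * (sqrt T * K)"
proof -
  have S0: "0 \<le> S" using S[OF s] by (rule order_trans[OF abs_ge_zero])
  have K0: "0 \<le> K" using K[OF s, of 0 1] by (simp add: order_trans[OF abs_ge_zero])
  let ?k = "\<lambda>y u. if u \<le> T then heat (u - s) (y - x) else 0"
  let ?V = "heat_moment g T p"
  \<comment> \<open>\<open>?f1\<close> uses the Lipschitz bound \<open>K\<close> of the lower moment
    and \<open>?f2\<close> the time-integrated one of the kernel; \<open>?f3\<close> integrates to 0
    because \<open>z\<close> survives only in \<open>g z\<close>.\<close>
  let ?f1 = "\<lambda>(u, z). ?k z u * g z * (?V u z - ?V u \<alpha>)"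
  let ?f2 = "\<lambda>(u, z). (?k z u - ?k \<alpha> u) * g z * ?V u \<alpha>"
  let ?f3 = "\<lambda>(u, z). ?k \<alpha> u * g z * ?V u \<alpha>"
  have near: "\<bar>z - \<alpha>\<bar> \<le> 2 * h" if "g z \<noteq> 0" for z
  proof -
    have "z \<in> {\<alpha>..\<alpha> + 2 * h}" using supp that by blast
    then show ?thesis by auto
  qed
  have c_f1: "0 \<le> sqrt T * (K * (2 * h))" using T K0 S0 h by simp
  have m_f1: "?f1 \<in> borel_measurable borel" by (simp add: borel_prod[symmetric])
  have le_f1: "(\<integral>\<^sup>+u. ennreal \<bar>?f1 (u, z)\<bar> \<partial>lborel) \<le> ennreal (sqrt T * (K * (2 * h)) * \<bar>g z\<bar>)" for z
  proof (cases "g z = 0")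
    case False
    have "(\<integral>\<^sup>+u. ennreal \<bar>?k z u * g z * (?V u z - ?V u \<alpha>)\<bar> \<partial>lborel) \<le> ennreal (sqrt T * (K * (2 * h)) * \<bar>g z\<bar>)"
    proof (rule nn_integral_times_bounded)
      show "(\<integral>\<^sup>+u. ennreal \<bar>?k z u\<bar> \<partial>lborel) \<le> ennreal (sqrt T)"
        by (rule nn_integral_killed_heat[OF s])
      fix u assume "?k z u \<noteq> 0"
      then have "0 \<le> u" using s by (auto simp: heat_def split: if_splits)
      then have "\<bar>?V u z - ?V u \<alpha>\<bar> \<le> K * \<bar>z - \<alpha>\<bar>" by (rule K)
      also have "\<dots> \<le> K * (2 * h)" using near[OF False] K0 by (rule mult_left_mono)
      finally show "\<bar>?V u z - ?V u \<alpha>\<bar> \<le> K * (2 * h)" .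
    qed (use T K0 h in auto)
    then show ?thesis by simp
  qed simp
  note f1 = pair_bound[OF m_f1 c_f1 le_f1]
  have c_f2: "0 \<le> 2 * (2 * h) * S" using T K0 S0 h by simp
  have m_f2: "?f2 \<in> borel_measurable borel" by (simp add: borel_prod[symmetric])
  have le_f2: "(\<integral>\<^sup>+u. ennreal \<bar>?f2 (u, z)\<bar> \<partial>lborel) \<le> ennreal (2 * (2 * h) * S * \<bar>g z\<bar>)" for z
  proof (cases "g z = 0")
    case False
    have "(\<integral>\<^sup>+u. ennreal \<bar>(?k z u - ?k \<alpha> u) * g z * ?V u \<alpha>\<bar> \<partial>lborel) \<le> ennreal (2 * (2 * h) * S * \<bar>g z\<bar>)"
    proof (rule nn_integral_times_bounded)
      show "(\<integral>\<^sup>+u. ennreal \<bar>?k z u - ?k \<alpha> u\<bar> \<partial>lborel) \<le> ennreal (2 * (2 * h))"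
        using near[OF False] by (intro order_trans[OF nn_integral_killed_heat_diff] ennreal_leI) auto
    qed (use S S0 s h in \<open>auto simp: heat_def split: if_splits\<close>)
    then show ?thesis by simp
  qed simp
  note f2 = pair_bound[OF m_f2 c_f2 le_f2]
  have f3: "integrable lborel ?f3"
  proof (rule pair_bound)
    show "0 \<le> sqrt T * S" using T S0 by simp
    fix z
    have "(\<integral>\<^sup>+u. ennreal \<bar>?k \<alpha> u * g z * ?V u \<alpha>\<bar> \<partial>lborel) \<le> ennreal (sqrt T * S * \<bar>g z\<bar>)"
    proof (rule nn_integral_times_bounded)
      show "(\<integral>\<^sup>+u. ennreal \<bar>?k \<alpha> u\<bar> \<partial>lborel) \<le> ennreal (sqrt T)"
        by (rule nn_integral_killed_heat[OF s])
    qed (use T S S0 s in \<open>auto simp: heat_def split: if_splits\<close>)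
    then show "(\<integral>\<^sup>+u. ennreal \<bar>?f3 (u, z)\<bar> \<partial>lborel) \<le> ennreal (sqrt T * S * \<bar>g z\<bar>)" by simp
  qed (simp add: borel_prod[symmetric])
  have f3_zero: "integral\<^sup>L lborel ?f3 = 0"
  proof -
    have "integral\<^sup>L lborel ?f3 = integral\<^sup>L (lborel \<Otimes>\<^sub>M lborel) ?f3" by (simp add: lborel_prod)
    also have "\<dots> = (\<integral>u. \<integral>z. ?f3 (u, z) \<partial>lborel \<partial>lborel)"
      using f3 by (intro lborel_pair.integral_fst'[symmetric]) (simp add: lborel_prod)
    also have "\<dots> = 0"
      using mean_zero by (simp add: mult.commute[of _ "g _"] mult.assoc)
    finally show ?thesis .
  qed
  have "heat_moment g T (Suc p) s x = (\<integral>w. ?f1 w + ?f2 w + ?f3 w \<partial>lborel)"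
    unfolding heat_moment.simps
    by (intro Bochner_Integration.integral_cong refl) (auto simp: algebra_simps)
  also have "\<dots> = integral\<^sup>L lborel ?f1 + integral\<^sup>L lborel ?f2 + integral\<^sup>L lborel ?f3"
    by (subst Bochner_Integration.integral_add Bochner_Integration.integrable_add; (intro Bochner_Integration.integrable_add)?; (rule f1 f2 f3)?)+ simp
  finally show ?thesis using f1(2) f2(2) f3_zero by (simp add: power2_eq_square algebra_simps)
qed

text \<open>Steps are taken in pairs: the first uses the mean zero of \<open>g\<close> and consumes
  a Lipschitz constant of the moment below, the second restores both a bound and a Lipschitz
  constant. A pair costs \<open>h ^ 3 * sqrt T\<close>, where two plain steps would cost
  \<open>h\<^sup>2 * T\<close>. The constants are 12 for the cancelling step, then a factor 2 for
  the bound and 4 for the Lipschitz constant, which gives 48.\<close>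

lemma heat_moment_even_bounds:
  shows "(\<forall>s\<ge>0. \<forall>x. \<bar>heat_moment g T (2 * k) s x\<bar> \<le> (48 * h ^ 3 * sqrt T) ^ k) \<and>
   (\<exists>K. (\<forall>s\<ge>0. \<forall>x x'. \<bar>heat_moment g T (2 * k) s x - heat_moment g T (2 * k) s x'\<bar> \<le> K * \<bar>x - x'\<bar>) \<and>
      sqrt T * K \<le> (48 * h ^ 3 * sqrt T) ^ k)"
proof (induction k)
  case 0
  then show ?case by (auto intro!: exI[of _ 0])
next
  case (Suc k)
  define A where "A = (48 * h ^ 3 * sqrt T) ^ k"
  obtain K where S: "\<And>s x. 0 \<le> s \<Longrightarrow> \<bar>heat_moment g T (2 * k) s x\<bar> \<le> A"
    and K: "\<And>s x x'. 0 \<le> s \<Longrightarrow> \<bar>heat_moment g T (2 * k) s x - heat_moment g T (2 * k) s x'\<bar> \<le> K * \<bar>x - x'\<bar>"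
    and KA: "sqrt T * K \<le> A"
    using Suc unfolding A_def by blast
  have odd: "\<bar>heat_moment g T (Suc (2 * k)) s x\<bar> \<le> 12 * h\<^sup>2 * A" if "0 \<le> s" for s x
  proof -
    have "\<bar>heat_moment g T (Suc (2 * k)) s x\<bar> \<le> 8 * h\<^sup>2 * A + 4 * h\<^sup>2 * (sqrt T * K)"
      by (rule heat_moment_cancel_step) (use S K that in auto)
    also have "\<dots> \<le> 8 * h\<^sup>2 * A + 4 * h\<^sup>2 * A" using KA h by simp
    also have "\<dots> = 12 * h\<^sup>2 * A" by simp
    finally show ?thesis .
  qed
  have A0: "0 \<le> A" using h T by (simp add: A_def)
  have Q: "(48 * h ^ 3 * sqrt T) ^ Suc k = 48 * h ^ 3 * sqrt T * A" by (simp add: A_def)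
  have e: "2 * Suc k = Suc (Suc (2 * k))" by simp
  show ?case unfolding e Q
  proof (intro conjI exI[of _ "48 * h ^ 3 * A"] allI impI)
    fix s x x' :: real assume s: "0 \<le> s"
    have "\<bar>heat_moment g T (Suc (Suc (2 * k))) s x\<bar> \<le> 2 * h * (sqrt T * (12 * h\<^sup>2 * A))"
      by (rule heat_moment_sup_step) (use odd s in auto)
    also have "\<dots> = 24 * h ^ 3 * sqrt T * A" by (simp add: power2_eq_square power3_eq_cube)
    also have "\<dots> \<le> 48 * h ^ 3 * sqrt T * A" using h T A0 by (intro mult_right_mono) auto
    finally show "\<bar>heat_moment g T (Suc (Suc (2 * k))) s x\<bar> \<le> 48 * h ^ 3 * sqrt T * A" .
    have "\<bar>heat_moment g T (Suc (Suc (2 * k))) s x - heat_moment g T (Suc (Suc (2 * k))) s x'\<bar> \<le> 2 * h * (2 * \<bar>x - x'\<bar> * (12 * h\<^sup>2 * A))"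
      by (rule heat_moment_lipschitz_step) (use odd s in auto)
    also have "\<dots> = 48 * h ^ 3 * A * \<bar>x - x'\<bar>" by (simp add: power2_eq_square power3_eq_cube)
    finally show "\<bar>heat_moment g T (Suc (Suc (2 * k))) s x - heat_moment g T (Suc (Suc (2 * k))) s x'\<bar> \<le> 48 * h ^ 3 * A * \<bar>x - x'\<bar>" .
  qed simp
qed

end

section \<open>Moments of occupation functionals\<close>

lemma integrable_indicator_Icc:
  fixes f :: "real \<Rightarrow> real"
  assumes [measurable]: "f \<in> borel_measurable borel" and "\<And>v. v \<in> {a..c} \<Longrightarrow> \<bar>f v\<bar> \<le> C"
  shows "integrable lborel (\<lambda>v. indicator {a..c} v * f v)"
proof -
  have "integrable lborel (\<lambda>v. indicator {a..c} v *\<^sub>R f v)"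
    by (rule integrableI_bounded_set_indicator[where B = C]) (use assms in \<open>auto simp: emeasure_lborel_Icc_eq\<close>)
  then show ?thesis by simp
qed

lemma abs_integral_indicator_Icc_le:
  fixes f :: "real \<Rightarrow> real"
  assumes [measurable]: "f \<in> borel_measurable borel" and C: "\<And>v. v \<in> {a..c} \<Longrightarrow> \<bar>f v\<bar> \<le> C" and "a \<le> c"
  shows "\<bar>\<integral>v. indicator {a..c} v * f v \<partial>lborel\<bar> \<le> C * (c - a)"
proof -
  have C0: "0 \<le> C" using C[of a] \<open>a \<le> c\<close> by (auto intro: order_trans[OF abs_ge_zero])
  have "(\<integral>\<^sup>+v. ennreal \<bar>indicator {a..c} v * f v\<bar> \<partial>lborel) \<le> (\<integral>\<^sup>+v. ennreal C * indicator {a..c} v \<partial>lborel)"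
    using C by (intro nn_integral_mono) (auto simp: indicator_def intro!: ennreal_leI)
  also have "\<dots> = ennreal (C * (c - a))"
    using C0 \<open>a \<le> c\<close> by (subst nn_integral_cmult_indicator) (auto simp: ennreal_mult)
  finally show ?thesis
    using C0 \<open>a \<le> c\<close> by (intro integrable_abs_integral_le(2)) auto
qed

text \<open>Formally \<open>A\<close> has derivative \<open>- f\<close>, but \<open>f\<close> is
  merely measurable, so the fundamental theorem of calculus is replaced by Fubini over
  \<open>s \<le> u \<le> w \<le> T\<close>. This gives a linear equation for the integral of order
  \<open>Suc p\<close>, which is solved at the end.\<close>

lemma iterated_power_integral:
  fixes f :: "real \<Rightarrow> real" and T :: real
  assumes [measurable]: "f \<in> borel_measurable borel" and f: "\<And>u. \<bar>f u\<bar> \<le> 1"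
  defines "A \<equiv> \<lambda>u. \<integral>v. indicator {u..T} v * f v \<partial>lborel"
  shows "(\<integral>u. indicator {s..T} u * (f u * A u ^ p) \<partial>lborel) = A s ^ Suc p / real (Suc p)"
proof -
  have A_meas [measurable]: "A \<in> borel_measurable borel"
  proof -
    have "A = (\<lambda>u. \<integral>v. (if u \<le> v \<and> v \<le> T then f v else 0) \<partial>lborel)"
      unfolding A_def by (intro ext Bochner_Integration.integral_cong) (auto simp: indicator_def)
    then show ?thesis by simp
  qed
  have A_le: "\<bar>A u\<bar> \<le> T - s" if "u \<in> {s..T}" for u s
  proof -
    have "\<bar>A u\<bar> \<le> 1 * (T - u)" unfolding A_def
      by (rule abs_integral_indicator_Icc_le) (use f that in auto)
    then show ?thesis using that by simp
  qed
  have le: "\<bar>f u * A u ^ p\<bar> \<le> (T - s) ^ p" if "u \<in> {s..T}" for u p s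
  proof -
    have "\<bar>f u\<bar> * \<bar>A u\<bar> ^ p \<le> 1 * (T - s) ^ p"
      using A_le[OF that] f that by (intro mult_mono power_mono) auto
    then show ?thesis by (simp add: abs_mult power_abs)
  qed
  define Q where "Q p s = (\<integral>u. indicator {s..T} u * (f u * A u ^ p) \<partial>lborel)" for p s
  have "Q p s = A s ^ Suc p / real (Suc p)" for s
  proof (induction p arbitrary: s)
    case 0
    then show ?case by (simp add: Q_def A_def)
  next
    case (Suc p)
    define G where "G u w = indicator {s..T} u * f u * (indicator {u..T} w * (f w * A w ^ p))" for u w
    have G_if: "G = (\<lambda>u w. if s \<le> u \<and> u \<le> w \<and> w \<le> T then f u * (f w * A w ^ p) else 0)"
      by (auto simp: G_def indicator_def fun_eq_iff)
    have G_int: "integrable (lborel \<Otimes>\<^sub>M lborel) (\<lambda>(u, w). G u w)"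
    proof (rule integrableI_bounded_set[where A = "{s..T} \<times> {s..T}" and B = "max 0 (T - s) ^ p"])
      show "(\<lambda>(u, w). G u w) \<in> borel_measurable (lborel \<Otimes>\<^sub>M lborel)" unfolding G_if by measurable
      show "emeasure (lborel \<Otimes>\<^sub>M lborel) ({s..T} \<times> {s..T}) < \<infinity>"
        by (subst lborel.emeasure_pair_measure_Times) (auto simp: emeasure_lborel_Icc_eq ennreal_mult_less_top)
      show "AE x in lborel \<Otimes>\<^sub>M lborel. x \<in> {s..T} \<times> {s..T} \<longrightarrow> norm (case x of (u, w) \<Rightarrow> G u w) \<le> max 0 (T - s) ^ p"
      proof (intro AE_I2 impI)
        fix x :: "real \<times> real" assume "x \<in> {s..T} \<times> {s..T}"
        then obtain u w where x: "x = (u, w)" "u \<in> {s..T}" "w \<in> {s..T}" by auto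
        have "\<bar>f u\<bar> * \<bar>f w * A w ^ p\<bar> \<le> 1 * (T - s) ^ p"
          using le[OF x(3), of p] f[of u] by (intro mult_mono) auto
        then show "norm (case x of (u, w) \<Rightarrow> G u w) \<le> max 0 (T - s) ^ p"
          using x by (auto simp: G_def abs_mult indicator_def)
      qed
    qed (auto simp: G_def indicator_def)
    have inner: "(\<integral>u. indicator {s..w} u * f u \<partial>lborel) = A s - A w" if "w \<in> {s..T}" for w
    proof -
      have "A s = (\<integral>u. indicator {s..w} u * f u + indicator {w..T} u * f u \<partial>lborel)"
        unfolding A_def using AE_lborel_singleton[of w] that
        by (intro integral_cong_AE) (auto elim!: eventually_mono simp: indicator_def)
      also have "\<dots> = (\<integral>u. indicator {s..w} u * f u \<partial>lborel) + A w"
        unfolding A_def using f by (intro Bochner_Integration.integral_add integrable_indicator_Icc) auto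
      finally show ?thesis by simp
    qed
    have "Q (Suc p) s = (\<integral>u. indicator {s..T} u * f u * (real (Suc p) * Q p u) \<partial>lborel)"
      unfolding Suc[of _] by (simp add: Q_def mult_ac)
    also have "\<dots> = real (Suc p) * (\<integral>u. \<integral>w. G u w \<partial>lborel \<partial>lborel)"
      by (simp add: G_def Q_def mult_ac flip: integral_mult_right_zero)
    also have "(\<integral>u. \<integral>w. G u w \<partial>lborel \<partial>lborel) = (\<integral>w. \<integral>u. G u w \<partial>lborel \<partial>lborel)"
      by (rule lborel_pair.Fubini_integral[OF G_int, symmetric])
    also have "\<dots> = (\<integral>w. A s * (indicator {s..T} w * (f w * A w ^ p)) - indicator {s..T} w * (f w * A w ^ Suc p) \<partial>lborel)"
    proof (rule Bochner_Integration.integral_cong[OF refl])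
      fix w
      have "G u w = indicator {s..T} w * (f w * A w ^ p) * (indicator {s..w} u * f u)" for u
        by (auto simp: G_def indicator_def)
      then have "(\<integral>u. G u w \<partial>lborel) = indicator {s..T} w * (f w * A w ^ p) * (\<integral>u. indicator {s..w} u * f u \<partial>lborel)"
        by simp
      also have "\<dots> = indicator {s..T} w * (f w * A w ^ p) * (A s - A w)"
        using inner[of w] by (auto simp: indicator_def)
      finally show "(\<integral>u. G u w \<partial>lborel) = A s * (indicator {s..T} w * (f w * A w ^ p)) - indicator {s..T} w * (f w * A w ^ Suc p)"
        by (simp add: algebra_simps)
    qed
    also have "\<dots> = A s * Q p s - Q (Suc p) s"
      unfolding Q_def
      by (subst Bochner_Integration.integral_diff)
        (auto intro!: integrable_mult_right integrable_indicator_Icc le simp del: power_Suc)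
    finally have "Q (Suc p) s = real (Suc p) * (A s * Q p s - Q (Suc p) s)" .
    also have "A s * Q p s = A s ^ Suc (Suc p) / real (Suc p)" unfolding Suc by simp
    also have "real (Suc p) * (A s ^ Suc (Suc p) / real (Suc p) - Q (Suc p) s) = A s ^ Suc (Suc p) - real (Suc p) * Q (Suc p) s"
      by (simp only: right_diff_distrib) simp
    finally have "real (Suc (Suc p)) * Q (Suc p) s = A s ^ Suc (Suc p)"
      by (simp only: of_nat_Suc[of "Suc p"] distrib_right)
    then show ?case by (simp add: eq_divide_eq mult.commute)
  qed
  then show ?thesis by (simp add: Q_def)
qed

section \<open>Markov property and moment formula\<close>

locale continuous_brownian_motion = standard_brownian_motion M B
  for M :: "'a measure" and B :: "real \<Rightarrow> 'a \<Rightarrow> real" +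
  assumes rv_all [measurable]: "\<And>t. B t \<in> borel_measurable M"
    and paths: "\<And>\<omega>. continuous_on UNIV (\<lambda>t. B t \<omega>)"
    and zero: "\<And>\<omega>. B 0 \<omega> = 0"
begin

text \<open>Continuity makes \<open>B\<close> a pointwise limit of processes frozen on dyadic time
  intervals, which are jointly measurable since only countably many times occur.\<close>

lemma joint_measurable [measurable]: "(\<lambda>(u, \<omega>). B u \<omega>) \<in> borel_measurable (borel \<Otimes>\<^sub>M M)"
proof (rule borel_measurable_LIMSEQ_real)
  fix n :: nat
  show "(\<lambda>w. B (real_of_int \<lfloor>fst w * (2 :: real) ^ n\<rfloor> / 2 ^ n) (snd w)) \<in> borel_measurable (borel \<Otimes>\<^sub>M M)"
    by (rule measurable_compose_countable[where f = "\<lambda>i w. B (real_of_int i / 2 ^ n) (snd w)"]) measurable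
next
  fix w :: "real \<times> 'a" assume "w \<in> space (borel \<Otimes>\<^sub>M M)"
  obtain u \<omega> where w: "w = (u, \<omega>)" by (cases w)
  have "(\<lambda>n. real_of_int \<lfloor>u * 2 ^ n\<rfloor> / 2 ^ n) \<longlonglongrightarrow> u"
  proof (rule tendsto_sandwich)
    show "(\<lambda>n. u - (1 / 2) ^ n) \<longlonglongrightarrow> u"
      using tendsto_diff[OF tendsto_const LIMSEQ_power_zero[of "1 / 2 :: real"], of u] by simp
    show "\<forall>\<^sub>F n in sequentially. u - (1 / 2) ^ n \<le> real_of_int \<lfloor>u * 2 ^ n\<rfloor> / 2 ^ n"
    proof (intro always_eventually allI)
      fix n :: nat
      have "(u - (1 / 2) ^ n) * 2 ^ n = u * 2 ^ n - 1" by (simp add: left_diff_distrib power_divide)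
      also have "\<dots> \<le> real_of_int \<lfloor>u * 2 ^ n\<rfloor>" using floor_correct[of "u * 2 ^ n"] by linarith
      finally show "u - (1 / 2) ^ n \<le> real_of_int \<lfloor>u * 2 ^ n\<rfloor> / 2 ^ n" by (simp add: le_divide_eq)
    qed
    show "\<forall>\<^sub>F n in sequentially. real_of_int \<lfloor>u * 2 ^ n\<rfloor> / 2 ^ n \<le> u"
      by (intro always_eventually allI) (simp add: divide_le_eq)
  qed auto
  moreover have "isCont (\<lambda>t. B t \<omega>) u" using paths[of \<omega>] by (simp add: continuous_on_eq_continuous_at)
  ultimately show "(\<lambda>n. B (real_of_int \<lfloor>fst w * (2 :: real) ^ n\<rfloor> / 2 ^ n) (snd w)) \<longlonglongrightarrow> (case w of (u, \<omega>) \<Rightarrow> B u \<omega>)"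
    unfolding w by (auto intro: isCont_tendsto_compose)
qed

text \<open>Stands in for measurability with respect to the natural filtration at time \<open>s\<close>: moments of
  occupation functionals involve only finitely many times.\<close>

definition past :: "real \<Rightarrow> ('a \<Rightarrow> real) \<Rightarrow> bool" where
  "past s W \<longleftrightarrow> (\<exists>C. \<forall>\<omega>. \<bar>W \<omega>\<bar> \<le> C) \<and> (\<exists>n \<tau> f. \<tau> 0 = 0 \<and> (\<forall>i<n. \<tau> i \<le> \<tau> (Suc i)) \<and> \<tau> n = s \<and>
     f \<in> borel_measurable (PiM {..<n::nat} (\<lambda>_. borel :: real measure)) \<and>
     (\<forall>\<omega>. W \<omega> = f (\<lambda>i\<in>{..<n}. B (\<tau> (Suc i)) \<omega> - B (\<tau> i) \<omega>)))"

lemma past_one: "past 0 (\<lambda>_. 1)"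
  unfolding past_def by (intro conjI exI[of _ 1] exI[of _ "0::nat"] exI[of _ "\<lambda>_. 0"] exI[of _ "\<lambda>_. 1"]) auto

lemma telescope_increments:
  fixes \<tau> :: "nat \<Rightarrow> real"
  shows "\<tau> 0 = 0 \<Longrightarrow> (\<Sum>i<n. B (\<tau> (Suc i)) \<omega> - B (\<tau> i) \<omega>) = B (\<tau> n) \<omega>"
  using zero by (induction n) auto

text \<open>\<open>B u\<close> is the sum of all increments because paths start at 0; appending the
  time \<open>u\<close> therefore makes \<open>k (B u \<omega>)\<close> a function of increments as
  well.\<close>

lemma past_extend:
  assumes W: "past s W" and su: "s \<le> u" and [measurable]: "k \<in> borel_measurable borel" and k: "\<And>y. \<bar>k y\<bar> \<le> c"
  shows "past u (\<lambda>\<omega>. W \<omega> * k (B u \<omega>))"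
proof -
  obtain C n f and \<tau> :: "nat \<Rightarrow> real" where C: "\<And>\<omega>. \<bar>W \<omega>\<bar> \<le> C" and \<tau>: "\<tau> 0 = 0" "\<forall>i<n. \<tau> i \<le> \<tau> (Suc i)" "\<tau> n = s"
    and f [measurable]: "f \<in> borel_measurable (PiM {..<n::nat} (\<lambda>_. borel :: real measure))"
    and Wf: "\<And>\<omega>. W \<omega> = f (\<lambda>i\<in>{..<n}. B (\<tau> (Suc i)) \<omega> - B (\<tau> i) \<omega>)"
    using W unfolding past_def by blast
  define \<tau>' where "\<tau>' = \<tau>(Suc n := u)"
  define f' where "f' v = f (restrict v {..<n}) * k (\<Sum>i<Suc n. v i)" for v :: "nat \<Rightarrow> real"
  have bound: "\<bar>W \<omega> * k (B u \<omega>)\<bar> \<le> C * c" for \<omega>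
    unfolding abs_mult using C[of \<omega>] k by (intro mult_mono) (auto intro: order_trans[OF abs_ge_zero])
  have "\<forall>i<Suc n. \<tau>' i \<le> \<tau>' (Suc i)"
    using \<tau> su by (auto simp: \<tau>'_def less_Suc_eq)
  moreover have "f' \<in> borel_measurable (PiM {..<Suc n} (\<lambda>_. borel))"
  proof -
    have [measurable]: "(\<lambda>v. restrict v {..<n}) \<in> measurable (PiM {..<Suc n} (\<lambda>_. borel :: real measure)) (PiM {..<n} (\<lambda>_. borel))"
      by (rule measurable_restrict_subset) auto
    show ?thesis unfolding f'_def by measurable
  qed
  moreover have "W \<omega> * k (B u \<omega>) = f' (\<lambda>i\<in>{..<Suc n}. B (\<tau>' (Suc i)) \<omega> - B (\<tau>' i) \<omega>)" for \<omega>
  proof -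
    have "restrict (\<lambda>i\<in>{..<Suc n}. B (\<tau>' (Suc i)) \<omega> - B (\<tau>' i) \<omega>) {..<n} = (\<lambda>i\<in>{..<n}. B (\<tau> (Suc i)) \<omega> - B (\<tau> i) \<omega>)"
      by (auto simp: \<tau>'_def restrict_def fun_eq_iff)
    moreover have "(\<Sum>i<Suc n. (\<lambda>i\<in>{..<Suc n}. B (\<tau>' (Suc i)) \<omega> - B (\<tau>' i) \<omega>) i) = B (\<tau>' (Suc n)) \<omega>"
      using telescope_increments[of \<tau>' \<omega> "Suc n"] \<tau> by (simp add: \<tau>'_def)
    ultimately show ?thesis using Wf by (simp add: f'_def \<tau>'_def)
  qed
  ultimately show ?thesis unfolding past_def
    using bound \<tau> by (intro conjI exI[of _ "C * c"] exI[of _ "Suc n"] exI[of _ \<tau>'] exI[of _ f']) (auto simp: \<tau>'_def)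
qed

lemma past_measurable: "past s W \<Longrightarrow> W \<in> borel_measurable M"
proof -
  assume "past s W"
  then obtain n f and \<tau> :: "nat \<Rightarrow> real" where f [measurable]: "f \<in> borel_measurable (PiM {..<n::nat} (\<lambda>_. borel :: real measure))"
    and Wf: "\<And>\<omega>. W \<omega> = f (\<lambda>i\<in>{..<n}. B (\<tau> (Suc i)) \<omega> - B (\<tau> i) \<omega>)"
    unfolding past_def by blast
  have "(\<lambda>\<omega>. f (\<lambda>i\<in>{..<n}. B (\<tau> (Suc i)) \<omega> - B (\<tau> i) \<omega>)) \<in> borel_measurable M" by measurable
  then show ?thesis using Wf by (simp add: fun_eq_iff[symmetric] cong: measurable_cong)
qed

lemma past_nonneg:
  assumes "past s W" shows "0 \<le> s"
proof -
  obtain n \<tau> where \<tau>: "\<tau> 0 = (0::real)" "\<forall>i<n. \<tau> i \<le> \<tau> (Suc i)" "\<tau> (n::nat) = s"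
    using assms unfolding past_def by blast
  have "m \<le> n \<Longrightarrow> 0 \<le> \<tau> m" for m using \<tau>(1,2) by (induction m) (auto intro: order_trans)
  then show ?thesis using \<tau>(3) by blast
qed

text \<open>Both \<open>W\<close> and \<open>B s\<close> are functions of increments up to
  \<open>s\<close>. The dummy coordinate 0 gives the two variables the common type
  \<open>real \<times> real\<close> that \<open>indep_var\<close> asks for.\<close>

lemma past_independent:
  assumes W: "past s W" and su: "s < u"
  shows "indep_var (borel \<Otimes>\<^sub>M borel) (\<lambda>\<omega>. (W \<omega>, B s \<omega>))
    (borel \<Otimes>\<^sub>M borel) (\<lambda>\<omega>. (B u \<omega> - B s \<omega>, 0 :: real))"
proof -
  obtain n f and \<tau> :: "nat \<Rightarrow> real" where \<tau>: "\<tau> 0 = 0" "\<forall>i<n. \<tau> i \<le> \<tau> (Suc i)" "\<tau> n = s"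
    and f [measurable]: "f \<in> borel_measurable (PiM {..<n::nat} (\<lambda>_. borel :: real measure))"
    and Wf: "\<And>\<omega>. W \<omega> = f (\<lambda>i\<in>{..<n}. B (\<tau> (Suc i)) \<omega> - B (\<tau> i) \<omega>)"
    using W unfolding past_def by blast
  define \<tau>' where "\<tau>' = \<tau>(Suc n := u)"
  have "indep_vars (\<lambda>_. borel) (\<lambda>i \<omega>. B (\<tau>' (Suc i)) \<omega> - B (\<tau>' i) \<omega>) {..<Suc n}"
    using \<tau> su by (intro independent_increments) (auto simp: \<tau>'_def less_Suc_eq)
  then have "indep_var (PiM {..<n} (\<lambda>_. borel)) (\<lambda>\<omega>. restrict (\<lambda>i. B (\<tau>' (Suc i)) \<omega> - B (\<tau>' i) \<omega>) {..<n})
      (PiM {n} (\<lambda>_. borel)) (\<lambda>\<omega>. restrict (\<lambda>i. B (\<tau>' (Suc i)) \<omega> - B (\<tau>' i) \<omega>) {n})"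
    by (rule indep_var_restrict) auto
  then have "indep_var (borel \<Otimes>\<^sub>M borel) ((\<lambda>v. (f v, \<Sum>i<n. v i)) \<circ> (\<lambda>\<omega>. restrict (\<lambda>i. B (\<tau>' (Suc i)) \<omega> - B (\<tau>' i) \<omega>) {..<n}))
      (borel \<Otimes>\<^sub>M borel) ((\<lambda>v. (v n, 0 :: real)) \<circ> (\<lambda>\<omega>. restrict (\<lambda>i. B (\<tau>' (Suc i)) \<omega> - B (\<tau>' i) \<omega>) {n}))"
    by (rule indep_var_compose) measurable
  moreover have "(\<lambda>v. (f v, \<Sum>i<n. v i)) \<circ> (\<lambda>\<omega>. restrict (\<lambda>i. B (\<tau>' (Suc i)) \<omega> - B (\<tau>' i) \<omega>) {..<n}) = (\<lambda>\<omega>. (W \<omega>, B s \<omega>))"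
  proof
    fix \<omega>
    have "restrict (\<lambda>i. B (\<tau>' (Suc i)) \<omega> - B (\<tau>' i) \<omega>) {..<n} = (\<lambda>i\<in>{..<n}. B (\<tau> (Suc i)) \<omega> - B (\<tau> i) \<omega>)"
      by (auto simp: \<tau>'_def restrict_def fun_eq_iff)
    then show "((\<lambda>v. (f v, \<Sum>i<n. v i)) \<circ> (\<lambda>\<omega>. restrict (\<lambda>i. B (\<tau>' (Suc i)) \<omega> - B (\<tau>' i) \<omega>) {..<n})) \<omega> = (W \<omega>, B s \<omega>)"
      using telescope_increments[of \<tau> \<omega> n] \<tau> Wf by simp
  qed
  moreover have "(\<lambda>v. (v n, 0 :: real)) \<circ> (\<lambda>\<omega>. restrict (\<lambda>i. B (\<tau>' (Suc i)) \<omega> - B (\<tau>' i) \<omega>) {n}) = (\<lambda>\<omega>. (B u \<omega> - B s \<omega>, 0))"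
    using \<tau> by (auto simp: \<tau>'_def fun_eq_iff)
  ultimately show ?thesis by simp
qed

lemma past_markov:
  assumes W: "past s W" and su: "s < u" and [measurable]: "\<phi> \<in> borel_measurable borel" and \<phi>: "\<And>y. \<bar>\<phi> y\<bar> \<le> c"
  shows "expectation (\<lambda>\<omega>. W \<omega> * \<phi> (x + B u \<omega>)) =
    expectation (\<lambda>\<omega>. W \<omega> * (\<integral>z. heat (u - s) (z - (x + B s \<omega>)) * \<phi> z \<partial>lborel))"
proof -
  note [measurable] = past_measurable[OF W]
  obtain C where C: "\<And>\<omega>. \<bar>W \<omega>\<bar> \<le> C" using W unfolding past_def by blast
  define \<Delta> where "\<Delta> \<omega> = B u \<omega> - B s \<omega>" for \<omega>
  define \<Delta>' where "\<Delta>' \<omega> = (\<Delta> \<omega>, 0 :: real)" for \<omega>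
  define X where "X \<omega> = (W \<omega>, B s \<omega>)" for \<omega>
  have [measurable]: "\<Delta> \<in> borel_measurable M" "\<Delta>' \<in> measurable M (borel \<Otimes>\<^sub>M borel)" "X \<in> measurable M (borel \<Otimes>\<^sub>M borel)"
    unfolding \<Delta>'_def \<Delta>_def X_def by measurable
  have ind: "distr M (borel \<Otimes>\<^sub>M borel) X \<Otimes>\<^sub>M distr M (borel \<Otimes>\<^sub>M borel) \<Delta>' = distr M ((borel \<Otimes>\<^sub>M borel) \<Otimes>\<^sub>M (borel \<Otimes>\<^sub>M borel)) (\<lambda>\<omega>. (X \<omega>, \<Delta>' \<omega>))"
    using past_independent[OF W su] unfolding indep_var_distribution_eq X_def \<Delta>_def \<Delta>'_def by blast
  interpret PX: prob_space "distr M (borel \<Otimes>\<^sub>M borel) X" by (rule prob_space_distr) simp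
  interpret PD: prob_space "distr M (borel \<Otimes>\<^sub>M borel) \<Delta>'" by (rule prob_space_distr) simp
  interpret P: pair_prob_space "distr M (borel \<Otimes>\<^sub>M borel) X" "distr M (borel \<Otimes>\<^sub>M borel) \<Delta>'" ..
  \<comment> \<open>\<open>W\<close> obeys the bound \<open>C\<close> only on its range; truncation
    makes the integrand bounded at all arguments, hence integrable for the product of the
    laws.\<close>
  define w where "w v = max (- C) (min C v)" for v
  have w_eq: "w (W \<omega>) = W \<omega>" for \<omega> using C[of \<omega>] by (auto simp: w_def)
  have w_le: "\<bar>w v\<bar> \<le> C" for v using C[of undefined] by (auto simp: w_def)
  define H where "H p = (case p of ((v, y), (d, e :: real)) \<Rightarrow> w v * \<phi> (x + (y + d)))" for p
  have H_meas [measurable]: "H \<in> borel_measurable ((borel \<Otimes>\<^sub>M borel) \<Otimes>\<^sub>M (borel \<Otimes>\<^sub>M borel))" unfolding H_def w_def by measurable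
  have H_le: "\<bar>H p\<bar> \<le> C * c" for p
  proof -
    have "\<bar>w v\<bar> * \<bar>\<phi> y\<bar> \<le> C * c" for v y
      using w_le[of v] \<phi>[of y] by (intro mult_mono) (auto intro: order_trans[OF abs_ge_zero])
    then show ?thesis by (auto simp: H_def abs_mult split: prod.split)
  qed
  have "expectation (\<lambda>\<omega>. W \<omega> * \<phi> (x + B u \<omega>)) = expectation (\<lambda>\<omega>. H (X \<omega>, \<Delta>' \<omega>))"
    by (simp add: H_def X_def \<Delta>_def \<Delta>'_def w_eq)
  also have "\<dots> = integral\<^sup>L (distr M (borel \<Otimes>\<^sub>M borel) X \<Otimes>\<^sub>M distr M (borel \<Otimes>\<^sub>M borel) \<Delta>') H"
    unfolding ind by (subst integral_distr) auto
  also have "\<dots> = (\<integral>p. \<integral>d. H (p, d) \<partial>distr M (borel \<Otimes>\<^sub>M borel) \<Delta>' \<partial>distr M (borel \<Otimes>\<^sub>M borel) X)"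
    by (rule P.integral_fst'[symmetric], rule P.integrable_const_bound[where B = "C * c"]) (use H_le in auto)
  also have "\<dots> = expectation (\<lambda>\<omega>. \<integral>d. H (X \<omega>, d) \<partial>distr M (borel \<Otimes>\<^sub>M borel) \<Delta>')"
    by (subst integral_distr) auto
  also have "\<dots> = expectation (\<lambda>\<omega>. W \<omega> * (\<integral>z. heat (u - s) (z - (x + B s \<omega>)) * \<phi> z \<partial>lborel))"
  proof (rule Bochner_Integration.integral_cong[OF refl])
    fix \<omega>
    have HX: "(\<lambda>d. H (X \<omega>, d)) \<in> borel_measurable (borel \<Otimes>\<^sub>M borel)"
      by (rule measurable_compose[OF measurable_Pair1'[of "X \<omega>" "borel \<Otimes>\<^sub>M borel"] H_meas]) (simp add: space_pair_measure)
    have HX0: "(\<lambda>d. H (X \<omega>, (d, 0))) \<in> borel_measurable borel"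
      by (rule measurable_compose[OF _ HX]) measurable
    have dist: "distributed M lborel \<Delta> (normal_density 0 (sqrt (u - s)))"
      unfolding \<Delta>_def using normal_increments[of s u] past_nonneg[OF W] su by simp
    have "(\<integral>d. H (X \<omega>, d) \<partial>distr M (borel \<Otimes>\<^sub>M borel) \<Delta>') = expectation (\<lambda>\<omega>'. H (X \<omega>, \<Delta>' \<omega>'))"
      by (rule integral_distr[OF _ HX]) measurable
    also have "\<dots> = (\<integral>d. normal_density 0 (sqrt (u - s)) d * H (X \<omega>, (d, 0)) \<partial>lborel)"
      unfolding \<Delta>'_def by (rule distributed_integral[OF dist, symmetric]) (use HX0 in auto)
    also have "\<dots> = (\<integral>d. W \<omega> * (heat (u - s) d * \<phi> (x + B s \<omega> + d)) \<partial>lborel)"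
      using su by (intro Bochner_Integration.integral_cong) (auto simp: H_def X_def w_eq heat_normal_density add_ac)
    also have "\<dots> = W \<omega> * (\<integral>d. heat (u - s) d * \<phi> (x + B s \<omega> + d) \<partial>lborel)" by simp
    also have "(\<integral>d. heat (u - s) d * \<phi> (x + B s \<omega> + d) \<partial>lborel) = (\<integral>z. heat (u - s) (z - (x + B s \<omega>)) * \<phi> z \<partial>lborel)"
      by (subst lborel_integral_real_affine[where c = 1 and t = "x + B s \<omega>" and f = "\<lambda>z. heat (u - s) (z - (x + B s \<omega>)) * \<phi> z"]) auto
    finally show "(\<integral>d. H (X \<omega>, d) \<partial>distr M (borel \<Otimes>\<^sub>M borel) \<Delta>') = W \<omega> * (\<integral>z. heat (u - s) (z - (x + B s \<omega>)) * \<phi> z \<partial>lborel)" .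
  qed
  finally show ?thesis .
qed

lemma strip_integrable:
  assumes "F \<in> borel_measurable (lborel \<Otimes>\<^sub>M M)"
    and "\<And>u \<omega>. u \<in> {s..T} \<Longrightarrow> \<bar>F (u, \<omega>)\<bar> \<le> C" and "\<And>u \<omega>. u \<notin> {s..T} \<Longrightarrow> F (u, \<omega>) = 0"
  shows "integrable (lborel \<Otimes>\<^sub>M M) (F :: real \<times> 'a \<Rightarrow> real)"
proof (rule integrableI_bounded_set[where A = "{s..T} \<times> space M" and B = C])
  show "emeasure (lborel \<Otimes>\<^sub>M M) ({s..T} \<times> space M) < \<infinity>"
    by (subst emeasure_pair_measure_Times) (auto simp: emeasure_lborel_Icc_eq emeasure_space_1)
  show "AE x in lborel \<Otimes>\<^sub>M M. x \<in> {s..T} \<times> space M \<longrightarrow> norm (F x) \<le> C"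
    using assms(2) by (intro AE_I2) auto
  show "AE x in lborel \<Otimes>\<^sub>M M. x \<notin> {s..T} \<times> space M \<longrightarrow> F x = 0"
  proof (intro AE_I2 impI)
    fix x assume "x \<in> space (lborel \<Otimes>\<^sub>M M)" "x \<notin> {s..T} \<times> space M"
    then show "F x = 0" using assms(3)[of "fst x" "snd x"] by (cases x) (auto simp: space_pair_measure)
  qed
qed (use assms in auto)

definition occ_integral :: "(real \<Rightarrow> real) \<Rightarrow> real \<Rightarrow> real \<Rightarrow> real \<Rightarrow> 'a \<Rightarrow> real" where
  "occ_integral g T x s \<omega> = (\<integral>u. indicator {s..T} u * g (x + B u \<omega>) \<partial>lborel)"

lemma occ_integral_measurable [measurable]:
  assumes [measurable]: "g \<in> borel_measurable borel"
  shows "(\<lambda>(s, \<omega>). occ_integral g T x s \<omega>) \<in> borel_measurable (borel \<Otimes>\<^sub>M M)"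
proof -
  have "occ_integral g T x = (\<lambda>s \<omega>. \<integral>u. (if s \<le> u \<and> u \<le> T then g (x + B u \<omega>) else 0) \<partial>lborel)"
    unfolding occ_integral_def by (intro ext Bochner_Integration.integral_cong) (auto simp: indicator_def)
  then show ?thesis by simp
qed

lemma path_measurable [measurable]: "(\<lambda>u. B u \<omega>) \<in> borel_measurable borel"
  using paths by (rule borel_measurable_continuous_onI)

lemma abs_occ_integral_le:
  assumes [measurable]: "g \<in> borel_measurable borel" and "\<And>z. \<bar>g z\<bar> \<le> 1" "s \<le> T"
  shows "\<bar>occ_integral g T x s \<omega>\<bar> \<le> T - s"
proof -
  have "\<bar>occ_integral g T x s \<omega>\<bar> \<le> 1 * (T - s)"
    unfolding occ_integral_def by (rule abs_integral_indicator_Icc_le) (use assms in auto)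
  then show ?thesis by simp
qed

text \<open>The power is expanded as an integral over its earliest time \<open>u\<close>. The factor
  \<open>g (x + B u \<omega>)\<close> then joins \<open>W\<close>, which is why the induction
  generalises over both \<open>s\<close> and \<open>W\<close>; the hypothesis is applied at time
  \<open>u\<close>, and the Markov property leads from \<open>u\<close> back to
  \<open>s\<close>.\<close>

lemma expectation_occ_integral_power:
  assumes g: "bounded_test g" and T: "0 \<le> T" and W: "past s W"
  shows "expectation (\<lambda>\<omega>. W \<omega> * (occ_integral g T x s \<omega> ^ p / fact p)) =
    expectation (\<lambda>\<omega>. W \<omega> * heat_moment g T p s (x + B s \<omega>))"
  using W
proof (induction p arbitrary: s W)
  case 0
  then show ?case by simp
next
  case (Suc p)
  interpret bounded_test g by (rule g)
  interpret PS: pair_sigma_finite lborel M ..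
  note [measurable] = past_measurable[OF Suc.prems]
  obtain C where C: "\<And>\<omega>. \<bar>W \<omega>\<bar> \<le> C" using Suc.prems unfolding past_def by blast
  have C0: "0 \<le> C" using C order_trans[OF abs_ge_zero] by blast
  have s: "0 \<le> s" by (rule past_nonneg[OF Suc.prems])
  define K where "K = T ^ p / fact p"
  have K0: "0 \<le> K" using T by (simp add: K_def)
  define F where "F u \<omega> = W \<omega> * g (x + B u \<omega>) * (occ_integral g T x u \<omega> ^ p / fact p)" for u \<omega>
  define \<Phi> where "\<Phi> u \<omega> = (\<integral>z. (if u \<le> T then heat (u - s) (z - (x + B s \<omega>)) * g z * heat_moment g T p u z else 0) \<partial>lborel)" for u \<omega>
  have F_meas [measurable]: "(\<lambda>(u, \<omega>). F u \<omega>) \<in> borel_measurable (borel \<Otimes>\<^sub>M M)"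
    unfolding F_def by measurable
  have \<Phi>_meas [measurable]: "(\<lambda>(u, \<omega>). \<Phi> u \<omega>) \<in> borel_measurable (borel \<Otimes>\<^sub>M M)"
    unfolding \<Phi>_def by measurable
  have F_le: "\<bar>F u \<omega>\<bar> \<le> C * 1 * K" if "u \<in> {s..T}" for u \<omega>
  proof -
    have "\<bar>occ_integral g T x u \<omega>\<bar> \<le> T - u" using that by (intro abs_occ_integral_le g_le) auto
    then have "\<bar>occ_integral g T x u \<omega>\<bar> ^ p \<le> T ^ p" using that s by (intro power_mono) auto
    then have "\<bar>occ_integral g T x u \<omega> ^ p / fact p\<bar> \<le> K"
      by (simp add: K_def power_abs divide_right_mono)
    then show ?thesis unfolding F_def abs_mult using C g_le C0 by (intro mult_mono) auto
  qed
  have \<Phi>_le: "\<bar>\<Phi> u \<omega>\<bar> \<le> K" and \<Phi>_out: "u \<notin> {s..T} \<Longrightarrow> \<Phi> u \<omega> = 0" for u \<omega>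
  proof -
    show out: "\<Phi> u \<omega> = 0" if "u \<notin> {s..T}" for u
    proof -
      have "(if u \<le> T then heat (u - s) (z - (x + B s \<omega>)) * g z * heat_moment g T p u z else 0) = 0" for z
        using that by (auto simp: heat_def)
      then show ?thesis by (simp add: \<Phi>_def)
    qed
    show "\<bar>\<Phi> u \<omega>\<bar> \<le> K"
    proof (cases "s < u \<and> u \<le> T")
      case True
      have "(\<integral>\<^sup>+z. ennreal \<bar>if u \<le> T then heat (u - s) (z - (x + B s \<omega>)) * g z * heat_moment g T p u z else 0\<bar> \<partial>lborel)
        \<le> (\<integral>\<^sup>+z. ennreal K * ennreal (heat (u - s) (z - (x + B s \<omega>))) \<partial>lborel)"
      proof (rule nn_integral_mono)
        fix z
        have "\<bar>g z\<bar> * \<bar>heat_moment g T p u z\<bar> \<le> 1 * K"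
          using g_le[of z] heat_moment_bound_horizon[of u T p z] True s T unfolding K_def by (intro mult_mono) auto
        then have "heat (u - s) (z - (x + B s \<omega>)) * (\<bar>g z\<bar> * \<bar>heat_moment g T p u z\<bar>) \<le> heat (u - s) (z - (x + B s \<omega>)) * K"
          by (intro mult_left_mono) auto
        then show "ennreal \<bar>if u \<le> T then heat (u - s) (z - (x + B s \<omega>)) * g z * heat_moment g T p u z else 0\<bar>
            \<le> ennreal K * ennreal (heat (u - s) (z - (x + B s \<omega>)))"
          using True K0 by (auto simp: abs_mult ennreal_mult[symmetric] mult_ac intro!: ennreal_leI)
      qed
      also have "\<dots> = ennreal K"
        using True by (subst nn_integral_cmult) (auto simp: nn_integral_heat_space)
      finally show ?thesis
        unfolding \<Phi>_def using K0 by (intro integrable_abs_integral_le(2)) auto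
    next
      case False
      then have "heat (u - s) y = 0 \<or> \<not> u \<le> T" for y by (auto simp: heat_def)
      then have "(if u \<le> T then heat (u - s) (z - (x + B s \<omega>)) * g z * heat_moment g T p u z else 0) = 0" for z
        by auto
      then show ?thesis using K0 by (simp add: \<Phi>_def)
    qed
  qed
  have "expectation (\<lambda>\<omega>. W \<omega> * (occ_integral g T x s \<omega> ^ Suc p / fact (Suc p))) =
     expectation (\<lambda>\<omega>. \<integral>u. indicator {s..T} u * F u \<omega> \<partial>lborel)"
  proof (rule Bochner_Integration.integral_cong[OF refl])
    fix \<omega>
    have "(\<integral>u. indicator {s..T} u * F u \<omega> \<partial>lborel) =
        (\<integral>u. W \<omega> / fact p * (indicator {s..T} u * (g (x + B u \<omega>) * occ_integral g T x u \<omega> ^ p)) \<partial>lborel)"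
      by (simp add: F_def mult_ac)
    also have "\<dots> = W \<omega> / fact p * (\<integral>u. indicator {s..T} u * (g (x + B u \<omega>) * occ_integral g T x u \<omega> ^ p) \<partial>lborel)"
      by simp
    also have "(\<integral>u. indicator {s..T} u * (g (x + B u \<omega>) * occ_integral g T x u \<omega> ^ p) \<partial>lborel) = occ_integral g T x s \<omega> ^ Suc p / real (Suc p)"
      unfolding occ_integral_def by (rule iterated_power_integral) (auto intro: g_le)
    finally show "W \<omega> * (occ_integral g T x s \<omega> ^ Suc p / fact (Suc p)) = (\<integral>u. indicator {s..T} u * F u \<omega> \<partial>lborel)"
      by (simp add: mult_ac)
  qed
  also have "\<dots> = (\<integral>u. expectation (\<lambda>\<omega>. indicator {s..T} u * F u \<omega>) \<partial>lborel)"
    by (rule PS.Fubini_integral, rule strip_integrable[where C = "C * 1 * K"]) (use F_le in \<open>auto simp: indicator_def\<close>)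
  also have "\<dots> = (\<integral>u. expectation (\<lambda>\<omega>. W \<omega> * \<Phi> u \<omega>) \<partial>lborel)"
  proof (rule integral_cong_AE)
    \<comment> \<open>At \<open>u = s\<close> the kernel is 0 by convention, hence the exceptional
      point.\<close>
    show "AE u in lborel. expectation (\<lambda>\<omega>. indicator {s..T} u * F u \<omega>) = expectation (\<lambda>\<omega>. W \<omega> * \<Phi> u \<omega>)"
      using AE_lborel_singleton[of s]
    proof eventually_elim
      case (elim u)
      show ?case
      proof (cases "u \<in> {s..T}")
        case True
        then have su: "s < u" "u \<le> T" using elim by auto
        have ext: "past u (\<lambda>\<omega>. W \<omega> * g (x + B u \<omega>))"
          using su by (intro past_extend[OF Suc.prems, where k = "\<lambda>y. g (x + y)" and c = 1]) (auto intro: g_le)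
        have "expectation (\<lambda>\<omega>. indicator {s..T} u * F u \<omega>) = expectation (\<lambda>\<omega>. (W \<omega> * g (x + B u \<omega>)) * (occ_integral g T x u \<omega> ^ p / fact p))"
          using True by (simp add: F_def)
        also have "\<dots> = expectation (\<lambda>\<omega>. (W \<omega> * g (x + B u \<omega>)) * heat_moment g T p u (x + B u \<omega>))"
          by (rule Suc.IH[OF ext])
        also have "\<dots> = expectation (\<lambda>\<omega>. W \<omega> * (g (x + B u \<omega>) * heat_moment g T p u (x + B u \<omega>)))"
          by (simp add: mult.assoc)
        also have "\<dots> = expectation (\<lambda>\<omega>. W \<omega> * (\<integral>z. heat (u - s) (z - (x + B s \<omega>)) * (g z * heat_moment g T p u z) \<partial>lborel))"
        proof (rule past_markov[OF Suc.prems su(1)])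
          fix y
          have "\<bar>g y\<bar> * \<bar>heat_moment g T p u y\<bar> \<le> 1 * K"
            using g_le[of y] heat_moment_bound_horizon[of u T p y] su s T unfolding K_def by (intro mult_mono) auto
          then show "\<bar>g y * heat_moment g T p u y\<bar> \<le> K" by (simp add: abs_mult)
        qed measurable
        also have "\<dots> = expectation (\<lambda>\<omega>. W \<omega> * \<Phi> u \<omega>)"
          using su by (simp add: \<Phi>_def mult.assoc)
        finally show ?thesis .
      next
        case False
        then show ?thesis by (simp add: \<Phi>_out)
      qed
    qed
  qed measurable
  also have "\<dots> = expectation (\<lambda>\<omega>. \<integral>u. W \<omega> * \<Phi> u \<omega> \<partial>lborel)"
  proof (rule PS.Fubini_integral[symmetric], rule strip_integrable[where C = "C * K" and s = s and T = T])
    show "\<bar>case (u, \<omega>) of (u, \<omega>) \<Rightarrow> W \<omega> * \<Phi> u \<omega>\<bar> \<le> C * K" for u \<omega>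
      using C \<Phi>_le C0 by (auto simp: abs_mult intro!: mult_mono)
  qed (auto simp: \<Phi>_out)
  also have "\<dots> = expectation (\<lambda>\<omega>. W \<omega> * heat_moment g T (Suc p) s (x + B s \<omega>))"
  proof (rule Bochner_Integration.integral_cong[OF refl])
    fix \<omega>
    have "heat_moment g T (Suc p) s (x + B s \<omega>) = (\<integral>u. \<Phi> u \<omega> \<partial>lborel)"
      using lborel_pair.integral_fst'[of "\<lambda>(u, z). if u \<le> T then heat (u - s) (z - (x + B s \<omega>)) * g z * heat_moment g T p u z else 0"]
        heat_moment_bound(1)[of T s "x + B s \<omega>" p]
      by (simp add: \<Phi>_def lborel_prod)
    then show "(\<integral>u. W \<omega> * \<Phi> u \<omega> \<partial>lborel) = W \<omega> * heat_moment g T (Suc p) s (x + B s \<omega>)"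
      by (simp del: heat_moment.simps)
  qed
  finally show ?case .
qed

corollary moment_formula:
  assumes "bounded_test g" "0 \<le> T"
  shows "expectation (\<lambda>\<omega>. occ_integral g T x 0 \<omega> ^ p) = fact p * heat_moment g T p 0 x"
proof -
  have "expectation (\<lambda>\<omega>. occ_integral g T x 0 \<omega> ^ p / fact p) = heat_moment g T p 0 x"
    using expectation_occ_integral_power[OF assms past_one, of x p] by (simp add: zero prob_space)
  then show ?thesis by (simp add: field_simps)
qed

end

section \<open>Tail bounds for differences of neighbouring densities\<close>

lemma (in prob_space) prob_le_expectation_div:
  assumes "integrable M X" "\<And>\<omega>. 0 \<le> X \<omega>" "S \<in> events" "0 < c" "\<And>\<omega>. \<omega> \<in> S \<Longrightarrow> c \<le> X \<omega>"
  shows "prob S \<le> expectation X / c"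
proof -
  have "c * prob S = expectation (\<lambda>\<omega>. c * indicator S \<omega>)"
    using assms by simp
  also have "\<dots> \<le> expectation X"
  proof (rule integral_mono)
    show "integrable M (\<lambda>\<omega>. c * indicator S \<omega>)"
      using assms(3) by (intro integrable_mult_right integrable_real_indicator) (auto simp: emeasure_eq_measure)
    show "c * indicator S \<omega> \<le> X \<omega>" for \<omega>
      using assms(2,5)[of \<omega>] by (cases "\<omega> \<in> S") auto
  qed (rule assms)
  finally show ?thesis using assms by (simp add: field_simps)
qed

context continuous_brownian_motion
begin

lemma continuous_path: "continuous_path (\<lambda>t. B t \<omega>)"
  by unfold_locales (rule paths)

lemma occ_eq_occ_integral: "occ (\<lambda>t. B t \<omega>) t A = occ_integral (indicator A) t 0 0 \<omega>"
proof -
  have "(\<lambda>u. indicator {0..t} u * indicator A (0 + B u \<omega>)) = (indicator {u \<in> {0..t}. B u \<omega> \<in> A} :: real \<Rightarrow> real)"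
    by (auto simp: indicator_def fun_eq_iff)
  then show ?thesis by (simp add: occ_def occ_integral_def)
qed

lemma occ_measurable [measurable]:
  assumes [measurable]: "A \<in> sets borel"
  shows "(\<lambda>\<omega>. occ (\<lambda>t. B t \<omega>) t A) \<in> borel_measurable M"
  unfolding occ_eq_occ_integral by measurable

lemma dens_measurable [measurable]: "(\<lambda>\<omega>. dens (\<lambda>t. B t \<omega>) n k t) \<in> borel_measurable M"
  unfolding dens_def by measurable

definition dyadic_test :: "nat \<Rightarrow> int \<Rightarrow> real \<Rightarrow> real" where
  "dyadic_test n k z = indicator {(real_of_int k + 1) / 2 ^ n ..< (real_of_int k + 2) / 2 ^ n} z
     - indicator {real_of_int k / 2 ^ n ..< (real_of_int k + 1) / 2 ^ n} z"

lemma dyadic_test_centred: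
  assumes "0 \<le> t"
  shows "centred_test (dyadic_test n k) (real_of_int k / 2 ^ n) (1 / 2 ^ n) t"
proof
  show "dyadic_test n k \<in> borel_measurable borel" unfolding dyadic_test_def by measurable
  show "\<bar>dyadic_test n k z\<bar> \<le> 1" for z by (auto simp: dyadic_test_def indicator_def)
  show "0 < (1 / 2 ^ n :: real)" by simp
  show "0 \<le> t" by fact
  show "dyadic_test n k z = 0" if "z \<notin> {real_of_int k / 2 ^ n..real_of_int k / 2 ^ n + 2 * (1 / 2 ^ n)}" for z
    using that by (auto simp: dyadic_test_def indicator_def add_divide_distrib)
  have "integral\<^sup>L lborel (dyadic_test n k) =
     (\<integral>z. indicator {(real_of_int k + 1) / 2 ^ n ..< (real_of_int k + 2) / 2 ^ n} z \<partial>lborel)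
     - (\<integral>z. indicator {real_of_int k / 2 ^ n ..< (real_of_int k + 1) / 2 ^ n} z \<partial>lborel)"
    unfolding dyadic_test_def
    by (rule Bochner_Integration.integral_diff) (auto simp: divide_right_mono intro!: integrable_real_indicator)
  also have "\<dots> = 0"
    by (simp add: divide_right_mono add_divide_distrib)
  finally show "integral\<^sup>L lborel (dyadic_test n k) = 0" .
qed

lemma dens_diff_eq:
  "dens (\<lambda>t. B t \<omega>) n (k + 1) t - dens (\<lambda>t. B t \<omega>) n k t = 2 ^ n * occ_integral (dyadic_test n k) t 0 0 \<omega>"
proof -
  let ?I = "\<lambda>A. \<integral>u. indicator {0..t} u * indicator A (0 + B u \<omega>) \<partial>lborel :: real"
  let ?A = "{(real_of_int k + 1) / 2 ^ n ..< (real_of_int k + 2) / 2 ^ n}"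
  let ?A' = "{real_of_int k / 2 ^ n ..< (real_of_int k + 1) / 2 ^ n}"
  have "occ_integral (dyadic_test n k) t 0 0 \<omega> = ?I ?A - ?I ?A'"
    unfolding occ_integral_def dyadic_test_def right_diff_distrib
    by (rule Bochner_Integration.integral_diff; rule integrable_indicator_Icc[where C = 1]) (auto simp: indicator_def)
  then show ?thesis
    unfolding dens_def occ_eq_occ_integral by (simp add: occ_integral_def add.commute right_diff_distrib)
qed

text \<open>Eighth moments suffice because the number of dyadic space-time points to be controlled at level
  \<open>n\<close> is of order \<open>8 ^ n\<close>.\<close>

lemma dens_diff_tail:
  assumes t: "0 \<le> t" and r: "0 < r"
  shows "prob {\<omega> \<in> space M. r < \<bar>dens (\<lambda>t. B t \<omega>) n (k + 1) t - dens (\<lambda>t. B t \<omega>) n k t\<bar>}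
     \<le> fact 8 * 48 ^ 4 * t\<^sup>2 / (16 ^ n * r ^ 8)"
proof -
  interpret centred_test "dyadic_test n k" "real_of_int k / 2 ^ n" "1 / 2 ^ n" t
    by (rule dyadic_test_centred[OF t])
  have bt: "bounded_test (dyadic_test n k)" by unfold_locales
  let ?X = "occ_integral (dyadic_test n k) t 0 0"
  have X_le: "\<bar>?X \<omega>\<bar> \<le> t" for \<omega>
    using abs_occ_integral_le[OF g_measurable g_le, of 0 t 0 \<omega>] t by simp
  have mom: "expectation (\<lambda>\<omega>. ?X \<omega> ^ 8) \<le> fact 8 * (48 * (1 / 2 ^ n) ^ 3 * sqrt t) ^ 4"
  proof -
    have "heat_moment (dyadic_test n k) t (2 * 4) 0 0 \<le> (48 * (1 / 2 ^ n) ^ 3 * sqrt t) ^ 4"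
      using heat_moment_even_bounds[of 4] by (meson abs_le_D1 order_refl)
    then show ?thesis
      using moment_formula[OF bt t, of 0 8] by (simp del: fact_numeral)
  qed
  have "prob {\<omega> \<in> space M. r < \<bar>2 ^ n * ?X \<omega>\<bar>} \<le> expectation (\<lambda>\<omega>. ?X \<omega> ^ 8) / (r / 2 ^ n) ^ 8"
  proof (rule prob_le_expectation_div)
    show "integrable M (\<lambda>\<omega>. ?X \<omega> ^ 8)"
    proof (rule integrable_const_bound[where B = "t ^ 8"])
      show "AE \<omega> in M. norm (?X \<omega> ^ 8) \<le> t ^ 8"
      proof (rule AE_I2)
        fix \<omega>
        have "\<bar>?X \<omega>\<bar> ^ 8 \<le> t ^ 8" using X_le by (intro power_mono) auto
        then show "norm (?X \<omega> ^ 8) \<le> t ^ 8" by simp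
      qed
    qed measurable
    show "(r / 2 ^ n) ^ 8 \<le> ?X \<omega> ^ 8" if "\<omega> \<in> {\<omega> \<in> space M. r < \<bar>2 ^ n * ?X \<omega>\<bar>}" for \<omega>
    proof -
      have "r / 2 ^ n \<le> \<bar>?X \<omega>\<bar>" using that by (simp add: abs_mult field_simps)
      then have "(r / 2 ^ n) ^ 8 \<le> \<bar>?X \<omega>\<bar> ^ 8" using r by (intro power_mono) auto
      then show ?thesis by (simp add: power_even_abs)
    qed
  qed (use r in auto)
  also have "\<dots> \<le> fact 8 * (48 * (1 / 2 ^ n) ^ 3 * sqrt t) ^ 4 / (r / 2 ^ n) ^ 8"
    using mom r by (intro divide_right_mono) auto
  also have "\<dots> = fact 8 * 48 ^ 4 * t\<^sup>2 / (16 ^ n * r ^ 8)"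
  proof -
    have s: "sqrt t ^ 4 = t\<^sup>2" using t power_mult[of "sqrt t" 2 2] by simp
    \<comment> \<open>Four pairs give \<open>h ^ 12\<close> with \<open>h = 2 ^ -n\<close>, and the
      normalisation of the densities costs \<open>2 ^ (8 * n)\<close>; what remains is
      \<open>16 ^ -n\<close>.\<close>
    have "(2 ^ n :: real) ^ 12 = (2 ^ n) ^ 8 * 16 ^ n"
      by (simp add: power_mult[symmetric] power_add[symmetric] flip: power_mult_distrib) (simp add: mult.commute[of n] power_mult flip: power_mult_distrib)
    then show ?thesis
      by (simp only: power_mult_distrib s power_divide power_mult[symmetric] power_one) (simp add: field_simps)
  qed
  finally show ?thesis unfolding dens_diff_eq .
qed

end

section \<open>Regularity and growth of the occupation densities\<close>

context continuous_brownian_motion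
begin

abbreviation "osc n k t \<omega> \<equiv> \<bar>dens (\<lambda>t. B t \<omega>) n (k + 1) t - dens (\<lambda>t. B t \<omega>) n k t\<bar>"

lemma card_dyadic_le:
  assumes "1 \<le> N"
  shows "real (card {k :: int. \<bar>k\<bar> \<le> int N * 2 ^ n}) \<le> 3 * real N * 2 ^ n"
proof -
  have "{k :: int. \<bar>k\<bar> \<le> int N * 2 ^ n} = {- (int N * 2 ^ n)..int N * 2 ^ n}" by auto
  then have "card {k :: int. \<bar>k\<bar> \<le> int N * 2 ^ n} = nat (2 * (int N * 2 ^ n) + 1)" by simp
  then have "real (card {k :: int. \<bar>k\<bar> \<le> int N * 2 ^ n}) = 2 * (real N * 2 ^ n) + 1"
    by (simp add: of_nat_nat)
  moreover have "1 * 1 \<le> real N * 2 ^ n"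
    using assms by (intro mult_mono) auto
  ultimately show ?thesis by simp
qed

lemma finite_dyadic: "finite {k :: int. \<bar>k\<bar> \<le> m}"
proof -
  have "{k :: int. \<bar>k\<bar> \<le> m} = {-m..m}" by auto
  then show ?thesis by simp
qed

text \<open>A union bound over at most \<open>6 * N\<^sup>2 * 8 ^ n\<close> grid points against a
  tail of order \<open>1 / (16 ^ n * \<theta> ^ (8 * n))\<close> is a geometric series of ratio
  \<open>1 / (2 * \<theta> ^ 8)\<close>. The value 19/20 is close enough to 1 to make this ratio
  less than 1.\<close>

lemma AE_regular:
  assumes N: "1 \<le> N"
  shows "AE \<omega> in M. \<exists>n\<^sub>0. \<forall>n\<ge>n\<^sub>0. \<forall>k. \<bar>k\<bar> \<le> int N * 2 ^ n \<longrightarrow> (\<forall>j \<le> N * 4 ^ n.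
      osc n k (real j / 4 ^ n) \<omega> \<le> (19 / 20) ^ n)"
proof -
  define K :: real where "K = fact 8 * 48 ^ 4"
  have K0: "0 \<le> K" by (simp add: K_def)
  define E where "E n = (\<Union>(k, j) \<in> {k. \<bar>k\<bar> \<le> int N * 2 ^ n} \<times> {..N * 4 ^ n}.
     {\<omega> \<in> space M. (19 / 20) ^ n < osc n k (real j / 4 ^ n) \<omega>})" for n
  have E_sets [measurable]: "E n \<in> events" for n
    unfolding E_def by (intro sets.finite_UN finite_cartesian_product finite_dyadic) auto
  have E_le: "prob (E n) \<le> 6 * real N ^ 4 * K * (1 / (2 * (19 / 20) ^ 8)) ^ n" for n
  proof -
    have each: "prob {\<omega> \<in> space M. (19 / 20) ^ n < osc n k (real j / 4 ^ n) \<omega>} \<le> K * (real N)\<^sup>2 / (16 ^ n * ((19 / 20) ^ n) ^ 8)"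
      if "j \<le> N * 4 ^ n" for k j
    proof -
      have "real j \<le> real (N * 4 ^ n)" using that by (simp only: of_nat_le_iff)
      then have "real j / 4 ^ n \<le> real N" by (simp add: divide_le_eq)
      then have "K * (real j / 4 ^ n)\<^sup>2 / (16 ^ n * ((19 / 20) ^ n) ^ 8) \<le> K * (real N)\<^sup>2 / (16 ^ n * ((19 / 20) ^ n) ^ 8)"
        using K0 by (intro divide_right_mono mult_left_mono power_mono) auto
      moreover have "prob {\<omega> \<in> space M. (19 / 20) ^ n < osc n k (real j / 4 ^ n) \<omega>} \<le> K * (real j / 4 ^ n)\<^sup>2 / (16 ^ n * ((19 / 20) ^ n) ^ 8)"
        unfolding K_def by (rule dens_diff_tail) auto
      ultimately show ?thesis by linarith
    qed
    have "prob (E n) \<le> (\<Sum>(k, j) \<in> {k. \<bar>k\<bar> \<le> int N * 2 ^ n} \<times> {..N * 4 ^ n}.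
       prob {\<omega> \<in> space M. (19 / 20) ^ n < osc n k (real j / 4 ^ n) \<omega>})"
    proof -
      have "prob (E n) \<le> (\<Sum>p \<in> {k. \<bar>k\<bar> \<le> int N * 2 ^ n} \<times> {..N * 4 ^ n}.
        prob (case p of (k, j) \<Rightarrow> {\<omega> \<in> space M. (19 / 20) ^ n < osc n k (real j / 4 ^ n) \<omega>}))"
        unfolding E_def by (rule finite_measure_subadditive_finite)
          (auto intro!: finite_cartesian_product finite_dyadic)
      then show ?thesis by (simp add: case_prod_beta')
    qed
    also have "\<dots> \<le> (\<Sum>(k, j) \<in> {k. \<bar>k\<bar> \<le> int N * 2 ^ n} \<times> {..N * 4 ^ n}. K * (real N)\<^sup>2 / (16 ^ n * ((19 / 20) ^ n) ^ 8))"
      by (rule sum_mono) (use each in auto)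
    also have "\<dots> = real (card {k. \<bar>k\<bar> \<le> int N * 2 ^ n}) * (real N * 4 ^ n + 1) * (K * (real N)\<^sup>2 / (16 ^ n * ((19 / 20) ^ n) ^ 8))"
      by (simp add: card_cartesian_product algebra_simps)
    also have "\<dots> \<le> (3 * real N * 2 ^ n) * (2 * real N * 4 ^ n) * (K * (real N)\<^sup>2 / (16 ^ n * ((19 / 20) ^ n) ^ 8))"
    proof (intro mult_right_mono mult_mono card_dyadic_le N)
      have "1 * 1 \<le> real N * 4 ^ n" using N by (intro mult_mono) auto
      then show "real N * 4 ^ n + 1 \<le> 2 * real N * 4 ^ n" by simp
    qed (use K0 in auto)
    also have "\<dots> = 6 * real N ^ 4 * K * (1 / (2 * (19 / 20) ^ 8)) ^ n"
    proof -
      have a: "(2 ^ n * 4 ^ n) * (2 :: real) ^ n = 16 ^ n" by (simp flip: power_mult_distrib)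
      have b: "(1 / (2 * c ^ 8)) ^ n = (2 ^ n * 4 ^ n) / (16 ^ n * (c ^ n) ^ 8)" for c :: real
      proof -
        have "(c ^ n) ^ 8 = (c ^ 8) ^ n" by (simp add: mult.commute flip: power_mult)
        then show ?thesis unfolding a[symmetric] by (simp add: power_divide power_mult_distrib)
      qed
      show ?thesis unfolding b by (simp add: power2_eq_square power4_eq_xxxx)
    qed
    finally show ?thesis .
  qed
  have "summable (\<lambda>n. prob (E n))"
  proof (rule summable_comparison_test')
    show "summable (\<lambda>n. 6 * real N ^ 4 * K * (1 / (2 * (19 / 20) ^ 8)) ^ n)"
      by (intro summable_mult summable_geometric) (simp add: power_divide)
    show "norm (prob (E n)) \<le> 6 * real N ^ 4 * K * (1 / (2 * (19 / 20) ^ 8)) ^ n" for n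
      using E_le[of n] by simp
  qed
  then have "AE \<omega> in M. eventually (\<lambda>n. \<omega> \<in> space M - E n) sequentially"
    by (intro borel_cantelli_AE1) (auto simp: emeasure_eq_measure)
  then show ?thesis
  proof eventually_elim
    case (elim \<omega>)
    then obtain n\<^sub>0 where n0: "\<And>n. n \<ge> n\<^sub>0 \<Longrightarrow> \<omega> \<in> space M - E n" by (auto simp: eventually_sequentially)
    have "osc n k (real j / 4 ^ n) \<omega> \<le> (19 / 20) ^ n" if "n \<ge> n\<^sub>0" "\<bar>k\<bar> \<le> int N * 2 ^ n" "j \<le> N * 4 ^ n" for n k j
    proof (rule ccontr)
      assume "\<not> osc n k (real j / 4 ^ n) \<omega> \<le> (19 / 20) ^ n"
      then have "(19 / 20) ^ n < osc n k (real j / 4 ^ n) \<omega>" by (simp only: not_le)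
      moreover have "\<omega> \<in> space M" using n0[OF that(1)] by simp
      ultimately have "\<omega> \<in> E n" using that unfolding E_def by blast
      with n0[OF that(1)] show False by simp
    qed
    then show ?case by blast
  qed
qed

section \<open>Laplace transform of the time spent near the origin\<close>

text \<open>The exponential series is integrated term by term: the functional is bounded by
  \<open>r\<close>, so the terms are dominated by those of \<open>exp (\<bar>l\<bar> * r)\<close>,
  and the factorials cancel against the moment formula.\<close>

lemma expectation_exp_occ_integral:
  assumes g: "bounded_test g" and r: "0 \<le> r"
  shows "(\<lambda>p. (- l) ^ p * heat_moment g r p 0 x) sums expectation (\<lambda>\<omega>. exp (- l * occ_integral g r x 0 \<omega>))"
proof -
  interpret bounded_test g by (rule g)
  let ?X = "occ_integral g r x 0"
  define f where "f p \<omega> = (- l * ?X \<omega>) ^ p /\<^sub>R fact p" for p \<omega>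
  have X_le: "\<bar>?X \<omega>\<bar> \<le> r" for \<omega>
    using abs_occ_integral_le[OF g_measurable g_le r] by simp
  have f_le: "norm (f p \<omega>) \<le> (\<bar>l\<bar> * r) ^ p /\<^sub>R fact p" for p \<omega>
  proof -
    have "\<bar>- l * ?X \<omega>\<bar> ^ p \<le> (\<bar>l\<bar> * r) ^ p"
      using X_le[of \<omega>] by (intro power_mono) (auto simp: abs_mult intro!: mult_left_mono)
    then show ?thesis by (simp add: f_def power_abs abs_mult field_simps)
  qed
  have f_meas [measurable]: "f p \<in> borel_measurable M" for p unfolding f_def by measurable
  have f_int: "integrable M (f p)" for p
    by (rule integrable_const_bound[where B = "(\<bar>l\<bar> * r) ^ p /\<^sub>R fact p"]) (use f_le in auto)
  have "(\<lambda>p. expectation (f p)) sums expectation (\<lambda>\<omega>. \<Sum>p. f p \<omega>)"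
  proof (rule sums_integral[OF f_int])
    show "AE \<omega> in M. summable (\<lambda>p. norm (f p \<omega>))"
      unfolding f_def by (intro AE_I2 summable_norm_exp)
    show "summable (\<lambda>p. expectation (\<lambda>\<omega>. norm (f p \<omega>)))"
    proof (rule summable_comparison_test'[OF summable_exp_generic[of "\<bar>l\<bar> * r"]])
      fix p
      have "expectation (\<lambda>\<omega>. norm (f p \<omega>)) \<le> expectation (\<lambda>\<omega>. (\<bar>l\<bar> * r) ^ p /\<^sub>R fact p)"
        by (intro integral_mono integrable_norm f_int f_le) simp
      then show "norm (expectation (\<lambda>\<omega>. norm (f p \<omega>))) \<le> (\<bar>l\<bar> * r) ^ p /\<^sub>R fact p"
        by (simp add: prob_space)
    qed
  qed
  moreover have "expectation (f p) = (- l) ^ p * heat_moment g r p 0 x" for p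
  proof -
    have "expectation (f p) = expectation (\<lambda>\<omega>. ((- l) ^ p / fact p) * ?X \<omega> ^ p)"
      unfolding f_def power_mult_distrib by (simp add: divide_inverse mult_ac)
    also have "\<dots> = ((- l) ^ p / fact p) * expectation (\<lambda>\<omega>. ?X \<omega> ^ p)" by simp
    finally show ?thesis using moment_formula[OF g r, of x p] by simp
  qed
  moreover have "(\<Sum>p. f p \<omega>) = exp (- l * ?X \<omega>)" for \<omega>
    unfolding f_def exp_def ..
  ultimately show ?thesis by simp
qed

text \<open>The renewal inequality \<open>l * (\<integral>\<^sub>0\<^sup>T P\<^sub>s (g v)) \<le> 1\<close>, where \<open>v\<close> is the Laplace transform of the
  occupation functional, forces \<open>v\<close> to be small because the Green function grows like \<open>sqrt T\<close>.\<close>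

lemma laplace_occ_le:
  assumes T: "1 \<le> T" and l: "0 < l"
  shows "expectation (\<lambda>\<omega>. exp (- l * occ (\<lambda>t. B t \<omega>) T {-1..<1})) \<le> 18 / (l * sqrt T)"
proof -
  \<comment> \<open>A smaller interval than the one in the statement: if \<open>z\<close> and
    \<open>z + B u\<close> both lie in \<open>{0..<1}\<close>, then \<open>B u\<close> lies in
    \<open>{-1..<1}\<close>. Hence the transform started at any such \<open>z\<close> is at least
    \<open>w\<close>.\<close>
  define g :: "real \<Rightarrow> real" where "g = indicator {0..<1}"
  have g: "bounded_test g" by unfold_locales (auto simp: g_def indicator_def)
  interpret bounded_test g by (rule g)
  have g0: "0 \<le> g z" for z by (simp add: g_def)
  define w where "w = expectation (\<lambda>\<omega>. exp (- l * occ (\<lambda>t. B t \<omega>) T {-1..<1}))"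
  have w0: "0 \<le> w" unfolding w_def by (intro Bochner_Integration.integral_nonneg) auto
  define k where "k u z = (if u \<le> T then heat (u - 0) (z - 0) * g z else 0)" for u z
  have k0: "0 \<le> k u z" for u z using g0 by (simp add: k_def)
  have [measurable]: "(\<lambda>(u, z). k u z) \<in> borel_measurable (borel \<Otimes>\<^sub>M borel)" unfolding k_def by measurable
  define v where "v u z = (\<Sum>p. (- l) ^ p * heat_moment g T p u z)" for u z
  have v_sums: "(\<lambda>p. (- l) ^ p * heat_moment g T p u z) sums v u z"
    and v_ge: "z \<in> {0..<1} \<Longrightarrow> w \<le> v u z" if u: "0 \<le> u" "u \<le> T" for u z
  proof -
    have shift: "heat_moment g T p u z = heat_moment g (T - u) p 0 z" for p
      using heat_moment_shift[of T p 0 u z] by simp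
    have s: "(\<lambda>p. (- l) ^ p * heat_moment g T p u z) sums expectation (\<lambda>\<omega>. exp (- l * occ_integral g (T - u) z 0 \<omega>))"
      unfolding shift using u by (intro expectation_exp_occ_integral g) auto
    then show "(\<lambda>p. (- l) ^ p * heat_moment g T p u z) sums v u z" unfolding v_def by (simp add: sums_iff)
    assume z: "z \<in> {0..<1}"
    have "w \<le> expectation (\<lambda>\<omega>. exp (- l * occ_integral g (T - u) z 0 \<omega>))"
      unfolding w_def
    proof (rule integral_mono)
      show "integrable M (\<lambda>\<omega>. exp (- l * occ (\<lambda>t. B t \<omega>) T {-1..<1}))"
        by (rule integrable_const_bound[where B = 1]) (use l in \<open>auto simp: occ_def\<close>)
      have nn: "0 \<le> occ_integral g (T - u) z 0 \<omega>" for \<omega>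
        unfolding occ_integral_def using g0 by (intro Bochner_Integration.integral_nonneg) auto
      show "integrable M (\<lambda>\<omega>. exp (- l * occ_integral g (T - u) z 0 \<omega>))"
        by (rule integrable_const_bound[where B = 1]) (use l nn in auto)
      fix \<omega>
      have "occ_integral g (T - u) z 0 \<omega> \<le> occ (\<lambda>t. B t \<omega>) T {-1..<1}"
        unfolding occ_eq_occ_integral occ_integral_def
        by (rule integral_mono; (rule integrable_indicator_Icc[where C = 1])?)
          (use u z in \<open>auto simp: g_def indicator_def\<close>)
      then show "exp (- l * occ (\<lambda>t. B t \<omega>) T {-1..<1}) \<le> exp (- l * occ_integral g (T - u) z 0 \<omega>)"
        using l by simp
    qed
    also have "\<dots> = v u z" using s unfolding v_def by (simp add: sums_iff)
    finally show "w \<le> v u z" .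
  qed
  define f where "f p = (\<lambda>(u, z). (- l) ^ p * (k u z * heat_moment g T p u z))" for p
  have fk: "f p = (\<lambda>x. (- l) ^ p * (case x of (u, z) \<Rightarrow> if u \<le> T then heat (u - 0) (z - 0) * g z * heat_moment g T p u z else 0))" for p
    by (auto simp: f_def k_def)
  have f_int: "integrable lborel (f p)" for p
    unfolding fk by (intro integrable_mult_right heat_moment_bound)
  have int_f: "integral\<^sup>L lborel (f p) = (- l) ^ p * heat_moment g T (Suc p) 0 0" for p
    unfolding fk by simp
  \<comment> \<open>A majorant summable in \<open>p\<close>, which justifies exchanging the series
    with the double integral.\<close>
  have f_norm: "(\<integral>x. norm (f p x) \<partial>lborel) \<le> T * ((l * T) ^ p /\<^sub>R fact p)" for p
  proof -
    have meas [measurable]: "f p \<in> borel_measurable lborel" using f_int by (rule borel_measurable_integrable)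
    have "(\<integral>\<^sup>+x. ennreal \<bar>norm (f p x)\<bar> \<partial>lborel) \<le>
       (\<integral>\<^sup>+x. ennreal (l ^ p) * (case x of (u, z) \<Rightarrow> ennreal \<bar>if u \<le> T then heat (u - 0) (z - 0) * g z * (max 0 (T - u) ^ p / fact p) else 0\<bar>) \<partial>lborel)"
    proof (rule nn_integral_mono)
      fix x :: "real \<times> real"
      obtain u z where x: "x = (u, z)" by (cases x)
      have "l ^ p * (k u z * \<bar>heat_moment g T p u z\<bar>) \<le> l ^ p * (k u z * (max 0 (T - u) ^ p / fact p))"
        using heat_moment_bound(2)[of T p u z] l k0 by (intro mult_left_mono) auto
      then show "ennreal \<bar>norm (f p x)\<bar> \<le> ennreal (l ^ p) * (case x of (u, z) \<Rightarrow> ennreal \<bar>if u \<le> T then heat (u - 0) (z - 0) * g z * (max 0 (T - u) ^ p / fact p) else 0\<bar>)"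
        using l g0 k0 unfolding x f_def k_def
        by (cases "u \<le> T") (auto simp: abs_mult power_abs ennreal_mult[symmetric] mult_ac intro!: ennreal_leI)
    qed
    also have "\<dots> = ennreal (l ^ p) * (\<integral>\<^sup>+(u, z). ennreal \<bar>if u \<le> T then heat (u - 0) (z - 0) * g z * (max 0 (T - u) ^ p / fact p) else 0\<bar> \<partial>lborel)"
      by (rule nn_integral_cmult) (simp add: borel_prod[symmetric])
    also have "\<dots> \<le> ennreal (l ^ p) * ennreal (max 0 (T - 0) ^ Suc p / fact (Suc p))"
      by (intro mult_left_mono nn_integral_heat_moment_kernel) simp
    also have "\<dots> = ennreal (l ^ p * (T ^ Suc p / fact (Suc p)))"
      using l T by (simp add: ennreal_mult[symmetric] max_def del: power_Suc fact_Suc)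
    finally have "(\<integral>x. norm (f p x) \<partial>lborel) \<le> l ^ p * (T ^ Suc p / fact (Suc p))"
      using integrable_abs_integral_le(2)[of "\<lambda>x. norm (f p x)" lborel "l ^ p * (T ^ Suc p / fact (Suc p))"] l T by auto
    also have "\<dots> \<le> l ^ p * (T ^ Suc p / fact p)"
      using l T by (intro mult_left_mono divide_left_mono fact_mono) auto
    also have "\<dots> = T * ((l * T) ^ p /\<^sub>R fact p)" by (simp add: power_mult_distrib divide_inverse mult_ac)
    finally show ?thesis .
  qed
  have sum_f: "(\<Sum>p. f p (u, z)) = k u z * v u z" for u z
  proof (cases "0 \<le> u \<and> u \<le> T")
    case True
    then have "(\<lambda>p. k u z * ((- l) ^ p * heat_moment g T p u z)) sums (k u z * v u z)"
      using v_sums by (intro sums_mult) auto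
    then show ?thesis by (simp add: f_def sums_iff mult_ac)
  next
    case False
    then have "k u z = 0" by (auto simp: k_def heat_def)
    then show ?thesis by (simp add: f_def)
  qed
  have f_sums: "(\<lambda>p. integral\<^sup>L lborel (f p)) sums (\<integral>(u, z). k u z * v u z \<partial>lborel)"
    and kv_int: "integrable lborel (\<lambda>(u, z). k u z * v u z)"
  proof -
    have eq: "(\<lambda>x. \<Sum>p. f p x) = (\<lambda>(u, z). k u z * v u z)" using sum_f by auto
    have 1: "AE x in lborel. summable (\<lambda>p. norm (f p x))"
    proof (rule AE_I2)
      fix x :: "real \<times> real"
      obtain u z where x: "x = (u, z)" by (cases x)
      show "summable (\<lambda>p. norm (f p x))"
      proof (rule summable_comparison_test'[OF summable_mult[OF summable_exp_generic[of "l * max 0 (T - u)"]]])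
        fix p
        have "l ^ p * (k u z * \<bar>heat_moment g T p u z\<bar>) \<le> l ^ p * (k u z * (max 0 (T - u) ^ p / fact p))"
          using heat_moment_bound(2)[of T p u z] l k0 by (intro mult_left_mono) auto
        then show "norm (norm (f p x)) \<le> k u z * ((l * max 0 (T - u)) ^ p /\<^sub>R fact p)"
          using l k0 unfolding x f_def by (simp add: abs_mult power_abs power_mult_distrib divide_inverse mult_ac)
      qed
    qed
    have 2: "summable (\<lambda>p. \<integral>x. norm (f p x) \<partial>lborel)"
    proof (rule summable_comparison_test'[OF summable_mult[OF summable_exp_generic[of "l * T"]]])
      show "norm (\<integral>x. norm (f p x) \<partial>lborel) \<le> T * ((l * T) ^ p /\<^sub>R fact p)" for p
        using f_norm[of p] by (simp add: Bochner_Integration.integral_nonneg)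
    qed
    show "(\<lambda>p. integral\<^sup>L lborel (f p)) sums (\<integral>(u, z). k u z * v u z \<partial>lborel)"
      using sums_integral[OF f_int 1 2] by (simp add: eq)
    show "integrable lborel (\<lambda>(u, z). k u z * v u z)"
      using integrable_suminf[OF f_int 1 2] by (simp add: eq)
  qed
  \<comment> \<open>The Laplace series from 0 is 1 plus its shifted tail, and the tail is
    \<open>- l\<close> times the integral of \<open>k u z * v u z\<close>. The transform is
    nonnegative.\<close>
  have le1: "l * (\<integral>(u, z). k u z * v u z \<partial>lborel) \<le> 1"
  proof -
    have "(\<lambda>p. - l * integral\<^sup>L lborel (f p)) sums (- l * (\<integral>(u, z). k u z * v u z \<partial>lborel))"
      by (rule sums_mult[OF f_sums])
    then have "(\<lambda>p. (- l) ^ Suc p * heat_moment g T (Suc p) 0 0) sums (- l * (\<integral>(u, z). k u z * v u z \<partial>lborel))"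
      by (simp add: int_f mult_ac del: heat_moment.simps)
    then have "(\<lambda>p. (- l) ^ p * heat_moment g T p 0 0) sums (- l * (\<integral>(u, z). k u z * v u z \<partial>lborel) + 1)"
      by (subst (asm) sums_Suc_iff) simp
    moreover have "(\<lambda>p. (- l) ^ p * heat_moment g T p 0 0) sums expectation (\<lambda>\<omega>. exp (- l * occ_integral g T 0 0 \<omega>))"
      using T by (intro expectation_exp_occ_integral g) auto
    ultimately have "expectation (\<lambda>\<omega>. exp (- l * occ_integral g T 0 0 \<omega>)) = - l * (\<integral>(u, z). k u z * v u z \<partial>lborel) + 1"
      by (rule sums_unique2[symmetric])
    moreover have "0 \<le> expectation (\<lambda>\<omega>. exp (- l * occ_integral g T 0 0 \<omega>))" by (intro Bochner_Integration.integral_nonneg) auto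
    ultimately show ?thesis by simp
  qed
  \<comment> \<open>In the later half of the time interval the kernel from 0 is at least
    \<open>1 / (9 * sqrt T)\<close> on \<open>{0..<1}\<close>; multiplied by the area
    \<open>T / 2\<close> this produces the constant 18.\<close>
  define R where "R = {T / 2..T} \<times> {0..<1 :: real}"
  have R: "emeasure lborel R = ennreal (T / 2)"
  proof -
    have "emeasure lborel R = emeasure (lborel \<Otimes>\<^sub>M lborel) R" by (simp add: lborel_prod)
    also have "\<dots> = emeasure lborel {T / 2..T} * emeasure lborel {0..<1 :: real}"
      unfolding R_def by (rule lborel.emeasure_pair_measure_Times) auto
    finally show ?thesis using T by simp
  qed
  have R_sets: "R \<in> sets lborel" unfolding R_def by (simp add: borel_prod[symmetric])
  \<comment> \<open>The 9 is a product of 3 from \<open>exp (- 1) \<ge> 1 / 3\<close> and 3 from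
    \<open>2 * pi \<le> 9\<close>; the assumption \<open>1 \<le> T\<close> keeps
    \<open>z\<^sup>2 / (2 * u)\<close> below 1.\<close>
  have heat_ge: "1 / (9 * sqrt T) \<le> heat u z" if "u \<in> {T / 2..T}" "z \<in> {0..<1}" for u z
  proof -
    have u: "0 < u" using that T by auto
    have z2: "z\<^sup>2 \<le> 1" using that by (auto simp: power_le_one)
    have "z\<^sup>2 / (2 * u) \<le> 1" using z2 that T u by (simp add: divide_le_eq)
    then have "exp (- 1) \<le> exp (- z\<^sup>2 / (2 * u))" by simp
    moreover have "1 / 3 \<le> exp (- 1 :: real)" using exp_le by (simp add: exp_minus field_simps)
    ultimately have e: "1 / 3 \<le> exp (- z\<^sup>2 / (2 * u))" by linarith
    have s: "sqrt (2 * pi * u) \<le> 3 * sqrt T"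
    proof -
      have "2 * pi * u \<le> 9 * T" using pi_less_4 that T by (intro mult_mono) auto
      then have "sqrt (2 * pi * u) \<le> sqrt (9 * T)" by simp
      also have "\<dots> = 3 * sqrt T" using real_sqrt_mult[of 9 T] real_sqrt_abs[of 3] by simp
      finally show ?thesis .
    qed
    have "1 / (9 * sqrt T) = (1 / 3) / (3 * sqrt T)" by simp
    also have "\<dots> \<le> exp (- z\<^sup>2 / (2 * u)) / sqrt (2 * pi * u)"
      using e s u T by (intro frac_le) auto
    finally show ?thesis using u by (simp add: heat_def)
  qed
  have "w / (9 * sqrt T) * (T / 2) = (\<integral>x. w / (9 * sqrt T) * indicator R x \<partial>lborel)"
    using R T by (simp add: measure_def)
  also have "\<dots> \<le> (\<integral>(u, z). k u z * v u z \<partial>lborel)"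
  proof (rule integral_mono[OF _ kv_int])
    show "integrable lborel (\<lambda>x. w / (9 * sqrt T) * indicator R x)"
      using R R_sets by (intro integrable_mult_right integrable_real_indicator) auto
    fix x :: "real \<times> real"
    obtain u z where x: "x = (u, z)" by (cases x)
    consider "x \<in> R" | "x \<notin> R" "0 < u" "u \<le> T" "z \<in> {0..<1}" | "x \<notin> R" "k u z = 0"
    proof -
      have "k u z = 0" if "\<not> (0 < u \<and> u \<le> T \<and> z \<in> {0..<1})"
        using that unfolding k_def g_def heat_def by auto
      then show thesis using that by blast
    qed
    then show "w / (9 * sqrt T) * indicator R x \<le> (case x of (u, z) \<Rightarrow> k u z * v u z)"
    proof cases
      case 1
      then have uz: "u \<in> {T / 2..T}" "z \<in> {0..<1}" by (auto simp: R_def x)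
      have "1 / (9 * sqrt T) * w \<le> heat u z * v u z"
        using heat_ge[OF uz] v_ge[of u z] uz T w0 by (intro mult_mono) auto
      then show ?thesis using 1 uz by (simp add: x k_def g_def)
    next
      case 2
      then show ?thesis using k0[of u z] v_ge[of u z] w0 by (auto simp: x intro!: mult_nonneg_nonneg)
    qed (simp add: x)
  qed
  finally have le2: "l * (w / (9 * sqrt T) * (T / 2)) \<le> 1"
    using le1 l mult_left_mono[of _ _ l] by (meson less_imp_le order_trans)
  have "T / sqrt T = sqrt T" using T by (simp add: real_div_sqrt)
  moreover have "w / (9 * sqrt T) * (T / 2) = w * (T / sqrt T) / 18" by (simp add: field_simps)
  ultimately have e: "w / (9 * sqrt T) * (T / 2) = w * sqrt T / 18" by (simp only:)
  have "l * (w * sqrt T / 18) \<le> 1" using le2 by (simp only: e)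
  then show ?thesis unfolding w_def[symmetric] using l T by (simp add: field_simps)
qed

text \<open>Exponential Markov inequality with \<open>l = 1 / m\<close>, for which the exponential
  is at least \<open>exp (- 1) \<ge> 1 / 3\<close> on the event; thus 54 is three times 18.\<close>

lemma prob_occ_small:
  assumes T: "1 \<le> T" and m: "0 < m"
  shows "prob {\<omega> \<in> space M. occ (\<lambda>t. B t \<omega>) T {-1..<1} \<le> m} \<le> 54 * m / sqrt T"
proof -
  have "prob {\<omega> \<in> space M. occ (\<lambda>t. B t \<omega>) T {-1..<1} \<le> m}
      \<le> expectation (\<lambda>\<omega>. exp (- (1 / m) * occ (\<lambda>t. B t \<omega>) T {-1..<1})) / (1 / 3)"
  proof (rule prob_le_expectation_div)
    show "integrable M (\<lambda>\<omega>. exp (- (1 / m) * occ (\<lambda>t. B t \<omega>) T {-1..<1}))"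
      by (rule integrable_const_bound[where B = 1]) (use m in \<open>auto simp: occ_def\<close>)
    fix \<omega> assume "\<omega> \<in> {\<omega> \<in> space M. occ (\<lambda>t. B t \<omega>) T {-1..<1} \<le> m}"
    then have "- 1 \<le> - (1 / m) * occ (\<lambda>t. B t \<omega>) T {-1..<1}" using m by simp
    then have "exp (- 1) \<le> exp (- (1 / m) * occ (\<lambda>t. B t \<omega>) T {-1..<1})" by (simp only: exp_le_cancel_iff)
    moreover have "1 / 3 \<le> exp (- 1 :: real)" using exp_le by (simp add: exp_minus field_simps)
    ultimately show "1 / 3 \<le> exp (- (1 / m) * occ (\<lambda>t. B t \<omega>) T {-1..<1})" by linarith
  qed auto
  also have "\<dots> \<le> 18 / (1 / m * sqrt T) / (1 / 3)"
    using laplace_occ_le[OF T, of "1 / m"] m by (intro divide_right_mono) auto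
  finally show ?thesis using m by simp
qed

end

section \<open>Scales at which the local time is uniformly large\<close>

context continuous_brownian_motion
begin

text \<open>Tailored to \<open>L_lower\<close> with \<open>c = S\<^sup>2\<close> and \<theta> =
  19/20: the loss there is \<open>(N + 21) * S\<^sup>2\<close>, so that the 22 leaves at least
  \<open>S\<^sup>2\<close> for the local time at every level up to \<open>N\<close>.\<close>

definition good_scale :: "nat \<Rightarrow> nat \<Rightarrow> 'a \<Rightarrow> bool" where
  "good_scale N S \<omega> \<longleftrightarrow>
     (\<forall>n k. \<bar>k\<bar> \<le> int N * 2 ^ n \<longrightarrow> osc n k (real S ^ 6) \<omega> \<le> (real S)\<^sup>2 * (19 / 20) ^ n) \<and>
     2 * (real N + 22) * (real S)\<^sup>2 < occ (\<lambda>t. B t \<omega>) (real S ^ 6) {-1..<1}"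

lemma prob_bad_scale:
  assumes N: "1 \<le> N"
  obtains C where "\<And>S. 1 \<le> S \<Longrightarrow> prob {\<omega> \<in> space M. \<not> good_scale N S \<omega>} \<le> C / real S"
proof -
  define K :: real where "K = fact 8 * 48 ^ 4"
  have K0: "0 \<le> K" by (simp add: K_def)
  \<comment> \<open>Only one time is involved here, so level \<open>n\<close> has about
    \<open>2 ^ n\<close> points and the ratio is \<open>2 / 16\<close> instead of
    \<open>8 / 16\<close>, again divided by \<open>(19 / 20) ^ 8\<close>.\<close>
  define q :: real where "q = 1 / (8 * (19 / 20) ^ 8)"
  have q: "0 \<le> q" "q < 1" by (simp_all add: q_def power_divide)
  define C where "C = 3 * real N * K / (1 - q) + 54 * (2 * (real N + 22))"
  have "prob {\<omega> \<in> space M. \<not> good_scale N S \<omega>} \<le> C / real S" if S: "1 \<le> S" for S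
  proof -
    define T where "T = real S ^ 6"
    have T: "1 \<le> T" using S by (simp add: T_def)
    have sqrtT: "sqrt T = real S ^ 3"
      by (rule real_sqrt_unique) (simp_all add: T_def flip: power_mult)
    define U where "U n = (\<Union>k \<in> {k. \<bar>k\<bar> \<le> int N * 2 ^ n}. {\<omega> \<in> space M. (real S)\<^sup>2 * (19 / 20) ^ n < osc n k T \<omega>})" for n
    define D where "D = {\<omega> \<in> space M. occ (\<lambda>t. B t \<omega>) T {-1..<1} \<le> 2 * (real N + 22) * (real S)\<^sup>2}"
    have U_sets [measurable]: "U n \<in> events" for n
      unfolding U_def by (intro sets.finite_UN finite_dyadic) auto
    have D_sets [measurable]: "D \<in> events" unfolding D_def by measurable
    have U_le: "prob (U n) \<le> 3 * real N * K / real S * q ^ n" for n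
    proof -
      have "prob (U n) \<le> (\<Sum>k \<in> {k. \<bar>k\<bar> \<le> int N * 2 ^ n}. prob {\<omega> \<in> space M. (real S)\<^sup>2 * (19 / 20) ^ n < osc n k T \<omega>})"
        unfolding U_def by (rule finite_measure_subadditive_finite) (auto intro!: finite_dyadic)
      also have "\<dots> \<le> (\<Sum>k \<in> {k. \<bar>k\<bar> \<le> int N * 2 ^ n}. K * T\<^sup>2 / (16 ^ n * ((real S)\<^sup>2 * (19 / 20) ^ n) ^ 8))"
        unfolding K_def using S T by (intro sum_mono dens_diff_tail) auto
      also have "\<dots> = real (card {k. \<bar>k\<bar> \<le> int N * 2 ^ n}) * (K * T\<^sup>2 / (16 ^ n * ((real S)\<^sup>2 * (19 / 20) ^ n) ^ 8))"
        by simp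
      also have "\<dots> \<le> (3 * real N * 2 ^ n) * (K * T\<^sup>2 / (16 ^ n * ((real S)\<^sup>2 * (19 / 20) ^ n) ^ 8))"
        using K0 by (intro mult_right_mono card_dyadic_le N) auto
      also have "\<dots> = 3 * real N * K * (1 / real S ^ 4) * q ^ n"
      proof -
        have a: "(2 :: real) ^ n * 8 ^ n = 16 ^ n" by (simp flip: power_mult_distrib)
        have b: "(1 / (8 * c ^ 8)) ^ n = 2 ^ n / (16 ^ n * (c ^ n) ^ 8)" for c :: real
        proof -
          have "(c ^ n) ^ 8 = (c ^ 8) ^ n" by (simp add: mult.commute flip: power_mult)
          then show ?thesis unfolding a[symmetric] by (simp add: power_divide power_mult_distrib)
        qed
        have *: "T\<^sup>2 * real S ^ 4 = ((real S)\<^sup>2) ^ 8"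
          by (simp add: T_def flip: power_mult power_add)
        have d: "T\<^sup>2 / ((real S)\<^sup>2) ^ 8 = 1 / real S ^ 4"
          unfolding *[symmetric] using T S by simp
        show ?thesis unfolding q_def b d[symmetric] power_mult_distrib by (simp add: mult_ac)
      qed
      \<comment> \<open>The oscillation bound is of order \<open>1 / S ^ 4\<close>; it is weakened
        to the order \<open>1 / S\<close> of the occupation time bound.\<close>
      also have "\<dots> \<le> 3 * real N * K * (1 / real S) * q ^ n"
        using S K0 q power_increasing[of 1 4 "real S"]
        by (intro mult_right_mono mult_left_mono divide_left_mono) auto
      finally show ?thesis by simp
    qed
    have sumU: "summable (\<lambda>n. 3 * real N * K / real S * q ^ n)"
      using q by (intro summable_mult summable_geometric) auto
    have sumP: "summable (\<lambda>n. prob (U n))"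
      by (rule summable_comparison_test'[OF sumU]) (use U_le in auto)
    have "prob (\<Union>n. U n) \<le> (\<Sum>n. prob (U n))"
      using sumP by (intro finite_measure_subadditive_countably) auto
    also have "\<dots> \<le> (\<Sum>n. 3 * real N * K / real S * q ^ n)"
      by (rule suminf_le[OF U_le sumP sumU])
    also have "\<dots> = 3 * real N * K / real S * (1 / (1 - q))"
      using q by (subst suminf_mult) (auto simp: suminf_geometric intro!: summable_geometric)
    finally have 1: "prob (\<Union>n. U n) \<le> 3 * real N * K / (1 - q) / real S" by (simp add: mult_ac)
    have "prob D \<le> 54 * (2 * (real N + 22) * (real S)\<^sup>2) / sqrt T"
      unfolding D_def using S by (intro prob_occ_small T) auto
    also have "\<dots> = 54 * (2 * (real N + 22)) / real S"
      using S by (simp add: sqrtT power2_eq_square power3_eq_cube)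
    finally have 2: "prob D \<le> 54 * (2 * (real N + 22)) / real S" .
    have "{\<omega> \<in> space M. \<not> good_scale N S \<omega>} \<subseteq> (\<Union>n. U n) \<union> D"
      unfolding good_scale_def U_def D_def T_def by (auto simp: not_le not_less)
    then have "prob {\<omega> \<in> space M. \<not> good_scale N S \<omega>} \<le> prob ((\<Union>n. U n) \<union> D)"
      by (intro finite_measure_mono) auto
    also have "\<dots> \<le> prob (\<Union>n. U n) + prob D" by (intro measure_Un_le) auto
    also have "\<dots> \<le> C / real S" using 1 2 by (simp add: C_def add_divide_distrib)
    finally show ?thesis .
  qed
  then show thesis by (rule that)
qed

lemma good_scale_measurable [measurable]: "Measurable.pred M (good_scale N S)"
  unfolding good_scale_def by measurable

text \<open>The bounds \<open>C / S\<close> are not summable, but infinitely many good scales are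
  enough: the event that all scales from \<open>m\<close> on are bad is contained in each single bad
  event, so its probability is below every \<open>C / S\<close>.\<close>

lemma AE_good_scale:
  assumes N: "1 \<le> N"
  shows "AE \<omega> in M. \<forall>m. \<exists>S\<ge>m. 1 \<le> S \<and> good_scale N S \<omega>"
  unfolding AE_all_countable
proof
  fix m
  obtain C where C: "\<And>S. 1 \<le> S \<Longrightarrow> prob {\<omega> \<in> space M. \<not> good_scale N S \<omega>} \<le> C / real S"
    using prob_bad_scale[OF N] by blast
  define A where "A = {\<omega> \<in> space M. \<forall>S. m \<le> S \<and> 1 \<le> S \<longrightarrow> \<not> good_scale N S \<omega>}"
  have A [measurable]: "A \<in> events" unfolding A_def by measurable
  have A_le: "prob A \<le> C / real S" if "m \<le> S" "1 \<le> S" for S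
  proof -
    have "prob A \<le> prob {\<omega> \<in> space M. \<not> good_scale N S \<omega>}"
      using that by (intro finite_measure_mono) (auto simp: A_def)
    then show ?thesis using C[OF that(2)] by linarith
  qed
  have "(\<lambda>S. C / real S) \<longlonglongrightarrow> 0" by (rule lim_const_over_n)
  then have "prob A \<le> 0"
    by (rule tendsto_lowerbound) (auto intro!: eventually_sequentiallyI[of "max m 1"] A_le)
  then have "prob A = 0" using measure_nonneg[of M A] by linarith
  then have "A \<in> null_sets M" using A by (auto simp: emeasure_eq_measure)
  then have "AE \<omega> in M. \<omega> \<notin> A" by (rule AE_not_in)
  then show "AE \<omega> in M. \<exists>S\<ge>m. 1 \<le> S \<and> good_scale N S \<omega>"
    using AE_space by eventually_elim (auto simp: A_def)
qed

lemma AE_bricklayer: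
  "AE \<omega> in M. continuous_on {0..} (bricklayer (\<lambda>t. B t \<omega>)) \<and>
     bricklayer (\<lambda>t. B t \<omega>) ` {0..} = UNIV \<times> {0..}"
proof -
  \<comment> \<open>\<open>Suc N\<close> because the probabilistic lemmas assume
    \<open>1 \<le> N\<close>; the box of size \<open>N\<close> is contained in the larger
    one.\<close>
  have "AE \<omega> in M. \<forall>N. \<exists>n\<^sub>0. \<forall>n\<ge>n\<^sub>0. \<forall>k. \<bar>k\<bar> \<le> int (Suc N) * 2 ^ n \<longrightarrow> (\<forall>j \<le> Suc N * 4 ^ n.
      osc n k (real j / 4 ^ n) \<omega> \<le> (19 / 20) ^ n)"
    unfolding AE_all_countable by (intro allI AE_regular) simp
  moreover have "AE \<omega> in M. \<forall>N. \<forall>m. \<exists>S\<ge>m. 1 \<le> S \<and> good_scale (Suc N) S \<omega>"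
    unfolding AE_all_countable[where P = "\<lambda>N \<omega>. \<forall>m. \<exists>S\<ge>m. 1 \<le> S \<and> good_scale (Suc N) S \<omega>"]
    by (intro allI AE_good_scale) simp
  ultimately show ?thesis
  proof eventually_elim
    case (elim \<omega>)
    interpret path: regular_path "\<lambda>t. B t \<omega>" "19 / 20"
    proof
      show "continuous_on UNIV (\<lambda>t. B t \<omega>)" by (rule paths)
      fix N
      obtain n\<^sub>0 where n0: "\<And>n k j. n \<ge> n\<^sub>0 \<Longrightarrow> \<bar>k\<bar> \<le> int (Suc N) * 2 ^ n \<Longrightarrow> j \<le> Suc N * 4 ^ n \<Longrightarrow>
          osc n k (real j / 4 ^ n) \<omega> \<le> (19 / 20) ^ n"
        using elim(1) by blast
      show "\<exists>n\<^sub>0. \<forall>n\<ge>n\<^sub>0. \<forall>k. \<bar>k\<bar> \<le> int N * 2 ^ n \<longrightarrow> (\<forall>j\<le>N * 4 ^ n. osc n k (real j / 4 ^ n) \<omega> \<le> (19 / 20) ^ n)"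
      proof (intro exI[of _ n\<^sub>0] allI impI n0)
        fix n k j assume "\<bar>k\<bar> \<le> int N * 2 ^ n"
        also have "int N * 2 ^ n \<le> int (Suc N) * 2 ^ n" by (intro mult_right_mono) auto
        finally show "\<bar>k\<bar> \<le> int (Suc N) * 2 ^ n" .
      next
        fix n k j assume "j \<le> N * 4 ^ n"
        then show "j \<le> Suc N * 4 ^ n" by simp
      qed
    qed auto
    have unbdd: "\<exists>t\<ge>0. m < path.L y t" for y m
    proof -
      obtain N :: nat where "\<bar>y\<bar> \<le> real N" using real_arch_simple by blast
      then have N: "\<bar>y\<bar> \<le> real (Suc N)" by simp
      obtain m' :: nat where m': "m < real m'" using reals_Archimedean2 by blast
      obtain S where S: "S \<ge> m'" "1 \<le> S" "good_scale (Suc N) S \<omega>" using elim(2) by blast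
      have "occ (\<lambda>t. B t \<omega>) (real S ^ 6) {-1..<1} / 2 - (real (Suc N) + 1 + 1 / (1 - 19 / 20)) * (real S)\<^sup>2 \<le> path.L y (real S ^ 6)"
        by (rule path.L_lower[OF _ _ N]) (use S in \<open>auto simp: good_scale_def\<close>)
      moreover have "2 * (real (Suc N) + 22) * (real S)\<^sup>2 < occ (\<lambda>t. B t \<omega>) (real S ^ 6) {-1..<1}"
        using S by (simp add: good_scale_def)
      \<comment> \<open>Here \<open>1 / (1 - 19 / 20) = 20\<close>, so the loss is one multiple of
        \<open>S\<^sup>2\<close> less than half the occupation time guarantees.\<close>
      ultimately have "(real S)\<^sup>2 \<le> path.L y (real S ^ 6)" by (simp add: algebra_simps)
      moreover have "real S * 1 \<le> real S * real S" using S by (intro mult_left_mono) auto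
      moreover have "real m' \<le> real S" using S by simp
      ultimately have "m < path.L y (real S ^ 6)" using m' unfolding power2_eq_square by linarith
      then show ?thesis by (intro exI[of _ "real S ^ 6"]) auto
    qed
    from path.bricklayer_surj[OF path.L_window path.L_continuous unbdd]
    show ?case by blast
  qed
qed

end

section \<open>Passage to a version with continuous paths\<close>

text \<open>Independence means that the joint law is the product of the marginal laws, and neither
  side changes under modification on a null set. The empty family is treated apart because that
  criterion concerns nonempty index sets.\<close>

lemma (in prob_space) indep_vars_AE_cong:
  assumes X: "indep_vars N X I" and Y: "\<And>i. i \<in> I \<Longrightarrow> Y i \<in> measurable M (N i)"
    and I: "finite I" and ae: "\<And>i. i \<in> I \<Longrightarrow> AE \<omega> in M. X i \<omega> = Y i \<omega>"
  shows "indep_vars N Y I"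
proof (cases "I = {}")
  case True
  then show ?thesis by (simp add: indep_vars_def indep_sets_def)
next
  case False
  have X': "\<And>i. i \<in> I \<Longrightarrow> X i \<in> measurable M (N i)" using X by (simp add: indep_vars_def)
  have "AE \<omega> in M. \<forall>i\<in>I. X i \<omega> = Y i \<omega>" using I ae by (simp add: AE_finite_all)
  then have "AE \<omega> in M. (\<lambda>i\<in>I. X i \<omega>) = (\<lambda>i\<in>I. Y i \<omega>)"
    by eventually_elim auto
  then have "distr M (PiM I N) (\<lambda>\<omega>. \<lambda>i\<in>I. Y i \<omega>) = distr M (PiM I N) (\<lambda>\<omega>. \<lambda>i\<in>I. X i \<omega>)"
    using X' Y by (intro distr_cong_AE) (auto intro!: measurable_restrict elim!: eventually_mono)
  also have "\<dots> = PiM I (\<lambda>i. distr M (N i) (X i))"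
    using indep_vars_iff_distr_eq_PiM'[where M' = N and X = X, OF False X'] X by blast
  also have "\<dots> = PiM I (\<lambda>i. distr M (N i) (Y i))"
    using X' Y ae by (intro PiM_cong distr_cong_AE) auto
  finally show ?thesis using indep_vars_iff_distr_eq_PiM'[where M' = N and X = Y, OF False Y] by blast
qed

lemma bricklayer_cong:
  assumes "\<And>t. 0 \<le> t \<Longrightarrow> b t = b' t" and "0 \<le> t"
  shows "bricklayer b t = bricklayer b' t"
proof -
  have eq: "b t = b' t" using assms by simp
  have "{u \<in> {0..t}. \<bar>b u - b' t\<bar> < \<epsilon>} = {u \<in> {0..t}. \<bar>b' u - b' t\<bar> < \<epsilon>}" for \<epsilon>
    by (rule Collect_cong) (auto simp: assms(1))
  then show ?thesis unfolding bricklayer_def local_time_def eq by (simp only:)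
qed

text \<open>The set of bad paths need not be measurable, so it is first enclosed in a measurable
  null set. On that set the new process is 0, and \<open>max 0 t\<close> extends the remaining paths
  continuously to negative times.\<close>

lemma continuous_modification:
  assumes "standard_brownian_motion M B"
  obtains B' where "continuous_brownian_motion M B'" "AE \<omega> in M. \<forall>t\<ge>0. B' t \<omega> = B t \<omega>"
proof -
  interpret standard_brownian_motion M B by (rule assms)
  have "AE \<omega> in M. B 0 \<omega> = 0 \<and> continuous_on {0..} (\<lambda>t. B t \<omega>)"
    using start continuous_paths by eventually_elim simp
  then obtain N where N: "{\<omega> \<in> space M. \<not> (B 0 \<omega> = 0 \<and> continuous_on {0..} (\<lambda>t. B t \<omega>))} \<subseteq> N"
    "emeasure M N = 0" "N \<in> sets M" by (rule AE_E)
  define G where "G = space M - N"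
  have G [measurable]: "G \<in> events" using N by (simp add: G_def)
  have G_good: "B 0 \<omega> = 0 \<and> continuous_on {0..} (\<lambda>t. B t \<omega>)" if "\<omega> \<in> G" for \<omega>
    using that N(1) by (auto simp: G_def)
  have "AE \<omega> in M. \<omega> \<notin> N" using N by (intro AE_not_in) auto
  then have AE_G: "AE \<omega> in M. \<omega> \<in> G" using AE_space by eventually_elim (simp add: G_def)
  define B' where "B' t \<omega> = (if \<omega> \<in> G then B (max 0 t) \<omega> else 0)" for t \<omega>
  have ae: "AE \<omega> in M. \<forall>t\<ge>0. B' t \<omega> = B t \<omega>"
    using AE_G by eventually_elim (simp add: B'_def)
  have meas [measurable]: "B' t \<in> borel_measurable M" for t
  proof -
    have [measurable]: "B (max 0 t) \<in> borel_measurable M" by (rule rv) simp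
    show ?thesis unfolding B'_def by measurable
  qed
  have "continuous_brownian_motion M B'"
  proof
    show "random_variable borel (B' t)" for t by (rule meas)
    then show "random_variable borel (B' t)" for t .
    show "AE \<omega> in M. B' 0 \<omega> = 0" using G_good by (intro AE_I2) (auto simp: B'_def)
    show "B' 0 \<omega> = 0" for \<omega> using G_good by (auto simp: B'_def)
    show cont: "continuous_on UNIV (\<lambda>t. B' t \<omega>)" for \<omega>
    proof (cases "\<omega> \<in> G")
      case True
      have "continuous_on UNIV (\<lambda>t :: real. B (max 0 t) \<omega>)"
        by (rule continuous_on_compose2[of "{0..}" "\<lambda>t. B t \<omega>"])
          (use G_good[OF True] in \<open>auto intro!: continuous_intros\<close>)
      then show ?thesis using True by (simp add: B'_def)
    qed (simp add: B'_def)
    show "AE \<omega> in M. continuous_on {0..} (\<lambda>t. B' t \<omega>)"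
      by (intro AE_I2 continuous_on_subset[OF cont]) auto
    fix \<tau> :: "nat \<Rightarrow> real" and n assume \<tau>: "0 \<le> \<tau> 0" "\<forall>i<n. \<tau> i \<le> \<tau> (Suc i)"
    have \<tau>0: "i \<le> n \<Longrightarrow> 0 \<le> \<tau> i" for i using \<tau> by (induction i) (auto intro: order_trans)
    show "indep_vars (\<lambda>_. borel) (\<lambda>i \<omega>. B' (\<tau> (Suc i)) \<omega> - B' (\<tau> i) \<omega>) {..<n}"
    proof (rule indep_vars_AE_cong[OF independent_increments[OF \<tau>]])
      fix i assume "i \<in> {..<n}"
      then show "AE \<omega> in M. B (\<tau> (Suc i)) \<omega> - B (\<tau> i) \<omega> = B' (\<tau> (Suc i)) \<omega> - B' (\<tau> i) \<omega>"
        using ae \<tau>0[of i] \<tau>0[of "Suc i"] by (auto elim!: eventually_mono)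
    qed auto
  next
    fix s t :: real assume st: "0 \<le> s" "s < t"
    have [measurable]: "B t \<in> borel_measurable M" "B s \<in> borel_measurable M" using st by (auto intro: rv)
    have "distr M lborel (\<lambda>\<omega>. B' t \<omega> - B' s \<omega>) = distr M lborel (\<lambda>\<omega>. B t \<omega> - B s \<omega>)"
      using ae st by (intro distr_cong_AE) (auto elim!: eventually_mono)
    then show "distributed M lborel (\<lambda>\<omega>. B' t \<omega> - B' s \<omega>) (normal_density 0 (sqrt (t - s)))"
      using normal_increments[OF st] by (simp add: distributed_def)
  qed
  then show thesis using ae by (rule that)
qed

theorem theorem1:
  fixes M :: "'a measure" and B :: "real \<Rightarrow> 'a \<Rightarrow> real"
  assumes "standard_brownian_motion M B"
  shows "(AE \<omega> in M. continuous_on {0..} (bricklayer (\<lambda>t. B t \<omega>))) \<and>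
         (AE \<omega> in M. bricklayer (\<lambda>t. B t \<omega>) ` {0..} = UNIV \<times> {0..})"
proof -
  obtain B' where B': "continuous_brownian_motion M B'" and ae: "AE \<omega> in M. \<forall>t\<ge>0. B' t \<omega> = B t \<omega>"
    using continuous_modification[OF assms] .
  interpret continuous_brownian_motion M B' by (rule B')
  have "AE \<omega> in M. continuous_on {0..} (bricklayer (\<lambda>t. B t \<omega>)) \<and>
     bricklayer (\<lambda>t. B t \<omega>) ` {0..} = UNIV \<times> {0..}"
    using AE_bricklayer ae
  proof eventually_elim
    case (elim \<omega>)
    have eq: "bricklayer (\<lambda>t. B t \<omega>) t = bricklayer (\<lambda>t. B' t \<omega>) t" if "t \<in> {0..}" for t
      using elim(2) that by (intro bricklayer_cong) simp_all
    have "continuous_on {0..} (bricklayer (\<lambda>t. B t \<omega>))"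
      by (subst continuous_on_cong[OF refl eq]) (use elim(1) in simp_all)
    moreover have "bricklayer (\<lambda>t. B t \<omega>) ` {0..} = bricklayer (\<lambda>t. B' t \<omega>) ` {0..}"
      by (rule image_cong[OF refl eq])
    ultimately show ?case using elim(1) by simp
  qed
  then show ?thesis by (auto elim: eventually_mono)
qed

end
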